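(* Let $\delta\in(0,1)$ and let $(P_t)_{t\ge0}$ be the semigroup of the process on $\mathbb R_+$ with generator $$Lf(x)=f'(x)+x\,\big(f(\delta x)-f(x)\big),$$ with invariant probability measure $\mu$. For $f\in\mathcal A$ define $$\mathrm{Ent} f=\mu\big(f^2\log f^2\big)-\mu(f^2)\log\mu(f^2).$$ Then there exist $c,r>0$ such that for all $f\in\mathcal A$ and all $t>0$, $$\mathrm{Ent}(P_tf)\le c\,e^{-rt}\,\mu\big((f')^2\big).$$ Moreover it is possible to get explicit values for $c$ and $r$ such that this holds.
   Context: This is the TCP process with linear rate: on $\mathbb R_+=[0,\infty)$ the process $X$ grows at unit speed ($X_t=x+t$ between jumps), jumps at rate $\lambda(x)=x$, and at a jump is multiplied by $\delta$. $P_tf(x)=\mathbb E(f(X_t)\mid X_0=x)$. The process is ergodic with a unique invariant law $\mu$ all of whose polynomial moments are finite. $\mathcal A$ is the set of $\mathcal C^\infty$ functions on $\mathbb R_+$ whose derivatives grow at most polynomially at infinity; $L$ and $P_t$ are taken to be well-defined on $\mathcal A$ and to map $\mathcal A$ to itself, and elementary calculations with functions of $\mathcal A$ (e.g. $\partial_tP_tf=LP_tf=P_tLf$, differentiation under $P_t$ and $\mu$) are taken to be licit. $\mu(g)=\int g\,d\mu$, and $0\log 0=0$. *)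

theory Defs
  imports "HOL-Probability.Probability"
begin

text \<open>
  Functions on the half-line \<open>[0,\<infinity>)\<close> are functions of type \<open>real \<Rightarrow> real\<close> of which only
  the values on \<open>{0..}\<close> matter: measures live on \<open>half_line\<close> and derivatives are taken within
  \<open>{0..}\<close>, so that they are one-sided at \<open>0\<close>.
\<close>

definition half_line :: "real measure" where
  "half_line = restrict_space borel {0..}"

definition hderiv :: "(real \<Rightarrow> real) \<Rightarrow> real \<Rightarrow> real" where
  "hderiv f x = vector_derivative f (at x within {0..})"

definition smooth_poly :: "(real \<Rightarrow> real) set" where
  "smooth_poly = {f. \<forall>n.
      (\<forall>x\<ge>0. (hderiv ^^ n) f differentiable (at x within {0..})) \<and>
      (\<exists>C k. \<forall>x\<ge>0. \<bar>(hderiv ^^ n) f x\<bar> \<le> C * (1 + x) ^ k)}"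

definition tcp_gen :: "real \<Rightarrow> (real \<Rightarrow> real) \<Rightarrow> real \<Rightarrow> real" where
  "tcp_gen \<delta> f x = hderiv f x + x * (f (\<delta> * x) - f x)"

text \<open>
  The process is driven by independent standard exponential variables. Starting from \<open>z\<close>, the
  first jump time \<open>T\<close> has survival function \<open>exp (- \<integral>\<^sub>0\<^sup>t (z + s) ds)\<close>; equivalently
  \<open>z * T + T\<^sup>2 / 2\<close> is a standard exponential variable \<open>e\<close>, i.e. \<open>z + T = sqrt (z\<^sup>2 + 2 * e)\<close>.
\<close>

definition exp_law :: "real measure" where
  "exp_law = restrict_space (density lborel (exponential_density 1)) {0..}"

definition clocks :: "(nat \<Rightarrow> real) measure" where
  "clocks = (\<Pi>\<^sub>M i\<in>UNIV. exp_law)"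

definition wait :: "real \<Rightarrow> real \<Rightarrow> real" where
  "wait z e = sqrt (z\<^sup>2 + 2 * e) - z"

lemma wait_cumulated_rate:
  assumes "0 \<le> e"
  shows "z * wait z e + (wait z e)\<^sup>2 / 2 = e"
proof -
  have "(sqrt (z\<^sup>2 + 2 * e))\<^sup>2 = z\<^sup>2 + 2 * e"
    using assms by simp
  then show ?thesis
    by (simp add: wait_def power2_eq_square field_simps)
qed

text \<open>\<open>post_jump \<delta> x \<omega> n\<close> is the position just after the \<open>n\<close>-th jump, which occurs at time
  \<open>jump_time \<delta> x \<omega> n\<close>; index \<open>0\<close> is the initial state.\<close>

primrec post_jump :: "real \<Rightarrow> real \<Rightarrow> (nat \<Rightarrow> real) \<Rightarrow> nat \<Rightarrow> real" where
  "post_jump \<delta> x \<omega> 0 = x"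
| "post_jump \<delta> x \<omega> (Suc n) =
     \<delta> * (post_jump \<delta> x \<omega> n + wait (post_jump \<delta> x \<omega> n) (\<omega> n))"

primrec jump_time :: "real \<Rightarrow> real \<Rightarrow> (nat \<Rightarrow> real) \<Rightarrow> nat \<Rightarrow> real" where
  "jump_time \<delta> x \<omega> 0 = 0"
| "jump_time \<delta> x \<omega> (Suc n) = jump_time \<delta> x \<omega> n + wait (post_jump \<delta> x \<omega> n) (\<omega> n)"

text \<open>The set of jumps up to time \<open>t\<close> is almost surely finite.\<close>

definition jump_count :: "real \<Rightarrow> real \<Rightarrow> (nat \<Rightarrow> real) \<Rightarrow> real \<Rightarrow> nat" where
  "jump_count \<delta> x \<omega> t = card {n. jump_time \<delta> x \<omega> (Suc n) \<le> t}"

definition tcp :: "real \<Rightarrow> real \<Rightarrow> (nat \<Rightarrow> real) \<Rightarrow> real \<Rightarrow> real" where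
  "tcp \<delta> x \<omega> t = (let n = jump_count \<delta> x \<omega> t in
     post_jump \<delta> x \<omega> n + (t - jump_time \<delta> x \<omega> n))"

definition tcp_sg :: "real \<Rightarrow> real \<Rightarrow> (real \<Rightarrow> real) \<Rightarrow> real \<Rightarrow> real" where
  "tcp_sg \<delta> t f x = (\<integral>\<omega>. f (tcp \<delta> x \<omega> t) \<partial>clocks)"

text \<open>
  The standing assumptions on the action of the generator and the semigroup on the test functions.
  Differentiation of integrals against \<open>\<mu>\<close> is not listed separately: it follows by dominated
  convergence, since \<open>tcp \<delta> x \<omega> t \<le> x + t\<close> bounds \<open>tcp_sg \<delta> t f\<close> polynomially and locally
  uniformly in \<open>t\<close>, and the derivative in \<open>x\<close> is expressed through \<open>tcp_gen\<close>.
\<close>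

definition tcp_regular :: "real \<Rightarrow> bool" where
  "tcp_regular \<delta> \<longleftrightarrow> (\<forall>f\<in>smooth_poly.
     tcp_gen \<delta> f \<in> smooth_poly \<and>
     (\<forall>t\<ge>0. tcp_sg \<delta> t f \<in> smooth_poly \<and>
       (\<forall>x\<ge>0.
         ((\<lambda>s. tcp_sg \<delta> s f x) has_real_derivative tcp_gen \<delta> (tcp_sg \<delta> t f) x)
           (at t within {0..}) \<and>
         tcp_gen \<delta> (tcp_sg \<delta> t f) x = tcp_sg \<delta> t (tcp_gen \<delta> f) x)))"

definition tcp_invariant :: "real \<Rightarrow> real measure \<Rightarrow> bool" where
  "tcp_invariant \<delta> \<mu> \<longleftrightarrow> prob_space \<mu> \<and> sets \<mu> = sets half_line \<and>
     (\<forall>t\<ge>0. \<forall>B\<in>sets \<mu>. measure \<mu> B = (\<integral>x. tcp_sg \<delta> t (indicat_real B) x \<partial>\<mu>))"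

definition finite_moments :: "real measure \<Rightarrow> bool" where
  "finite_moments \<mu> \<longleftrightarrow> (\<forall>k::nat. integrable \<mu> (\<lambda>x. x ^ k))"

text \<open>The convention \<open>0 log 0 = 0\<close> holds automatically.\<close>

definition Ent :: "real measure \<Rightarrow> (real \<Rightarrow> real) \<Rightarrow> real" where
  "Ent \<mu> f = (\<integral>x. (f x)\<^sup>2 * ln ((f x)\<^sup>2) \<partial>\<mu>)
     - (\<integral>x. (f x)\<^sup>2 \<partial>\<mu>) * ln (\<integral>x. (f x)\<^sup>2 \<partial>\<mu>)"

text \<open>An explicit constant depending on a parameter is a closed-form expression in it. Uniformity
  in the parameter is essential: for a single value, constants in such an inequality can always be
  replaced by rational ones.\<close>

inductive closed_form :: "(real \<Rightarrow> real) \<Rightarrow> bool" where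
  cf_const: "q \<in> \<rat> \<Longrightarrow> closed_form (\<lambda>x. q)"
| cf_id: "closed_form (\<lambda>x. x)"
| cf_add: "closed_form f \<Longrightarrow> closed_form g \<Longrightarrow> closed_form (\<lambda>x. f x + g x)"
| cf_diff: "closed_form f \<Longrightarrow> closed_form g \<Longrightarrow> closed_form (\<lambda>x. f x - g x)"
| cf_mult: "closed_form f \<Longrightarrow> closed_form g \<Longrightarrow> closed_form (\<lambda>x. f x * g x)"
| cf_div: "closed_form f \<Longrightarrow> closed_form g \<Longrightarrow> closed_form (\<lambda>x. f x / g x)"
| cf_exp: "closed_form f \<Longrightarrow> closed_form (\<lambda>x. exp (f x))"
| cf_ln: "closed_form f \<Longrightarrow> closed_form (\<lambda>x. ln (f x))"

end

theory Submission imports Defs begin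

text \<open>
  Write \<open>energy g\<close> for \<open>\<mu>((g')\<^sup>2)\<close>. Two facts suffice: a logarithmic Sobolev inequality
  \<open>Ent g \<le> C * energy g\<close> for \<open>\<mu>\<close> (lemma \<open>log_Sobolev\<close>), applied to \<open>g = P\<^sub>t f\<close>, and the decay
  \<open>energy (P\<^sub>t f) \<le> C * exp (- r * t) * energy f\<close> (lemma \<open>energy_decay\<close>). Nearly everything about
  \<open>\<mu>\<close> is extracted from \<open>\<mu>(L G) = 0\<close>, that is
  \<open>\<mu>(G') = \<mu>(x * (G x - G (\<delta> * x)))\<close> (lemma \<open>stationarity\<close>), by choosing the test function \<open>G\<close>.

  Test functions for the logarithmic Sobolev inequality. Solving \<open>G' = x * G + p\<close> shows that
  \<open>\<mu>\<close> dominates \<open>m a * exp (- y\<^sup>2 / 2) dy\<close> on \<open>[a, \<infinity>)\<close>, where \<open>m a = \<mu>(x; x \<le> a / \<delta>)\<close> (lemma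
  \<open>gaussian_minorisation\<close>); \<open>G = exp (- s * x\<^sup>2 / 2)\<close> gives a recursion that bounds \<open>m a\<close> from below
  by \<open>exp (- C * (1 + 1 / a\<^sup>2))\<close>. Hence \<open>(g x - g 1)\<^sup>2\<close> is at most \<open>exp (C * W x) * energy g\<close> up
  to a constant, with \<open>W x = x\<^sup>2 + 1 / x\<^sup>2\<close> (lemma \<open>pointwise_bound\<close>). The functions
  \<open>G = - g\<^sup>2 / (x + \<epsilon>)\<close> and \<open>G = x * g\<^sup>2\<close> give Hardy inequalities at the two ends, which show
  \<open>\<mu>(W * (g - g 1)\<^sup>2) \<le> C * energy g\<close> (lemma \<open>weighted_Poincare\<close>). The entropy only sees the
  logarithm of the pointwise bound, so it is controlled by this weighted \<open>L\<^sup>2\<close> norm.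

  Decay of the energy. Commuting \<open>d/dx\<close> with \<open>L\<close> produces dissipation proportional to \<open>x\<close>, weak
  near the origin, and an error \<open>v * (u x - u (\<delta> * x))\<close> with \<open>v = u'\<close>. Two devices repair this:
  a bounded increasing weight, whose transport by the unit drift dissipates near the origin, and
  the addition of a multiple of the variance of \<open>u\<close>, whose dissipation is exactly
  \<open>\<mu>(x * (u x - u (\<delta> * x))\<^sup>2)\<close>. The Poincare inequality makes the modified functional comparable
  to the energy.

  The link with the process is that the law of \<open>X\<^sub>t\<close> started from \<open>\<mu>\<close> is \<open>\<mu>\<close>, so that
  \<open>\<mu>(P\<^sub>t f) = \<mu>(f)\<close> (lemma \<open>invariant_mean\<close>); differentiating in \<open>t\<close> yields \<open>\<mu>(L f) = 0\<close>.
\<close>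

section \<open>Smooth functions of polynomial growth on the half-line\<close>

definition half_deriv :: "(real \<Rightarrow> real) \<Rightarrow> (real \<Rightarrow> real) \<Rightarrow> bool" where
  "half_deriv f f' \<longleftrightarrow> (\<forall>x\<ge>0. (f has_real_derivative f' x) (at x within {0..}))"

definition poly_bounded :: "(real \<Rightarrow> real) \<Rightarrow> bool" where
  "poly_bounded f \<longleftrightarrow> (\<exists>C k. \<forall>x\<ge>0. \<bar>f x\<bar> \<le> C * (1 + x) ^ k)"

lemma half_derivD: "half_deriv f f' \<Longrightarrow> 0 \<le> x \<Longrightarrow> (f has_real_derivative f' x) (at x within {0..})"
  by (simp add: half_deriv_def)

lemma at_within_half_line_neq_bot:
  fixes x :: real
  assumes "0 \<le> x" shows "at x within {0..} \<noteq> bot"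
proof -
  have "{x..x + 1} \<subseteq> {0..}" using assms by auto
  moreover have "at x within {x..x + 1} \<noteq> bot"
    using at_within_Icc_at_right[of x "x + 1"] by simp
  ultimately show ?thesis
    using at_le bot.extremum_unique by metis
qed

lemma half_deriv_hderiv:
  assumes "half_deriv f f'" "0 \<le> x"
  shows "hderiv f x = f' x"
proof -
  have "at x within {0..} \<noteq> bot" by (rule at_within_half_line_neq_bot) fact
  moreover have "(f has_vector_derivative f' x) (at x within {0..})"
    using half_derivD[OF assms] by (simp add: has_real_derivative_iff_has_vector_derivative)
  ultimately show ?thesis
    unfolding hderiv_def by (rule vector_derivative_within)
qed

lemma half_deriv_cong:
  assumes "half_deriv f f'" "\<And>x. 0 \<le> x \<Longrightarrow> g x = f x" "\<And>x. 0 \<le> x \<Longrightarrow> g' x = f' x"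
  shows "half_deriv g g'"
  unfolding half_deriv_def
proof (intro allI impI)
  fix x :: real assume "0 \<le> x"
  then have "(g has_real_derivative f' x) (at x within {0..})"
    using half_derivD[OF assms(1), of x] assms(2)
    by (rule_tac has_field_derivative_transform_within[where f = f and d = 1]) auto
  then show "(g has_real_derivative g' x) (at x within {0..})"
    using assms(3) \<open>0 \<le> x\<close> by simp
qed

lemma smooth_poly_bounded:
  assumes "f \<in> smooth_poly" shows "poly_bounded f"
proof -
  have "\<exists>C k. \<forall>x\<ge>0. \<bar>(hderiv ^^ 0) f x\<bar> \<le> C * (1 + x) ^ k"
    using assms unfolding smooth_poly_def by blast
  then show ?thesis by (simp add: poly_bounded_def)
qed

lemma smooth_poly_half_deriv:
  assumes "f \<in> smooth_poly" shows "half_deriv f (hderiv f)"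
  unfolding half_deriv_def
proof (intro allI impI)
  fix x :: real assume "0 \<le> x"
  have "\<forall>x\<ge>0. (hderiv ^^ 0) f differentiable (at x within {0..})"
    using assms unfolding smooth_poly_def by blast
  with \<open>0 \<le> x\<close> have "f differentiable (at x within {0..})" by simp
  then obtain d where d: "(f has_real_derivative d) (at x within {0..})"
    using real_differentiable_def by auto
  have nb: "at x within {0..} \<noteq> bot" by (rule at_within_half_line_neq_bot) fact
  have "hderiv f x = d" unfolding hderiv_def
    using d by (intro vector_derivative_within nb)
      (simp add: has_real_derivative_iff_has_vector_derivative)
  with d show "(f has_real_derivative hderiv f x) (at x within {0..})" by simp
qed

lemma smooth_poly_hderiv:
  assumes "f \<in> smooth_poly" shows "hderiv f \<in> smooth_poly"
proof -
  have *: "(hderiv ^^ n) (hderiv f) = (hderiv ^^ Suc n) f" for n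
    using fun_cong[OF funpow_Suc_right[of n hderiv]] by (simp del: funpow.simps)
  show ?thesis
    unfolding smooth_poly_def mem_Collect_eq *
    using assms[unfolded smooth_poly_def mem_Collect_eq] by (intro allI) (rule spec)
qed

text \<open>
  Smoothness with polynomial bounds is the largest class of polynomially bounded functions that is
  closed under differentiation, so a function is smooth as soon as it lies in one such class. The
  class only has to contain a derivative up to equality on the half-line, since values at negative
  arguments are meaningless.
\<close>

lemma smooth_poly_coinduct:
  assumes "f \<in> S"
    and S: "\<And>f. f \<in> S \<Longrightarrow> poly_bounded f" "\<And>f. f \<in> S \<Longrightarrow> \<exists>g\<in>S. half_deriv f g"
  shows "f \<in> smooth_poly"
proof -
  have *: "\<exists>g\<in>S. \<forall>x\<ge>0. (hderiv ^^ n) f x = g x" for n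
  proof (induction n)
    case 0
    then show ?case using assms(1) by auto
  next
    case (Suc n)
    then obtain g where g: "g \<in> S" "\<And>x. 0 \<le> x \<Longrightarrow> (hderiv ^^ n) f x = g x" by auto
    obtain g' where g': "g' \<in> S" "half_deriv g g'" using S(2) g(1) by auto
    have "half_deriv ((hderiv ^^ n) f) g'"
      by (rule half_deriv_cong[OF g'(2)]) (use g in auto)
    then show ?case using half_deriv_hderiv g'(1) by (auto intro!: bexI[of _ g'])
  qed
  show ?thesis
    unfolding smooth_poly_def
  proof (intro CollectI allI conjI impI)
    fix n
    obtain g where g: "g \<in> S" "\<And>x. 0 \<le> x \<Longrightarrow> (hderiv ^^ n) f x = g x" using * by blast
    obtain g' where g': "half_deriv g g'" using S(2) g(1) by auto
    have hd: "half_deriv ((hderiv ^^ n) f) g'"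
      by (rule half_deriv_cong[OF g']) (use g in auto)
    then show "(hderiv ^^ n) f differentiable (at x within {0..})" if "0 \<le> x" for x
      using that real_differentiable_def half_derivD by blast
    show "\<exists>C k. \<forall>x\<ge>0. \<bar>(hderiv ^^ n) f x\<bar> \<le> C * (1 + x) ^ k"
      using S(1)[OF g(1)] g(2) by (auto simp: poly_bounded_def)
  qed
qed

lemma poly_boundedI: "(\<And>x. 0 \<le> x \<Longrightarrow> \<bar>f x\<bar> \<le> C * (1 + x) ^ k) \<Longrightarrow> poly_bounded f"
  unfolding poly_bounded_def by blast

lemma poly_boundedE:
  assumes "poly_bounded f"
  shows "\<exists>C k. 0 \<le> C \<and> (\<forall>x\<ge>0. \<bar>f x\<bar> \<le> C * (1 + x) ^ k)"
proof -
  obtain C k where c: "\<forall>x\<ge>0. \<bar>f x\<bar> \<le> C * (1 + x) ^ k"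
    using assms unfolding poly_bounded_def by blast
  then have "0 \<le> C" by (auto dest: spec[of _ 0])
  with c show ?thesis by blast
qed

lemma poly_bounded_add:
  assumes "poly_bounded f" "poly_bounded g"
  shows "poly_bounded (\<lambda>x. f x + g x)"
proof -
  obtain C k where f: "0 \<le> C" "\<forall>x\<ge>0. \<bar>f x\<bar> \<le> C * (1 + x) ^ k"
    using poly_boundedE[OF assms(1)] by blast
  note f = f(1) f(2)[rule_format]
  obtain D l where g: "0 \<le> D" "\<forall>x\<ge>0. \<bar>g x\<bar> \<le> D * (1 + x) ^ l"
    using poly_boundedE[OF assms(2)] by blast
  note g = g(1) g(2)[rule_format]
  show ?thesis
  proof (rule poly_boundedI[where C = "C + D" and k = "k + l"])
    fix x :: real assume x: "0 \<le> x"
    have "C * (1 + x) ^ k \<le> C * (1 + x) ^ (k + l)" "D * (1 + x) ^ l \<le> D * (1 + x) ^ (k + l)"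
      using x f(1) g(1) by (auto intro!: mult_left_mono power_increasing)
    then show "\<bar>f x + g x\<bar> \<le> (C + D) * (1 + x) ^ (k + l)"
      using f(2)[OF x] g(2)[OF x] by (simp add: distrib_right)
  qed
qed

lemma poly_bounded_mult:
  assumes "poly_bounded f" "poly_bounded g"
  shows "poly_bounded (\<lambda>x. f x * g x)"
proof -
  obtain C k where f: "0 \<le> C" "\<forall>x\<ge>0. \<bar>f x\<bar> \<le> C * (1 + x) ^ k"
    using poly_boundedE[OF assms(1)] by blast
  note f = f(1) f(2)[rule_format]
  obtain D l where g: "0 \<le> D" "\<forall>x\<ge>0. \<bar>g x\<bar> \<le> D * (1 + x) ^ l"
    using poly_boundedE[OF assms(2)] by blast
  note g = g(1) g(2)[rule_format]
  show ?thesis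
  proof (rule poly_boundedI[where C = "C * D" and k = "k + l"])
    fix x :: real assume x: "0 \<le> x"
    have "\<bar>f x\<bar> * \<bar>g x\<bar> \<le> (C * (1 + x) ^ k) * (D * (1 + x) ^ l)"
      using f g x by (intro mult_mono) auto
    then show "\<bar>f x * g x\<bar> \<le> C * D * (1 + x) ^ (k + l)"
      by (simp add: abs_mult power_add mult_ac)
  qed
qed

text \<open>
  The algebra generated by the smooth functions and one extra function \<open>F\<close>. If \<open>F\<close> is polynomially
  bounded and \<open>F'\<close> lies in this algebra, the algebra is closed under differentiation; this covers
  solutions of polynomial differential equations with smooth coefficients.
\<close>

inductive_set adjoined :: "(real \<Rightarrow> real) \<Rightarrow> (real \<Rightarrow> real) set" for F where
  self: "F \<in> adjoined F"
| base: "f \<in> smooth_poly \<Longrightarrow> f \<in> adjoined F"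
| add: "f \<in> adjoined F \<Longrightarrow> g \<in> adjoined F \<Longrightarrow> (\<lambda>x. f x + g x) \<in> adjoined F"
| mult: "f \<in> adjoined F \<Longrightarrow> g \<in> adjoined F \<Longrightarrow> (\<lambda>x. f x * g x) \<in> adjoined F"

lemma adjoined_smooth_poly:
  assumes F: "poly_bounded F" "half_deriv F F'" "F' \<in> adjoined F" and f: "f \<in> adjoined F"
  shows "f \<in> smooth_poly"
proof (rule smooth_poly_coinduct[OF f])
  show "poly_bounded g" if "g \<in> adjoined F" for g
    using that
    by induction (auto intro: F smooth_poly_bounded poly_bounded_add poly_bounded_mult)
  show "\<exists>g'\<in>adjoined F. half_deriv g g'" if "g \<in> adjoined F" for g
    using that
  proof induction
    case self
    then show ?case using F by blast
  next
    case (base f)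
    then show ?case using smooth_poly_half_deriv smooth_poly_hderiv adjoined.base by blast
  next
    case (add f g)
    then obtain f' g' where "f' \<in> adjoined F" "half_deriv f f'" "g' \<in> adjoined F" "half_deriv g g'"
      by blast
    then show ?case
      by (intro bexI[of _ "\<lambda>x. f' x + g' x"])
        (auto intro!: adjoined.add DERIV_add simp: half_deriv_def)
  next
    case (mult f g)
    then obtain f' g' where "f' \<in> adjoined F" "half_deriv f f'" "g' \<in> adjoined F" "half_deriv g g'"
      by blast
    then show ?case using mult.hyps
      by (intro bexI[of _ "\<lambda>x. f' x * g x + g' x * f x"])
        (auto intro!: adjoined.add adjoined.mult DERIV_mult simp: half_deriv_def)
  qed
qed

lemma smooth_polyI:
  assumes "poly_bounded F" "half_deriv F F'" "F' \<in> adjoined F"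
  shows "F \<in> smooth_poly"
  using adjoined_smooth_poly[OF assms adjoined.self] .

lemma smooth_poly_const [simp]: "(\<lambda>x. c) \<in> smooth_poly"
proof (rule smooth_poly_coinduct[where S = "range (\<lambda>c x. c)"])
  fix f assume "f \<in> range (\<lambda>c x :: real. c :: real)"
  then obtain c where f: "f = (\<lambda>x. c)" by auto
  show "poly_bounded f" unfolding f by (rule poly_boundedI[where C = "\<bar>c\<bar>" and k = 0]) auto
  show "\<exists>g\<in>range (\<lambda>c x. c). half_deriv f g"
    unfolding f by (auto simp: half_deriv_def intro!: exI[of _ 0])
qed auto

lemma smooth_poly_id [simp]: "(\<lambda>x. x) \<in> smooth_poly"
proof (rule smooth_polyI[where F' = "\<lambda>x. 1"])
  show "poly_bounded (\<lambda>x. x)" by (rule poly_boundedI[where C = 1 and k = 1]) auto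
qed (auto simp: half_deriv_def intro: adjoined.intros)

lemma smooth_poly_add:
  assumes "f \<in> smooth_poly" "g \<in> smooth_poly" shows "(\<lambda>x. f x + g x) \<in> smooth_poly"
  by (rule adjoined_smooth_poly[OF smooth_poly_bounded[OF assms(1)] smooth_poly_half_deriv[OF assms(1)]])
    (intro adjoined.intros assms smooth_poly_hderiv)+

lemma smooth_poly_mult:
  assumes "f \<in> smooth_poly" "g \<in> smooth_poly" shows "(\<lambda>x. f x * g x) \<in> smooth_poly"
  by (rule adjoined_smooth_poly[OF smooth_poly_bounded[OF assms(1)] smooth_poly_half_deriv[OF assms(1)]])
    (intro adjoined.intros assms smooth_poly_hderiv)+

lemma smooth_poly_minus:
  assumes "f \<in> smooth_poly" shows "(\<lambda>x. - f x) \<in> smooth_poly"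
  using smooth_poly_mult[OF smooth_poly_const[of "-1"] assms] by simp

lemma smooth_poly_diff:
  assumes "f \<in> smooth_poly" "g \<in> smooth_poly" shows "(\<lambda>x. f x - g x) \<in> smooth_poly"
  using smooth_poly_add[OF assms(1) smooth_poly_minus[OF assms(2)]] by simp

lemma smooth_poly_power:
  assumes "f \<in> smooth_poly" shows "(\<lambda>x. f x ^ n) \<in> smooth_poly"
  by (induction n) (auto intro: smooth_poly_mult assms)

lemma smooth_poly_scale:
  assumes "f \<in> smooth_poly" "0 \<le> d" shows "(\<lambda>x. f (d * x)) \<in> smooth_poly"
proof (rule smooth_poly_coinduct[where S = "{\<lambda>x. c * f (d * x) |c f. f \<in> smooth_poly}"])
  show "(\<lambda>x. f (d * x)) \<in> {\<lambda>x. c * f (d * x) |c f. f \<in> smooth_poly}"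
    using assms by (auto intro!: exI[of _ 1] exI[of _ f])
next
  fix h assume "h \<in> {\<lambda>x. c * f (d * x) |c f. f \<in> smooth_poly}"
  then obtain c f where h: "h = (\<lambda>x. c * f (d * x))" "f \<in> smooth_poly" by blast
  obtain C k where f: "0 \<le> C" "\<forall>x\<ge>0. \<bar>f x\<bar> \<le> C * (1 + x) ^ k"
    using poly_boundedE[OF smooth_poly_bounded[OF h(2)]] by blast
  note f = f(1) f(2)[rule_format]
  show "poly_bounded h"
  proof (rule poly_boundedI[where C = "\<bar>c\<bar> * C * (1 + d) ^ k" and k = k])
    fix x :: real assume x: "0 \<le> x"
    have "\<bar>f (d * x)\<bar> \<le> C * (1 + d * x) ^ k" using f(2)[of "d * x"] assms(2) x by simp
    also have "\<dots> \<le> C * ((1 + d) * (1 + x)) ^ k"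
      using f(1) assms(2) x by (intro mult_left_mono power_mono) (auto simp: algebra_simps)
    finally have "\<bar>c\<bar> * \<bar>f (d * x)\<bar> \<le> \<bar>c\<bar> * (C * ((1 + d) * (1 + x)) ^ k)"
      by (intro mult_left_mono) auto
    then show "\<bar>h x\<bar> \<le> \<bar>c\<bar> * C * (1 + d) ^ k * (1 + x) ^ k"
      by (simp add: h abs_mult power_mult_distrib mult_ac)
  qed
  have "half_deriv h (\<lambda>x. (c * d) * hderiv f (d * x))"
    unfolding half_deriv_def
  proof (intro allI impI)
    fix x :: real assume x: "0 \<le> x"
    have "(f has_real_derivative hderiv f (d * x)) (at (d * x) within (*) d ` {0..})"
      by (rule DERIV_subset[OF half_derivD[OF smooth_poly_half_deriv[OF h(2)]]])
        (use x assms in auto)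
    moreover have "((*) d has_real_derivative d) (at x within {0..})"
      by (auto intro!: derivative_eq_intros)
    ultimately have "((\<lambda>x. f (d * x)) has_real_derivative hderiv f (d * x) * d) (at x within {0..})"
      using DERIV_image_chain[of f _ "(*) d" x "{0..}" d] by (simp add: o_def)
    from DERIV_cmult[OF this, of c]
    show "(h has_real_derivative (c * d) * hderiv f (d * x)) (at x within {0..})"
      by (simp add: h mult_ac)
  qed
  then show "\<exists>g\<in>{\<lambda>x. c * f (d * x) |c f. f \<in> smooth_poly}. half_deriv h g"
    using smooth_poly_hderiv[OF h(2)] by blast
qed

lemma smooth_poly_exp_neg:
  assumes "0 \<le> k" shows "(\<lambda>x. exp (- (k * x))) \<in> smooth_poly"
proof (rule smooth_polyI[where F' = "\<lambda>x. (-k) * exp (- (k * x))"])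
  show "poly_bounded (\<lambda>x. exp (- (k * x)))"
    by (rule poly_boundedI[where C = 1 and k = 0]) (use assms in auto)
  show "half_deriv (\<lambda>x. exp (- (k * x))) (\<lambda>x. (-k) * exp (- (k * x)))"
    unfolding half_deriv_def by (auto intro!: derivative_eq_intros)
qed (intro adjoined.mult adjoined.self adjoined.base; simp)

lemma smooth_poly_gauss:
  assumes "0 \<le> s" shows "(\<lambda>x. exp (- (s * x\<^sup>2 / 2))) \<in> smooth_poly"
proof (rule smooth_polyI[where F' = "\<lambda>x. ((-s) * x) * exp (- (s * x\<^sup>2 / 2))"])
  show "poly_bounded (\<lambda>x. exp (- (s * x\<^sup>2 / 2)))"
    by (rule poly_boundedI[where C = 1 and k = 0]) (use assms in auto)
  show "half_deriv (\<lambda>x. exp (- (s * x\<^sup>2 / 2))) (\<lambda>x. ((-s) * x) * exp (- (s * x\<^sup>2 / 2)))"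
    unfolding half_deriv_def by (auto intro!: derivative_eq_intros)
qed (intro adjoined.mult adjoined.self adjoined.base smooth_poly_mult; simp)

lemma smooth_poly_inverse_shift:
  assumes "0 < e" shows "(\<lambda>x. 1 / (x + e)) \<in> smooth_poly"
proof (rule smooth_polyI[where F' = "\<lambda>x. (-1) * ((1 / (x + e)) * (1 / (x + e)))"])
  show "poly_bounded (\<lambda>x. 1 / (x + e))"
    by (rule poly_boundedI[where C = "1 / e" and k = 0]) (use assms in \<open>auto simp: field_simps\<close>)
  show "half_deriv (\<lambda>x. 1 / (x + e)) (\<lambda>x. (-1) * ((1 / (x + e)) * (1 / (x + e))))"
    unfolding half_deriv_def using assms
    by (auto intro!: derivative_eq_intros simp: power2_eq_square divide_simps)
qed (intro adjoined.mult adjoined.self adjoined.base; simp)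

lemma half_deriv_continuous_on:
  assumes "half_deriv f f'" shows "continuous_on {0..} f"
  using assms unfolding half_deriv_def continuous_on_eq_continuous_within
  by (auto intro: DERIV_continuous)

lemma half_deriv_mono:
  assumes "half_deriv f f'" "0 \<le> a" "a \<le> b" "\<And>x. a \<le> x \<Longrightarrow> x \<le> b \<Longrightarrow> 0 \<le> f' x"
  shows "f a \<le> f b"
proof (rule DERIV_nonneg_imp_increasing_open[OF assms(3)])
  fix x assume x: "a < x" "x < b"
  have "(f has_real_derivative f' x) (at x)"
    using half_derivD[OF assms(1), of x] x assms(2)
    by (simp add: at_within_interior[of x "{0..}"])
  then show "\<exists>y. (f has_real_derivative y) (at x) \<and> 0 \<le> y"
    using x assms(4)[of x] by auto
qed (use half_deriv_continuous_on[OF assms(1)] assms(2) in \<open>auto intro: continuous_on_subset\<close>)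

lemma smooth_poly_continuous_on: "f \<in> smooth_poly \<Longrightarrow> continuous_on {0..} f"
  using half_deriv_continuous_on smooth_poly_half_deriv by blast

lemma smooth_poly_antiderivative:
  assumes "f \<in> smooth_poly"
  obtains F where "F \<in> smooth_poly" "half_deriv F f" "F 0 = 0"
proof -
  define F where "F x = integral {0..x} f" for x
  have hd: "half_deriv F f"
    unfolding half_deriv_def
  proof (intro allI impI)
    fix x :: real assume x: "0 \<le> x"
    have "(F has_real_derivative f x) (at x within {0..x + 1})"
      unfolding F_def
      by (rule integral_has_real_derivative)
        (use x smooth_poly_continuous_on[OF assms] in \<open>auto intro: continuous_on_subset\<close>)
    moreover have "at x within {0..x + 1} = at x within {0..}"
      by (rule at_within_nhd[of x "{..<x + 1}"]) auto
    ultimately show "(F has_real_derivative f x) (at x within {0..})" by simp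
  qed
  obtain C k where f: "0 \<le> C" "\<forall>x\<ge>0. \<bar>f x\<bar> \<le> C * (1 + x) ^ k"
    using poly_boundedE[OF smooth_poly_bounded[OF assms]] by blast
  note f = f(1) f(2)[rule_format]
  have F0: "F 0 = 0" by (simp add: F_def)
  have hp: "half_deriv (\<lambda>x. C * (1 + x) ^ Suc k) (\<lambda>x. C * (Suc k) * (1 + x) ^ k)"
    unfolding half_deriv_def
    by (auto intro!: derivative_eq_intros simp del: power_Suc)
  have le: "C * (1 + x) ^ k \<le> C * (Suc k) * (1 + x) ^ k" if "0 \<le> x" for x
    using that f(1) by (simp add: field_simps)
  have "poly_bounded F"
  proof (rule poly_boundedI[where C = C and k = "Suc k"])
    fix x :: real assume x: "0 \<le> x"
    have "C * (1 + 0) ^ Suc k - F 0 \<le> C * (1 + x) ^ Suc k - F x"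
    proof (rule half_deriv_mono[where a = 0 and b = x])
      show "half_deriv (\<lambda>x. C * (1 + x) ^ Suc k - F x) (\<lambda>x. C * (Suc k) * (1 + x) ^ k - f x)"
        using hd hp unfolding half_deriv_def by (auto intro!: DERIV_diff)
      show "0 \<le> C * (Suc k) * (1 + y) ^ k - f y" if "0 \<le> y" for y
        using f(2)[of y] le[of y] that by simp
    qed (use x in auto)
    moreover have "C * (1 + 0) ^ Suc k + F 0 \<le> C * (1 + x) ^ Suc k + F x"
    proof (rule half_deriv_mono[where a = 0 and b = x])
      show "half_deriv (\<lambda>x. C * (1 + x) ^ Suc k + F x) (\<lambda>x. C * (Suc k) * (1 + x) ^ k + f x)"
        using hd hp unfolding half_deriv_def by (auto intro!: DERIV_add)
      show "0 \<le> C * (Suc k) * (1 + y) ^ k + f y" if "0 \<le> y" for y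
        using f(2)[of y] le[of y] that by simp
    qed (use x in auto)
    ultimately show "\<bar>F x\<bar> \<le> C * (1 + x) ^ Suc k" using F0 f(1) by auto
  qed
  then have "F \<in> smooth_poly"
    by (rule smooth_polyI[OF _ hd]) (auto intro: adjoined.base assms)
  with hd F0 that show thesis by blast
qed

lemma smooth_poly_divide:
  assumes "f \<in> smooth_poly" shows "(\<lambda>x. f x / c) \<in> smooth_poly"
  using smooth_poly_mult[OF assms smooth_poly_const[of "1 / c"]] by simp

lemmas smooth_intros = smooth_poly_const smooth_poly_id smooth_poly_add smooth_poly_mult
  smooth_poly_minus smooth_poly_diff smooth_poly_power smooth_poly_exp_neg smooth_poly_gauss
  smooth_poly_inverse_shift smooth_poly_divide

section \<open>Moments and mass near the origin of a stationary law\<close>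

text \<open>
  Cauchy--Schwarz for \<open>u b - u a = \<integral>\<^bsub>[a,b]\<^esub> v\<close> with a weight bounded below by \<open>r\<close>, where an
  antiderivative \<open>P\<close> of the weighted square replaces the integral. It comes from the monotonicity of
  \<open>P y - r * (2 * l * u y - l\<^sup>2 * y)\<close> and the optimal \<open>l = (u b - u a) / (b - a)\<close>.
\<close>

lemma half_deriv_Cauchy_Schwarz:
  assumes u: "half_deriv u v" and P: "half_deriv P p" and ab: "0 \<le> a" "a \<le> b" and r: "0 \<le> r"
    and le: "\<And>y. a \<le> y \<Longrightarrow> y \<le> b \<Longrightarrow> r * (v y)\<^sup>2 \<le> p y"
  shows "r * (u b - u a)\<^sup>2 \<le> (b - a) * (P b - P a)"
proof (cases "a = b")
  case False
  define l where "l = (u b - u a) / (b - a)"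
  have "P a - r * (2 * l * u a - l\<^sup>2 * a) \<le> P b - r * (2 * l * u b - l\<^sup>2 * b)"
  proof (rule half_deriv_mono[OF _ ab])
    show "half_deriv (\<lambda>y. P y - r * (2 * l * u y - l\<^sup>2 * y)) (\<lambda>y. p y - r * (2 * l * v y - l\<^sup>2))"
      using u P unfolding half_deriv_def by (auto intro!: derivative_eq_intros)
    fix y assume "a \<le> y" "y \<le> b"
    have "r * (2 * l * v y - l\<^sup>2) \<le> r * (v y)\<^sup>2"
      using r by (intro mult_left_mono) (use zero_le_power2[of "v y - l"] in \<open>auto simp: power2_diff mult_ac\<close>)
    then show "0 \<le> p y - r * (2 * l * v y - l\<^sup>2)"
      using le[OF \<open>a \<le> y\<close> \<open>y \<le> b\<close>] by simp
  qed
  then have "r * (2 * l * (u b - u a) - l\<^sup>2 * (b - a)) \<le> P b - P a" by (simp add: algebra_simps)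
  moreover have "2 * l * (u b - u a) - l\<^sup>2 * (b - a) = (u b - u a)\<^sup>2 / (b - a)"
  proof -
    have "2 * (U / d) * U - (U / d)\<^sup>2 * d = U\<^sup>2 / d" if "d \<noteq> 0" for U d :: real
      using that by (simp add: power2_eq_square field_simps)
    from this[of "b - a" "u b - u a"] show ?thesis using False unfolding l_def by linarith
  qed
  ultimately have "r * ((u b - u a)\<^sup>2 / (b - a)) \<le> P b - P a" by simp
  then show ?thesis using False ab by (simp add: field_simps)
qed simp

definition kappa :: "real \<Rightarrow> real" where "kappa d = 1 / (1 - d)"

locale half_line_measure = prob_space \<mu> for \<mu> :: "real measure" +
  assumes sets_half_line: "sets \<mu> = sets half_line"
    and moments: "finite_moments \<mu>"
begin

lemma space_half_line: "space \<mu> = {0..}"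
  using sets_eq_imp_space_eq[OF sets_half_line] by (simp add: half_line_def space_restrict_space)

lemma space_nonneg [simp]: "x \<in> space \<mu> \<Longrightarrow> 0 \<le> x"
  by (simp add: space_half_line)

lemma continuous_measurable:
  fixes f :: "real \<Rightarrow> real"
  assumes "continuous_on {0..} f" shows "f \<in> borel_measurable \<mu>"
  using borel_measurable_continuous_on_restrict[OF assms] measurable_cong_sets[OF sets_half_line refl]
  by (auto simp: half_line_def)

lemma smooth_measurable: "f \<in> smooth_poly \<Longrightarrow> f \<in> borel_measurable \<mu>"
  by (intro continuous_measurable smooth_poly_continuous_on)

lemma borel_measurable_mu:
  fixes f :: "real \<Rightarrow> 'b::topological_space"
  assumes "f \<in> borel_measurable borel" shows "f \<in> borel_measurable \<mu>"
  using measurable_restrict_space1[OF assms, of "{0..}"] measurable_cong_sets[OF sets_half_line refl]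
  by (auto simp: half_line_def)

lemma integrable_poly_bounded:
  fixes f :: "real \<Rightarrow> real"
  assumes "f \<in> borel_measurable \<mu>" "poly_bounded f" shows "integrable \<mu> f"
proof -
  obtain C k where f: "0 \<le> C" "\<forall>x\<ge>0. \<bar>f x\<bar> \<le> C * (1 + x) ^ k"
    using poly_boundedE[OF assms(2)] by blast
  have "integrable \<mu> (\<lambda>x. C * 2 ^ k * (1 + x ^ k))"
    using moments unfolding finite_moments_def by (intro integrable_mult_right integrable_add) auto
  then show ?thesis
  proof (rule Bochner_Integration.integrable_bound[OF _ assms(1)], intro AE_I2)
    fix x assume "x \<in> space \<mu>"
    then have x: "0 \<le> x" by simp
    have "(1 + x) ^ k \<le> (2 * max 1 x) ^ k" using x by (intro power_mono) auto
    also have "\<dots> = 2 ^ k * (max 1 x) ^ k" by (simp add: power_mult_distrib)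
    also have "(max 1 x) ^ k \<le> 1 + x ^ k" using x by (auto simp: max_def)
    finally have "(1 + x) ^ k \<le> 2 ^ k * (1 + x ^ k)" by simp
    then have "C * (1 + x) ^ k \<le> C * (2 ^ k * (1 + x ^ k))"
      using f(1) by (rule mult_left_mono)
    moreover have "0 \<le> C * (2 ^ k * (1 + x ^ k))" using f(1) x by simp
    ultimately show "norm (f x) \<le> norm (C * 2 ^ k * (1 + x ^ k))"
      using f(2)[rule_format, OF x] by (simp add: mult.assoc)
  qed
qed

lemma smooth_integrable: "f \<in> smooth_poly \<Longrightarrow> integrable \<mu> f"
  by (intro integrable_poly_bounded smooth_measurable smooth_poly_bounded)

lemma mean_mono:
  fixes f g :: "real \<Rightarrow> real"
  assumes "integrable \<mu> f" "integrable \<mu> g" "\<And>x. 0 \<le> x \<Longrightarrow> f x \<le> g x"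
  shows "(\<integral>x. f x \<partial>\<mu>) \<le> (\<integral>x. g x \<partial>\<mu>)"
  using assms by (intro integral_mono) auto

lemma mean_nonneg:
  fixes f :: "real \<Rightarrow> real"
  assumes "\<And>x. 0 \<le> x \<Longrightarrow> 0 \<le> f x"
  shows "0 \<le> (\<integral>x. f x \<partial>\<mu>)"
  using assms by (intro integral_nonneg_AE AE_I2) auto

end

locale stationary_half_line = half_line_measure +
  fixes \<delta> :: real
  assumes \<delta>_pos: "0 < \<delta>" and \<delta>_less: "\<delta> < 1"
    and generator_mean_zero: "G \<in> smooth_poly \<Longrightarrow> (\<integral>x. tcp_gen \<delta> G x \<partial>\<mu>) = 0"
begin

lemma smooth_dil: "f \<in> smooth_poly \<Longrightarrow> (\<lambda>x. f (\<delta> * x)) \<in> smooth_poly"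
  using smooth_poly_scale \<delta>_pos by simp

lemma stationarity:
  assumes G: "G \<in> smooth_poly" and g: "half_deriv G g"
  shows "integrable \<mu> g" "(\<integral>x. g x \<partial>\<mu>) = (\<integral>x. x * (G x - G (\<delta> * x)) \<partial>\<mu>)"
proof -
  have eq: "hderiv G x = g x" if "x \<in> space \<mu>" for x
    using half_deriv_hderiv[OF g] that by simp
  have i1: "integrable \<mu> (hderiv G)" using smooth_poly_hderiv[OF G] by (rule smooth_integrable)
  then show "integrable \<mu> g"
    using eq by (rule_tac Bochner_Integration.integrable_cong[THEN iffD1, OF refl _ i1]) auto
  have i2: "integrable \<mu> (\<lambda>x. x * (G x - G (\<delta> * x)))"
    by (intro smooth_integrable smooth_intros smooth_dil G)
  have "0 = (\<integral>x. hderiv G x - x * (G x - G (\<delta> * x)) \<partial>\<mu>)"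
    using generator_mean_zero[OF G] unfolding tcp_gen_def by (simp add: algebra_simps)
  also have "\<dots> = (\<integral>x. hderiv G x \<partial>\<mu>) - (\<integral>x. x * (G x - G (\<delta> * x)) \<partial>\<mu>)"
    by (rule Bochner_Integration.integral_diff[OF i1 i2])
  also have "(\<integral>x. hderiv G x \<partial>\<mu>) = (\<integral>x. g x \<partial>\<mu>)"
    using eq by (intro Bochner_Integration.integral_cong) auto
  finally show "(\<integral>x. g x \<partial>\<mu>) = (\<integral>x. x * (G x - G (\<delta> * x)) \<partial>\<mu>)" by simp
qed

lemma moment_recursion:
  "real k * (\<integral>x. x ^ (k - 1) \<partial>\<mu>) = (1 - \<delta> ^ k) * (\<integral>x. x ^ (k + 1) \<partial>\<mu>)"
proof -
  have "half_deriv (\<lambda>x. x ^ k) (\<lambda>x. real k * x ^ (k - 1))"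
    unfolding half_deriv_def by (auto intro!: derivative_eq_intros)
  from stationarity(2)[OF _ this]
  have "(\<integral>x. real k * x ^ (k - 1) \<partial>\<mu>) = (\<integral>x. x * (x ^ k - (\<delta> * x) ^ k) \<partial>\<mu>)"
    using smooth_poly_power[OF smooth_poly_id, of k] by blast
  also have "\<dots> = (\<integral>x. (1 - \<delta> ^ k) * x ^ (k + 1) \<partial>\<mu>)"
    by (simp add: power_mult_distrib algebra_simps)
  finally show ?thesis by simp
qed

abbreviation \<kappa> :: real where "\<kappa> \<equiv> kappa \<delta>"

lemma kappa_ge_1: "1 \<le> \<kappa>"
  unfolding kappa_def using \<delta>_pos \<delta>_less by simp

lemma kappa_q: "1 / (1 - \<delta>\<^sup>2) \<le> \<kappa>"
proof -
  have "1 - \<delta> \<le> 1 - \<delta>\<^sup>2" using \<delta>_pos \<delta>_less by (simp add: power2_eq_square mult_left_le)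
  then show ?thesis unfolding kappa_def using \<delta>_less by (intro divide_left_mono) (auto intro!: mult_pos_pos)
qed

lemma q_less_1: "\<delta>\<^sup>2 < 1"
  using \<delta>_pos \<delta>_less by (simp add: power_less_one_iff)

lemma second_moment: "(\<integral>x. x\<^sup>2 \<partial>\<mu>) = \<kappa>"
  using moment_recursion[of 1] \<delta>_less by (simp add: kappa_def prob_space power2_eq_square field_simps)

lemma third_moment: "(\<integral>x. x ^ 3 \<partial>\<mu>) = 2 / (1 - \<delta>\<^sup>2) * (\<integral>x. x \<partial>\<mu>)"
  using moment_recursion[of 2] q_less_1 by (simp add: field_simps eval_nat_numeral)

lemma first_moment_lower: "1 / 2 \<le> (\<integral>x. x \<partial>\<mu>)"
proof -
  have "(\<integral>x. 2 * x\<^sup>2 \<partial>\<mu>) \<le> (\<integral>x. x + x ^ 3 \<partial>\<mu>)"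
  proof (rule mean_mono)
    fix x :: real assume "0 \<le> x"
    have "0 \<le> x * (1 - x)\<^sup>2" using \<open>0 \<le> x\<close> by simp
    then show "2 * x\<^sup>2 \<le> x + x ^ 3" by (simp add: power2_eq_square power3_eq_cube algebra_simps)
  qed (auto intro!: smooth_integrable smooth_intros)
  then have "2 * \<kappa> \<le> (1 + 2 / (1 - \<delta>\<^sup>2)) * (\<integral>x. x \<partial>\<mu>)"
    by (subst (asm) Bochner_Integration.integral_add)
      (auto intro!: smooth_integrable smooth_intros simp: second_moment third_moment algebra_simps)
  also have "\<dots> \<le> (3 * \<kappa>) * (\<integral>x. x \<partial>\<mu>)"
    using kappa_q kappa_ge_1 by (intro mult_right_mono mean_nonneg) auto
  finally have "\<kappa> * 2 \<le> \<kappa> * (3 * (\<integral>x. x \<partial>\<mu>))" by simp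
  then show ?thesis using kappa_ge_1 by (subst (asm) mult_le_cancel_left_pos) auto
qed

lemma first_moment_upper: "(\<integral>x. x \<partial>\<mu>) \<le> \<kappa>"
proof -
  have "(\<integral>x. 2 * x \<partial>\<mu>) \<le> (\<integral>x. 1 + x\<^sup>2 \<partial>\<mu>)"
  proof (rule mean_mono)
    fix x :: real
    show "2 * x \<le> 1 + x\<^sup>2" using zero_le_power2[of "1 - x"] by (simp add: power2_diff)
  qed (auto intro!: smooth_integrable smooth_intros)
  then have "2 * (\<integral>x. x \<partial>\<mu>) \<le> 1 + \<kappa>"
    by (subst (asm) Bochner_Integration.integral_add)
      (auto intro!: smooth_integrable smooth_intros simp: second_moment prob_space)
  with kappa_ge_1 show ?thesis by simp
qed

definition gaussian_mean :: "real \<Rightarrow> real" where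
  "gaussian_mean s = (\<integral>x. x * exp (- (s * x\<^sup>2 / 2)) \<partial>\<mu>)"

text \<open>
  The derivative of \<open>exp (- s * x\<^sup>2 / 2)\<close> is \<open>- s * x\<close> times itself, and dilation by \<open>\<delta>\<close> replaces
  \<open>s\<close> by \<open>s * \<delta>\<^sup>2\<close>; so stationarity becomes a functional equation relating \<open>s\<close> and
  \<open>s * \<delta>\<^sup>2\<close>. Iterating it expresses \<open>gaussian_mean s\<close> as \<open>\<mu>(x)\<close> divided by the product of the \<open>1 + s * \<delta>\<^sup>2\<^sup>n\<close>.
\<close>

lemma gaussian_mean_recursion:
  assumes "0 \<le> s" shows "gaussian_mean (s * \<delta>\<^sup>2) = (1 + s) * gaussian_mean s"
proof -
  have hd: "half_deriv (\<lambda>x. exp (- (s * x\<^sup>2 / 2))) (\<lambda>x. - s * (x * exp (- (s * x\<^sup>2 / 2))))"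
    unfolding half_deriv_def by (auto intro!: derivative_eq_intros)
  have i: "integrable \<mu> (\<lambda>x. x * exp (- (s * x\<^sup>2 / 2)))"
    "integrable \<mu> (\<lambda>x. x * exp (- (s * \<delta>\<^sup>2 * x\<^sup>2 / 2)))"
    using assms by (auto intro!: smooth_integrable smooth_intros)
  have "- s * gaussian_mean s = (\<integral>x. x * (exp (- (s * x\<^sup>2 / 2)) - exp (- (s * (\<delta> * x)\<^sup>2 / 2))) \<partial>\<mu>)"
    using stationarity(2)[OF smooth_poly_gauss[OF assms] hd] by (simp add: gaussian_mean_def)
  also have "\<dots> = (\<integral>x. x * exp (- (s * x\<^sup>2 / 2)) - x * exp (- (s * \<delta>\<^sup>2 * x\<^sup>2 / 2)) \<partial>\<mu>)"
    by (simp add: power_mult_distrib algebra_simps)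
  also have "\<dots> = gaussian_mean s - gaussian_mean (s * \<delta>\<^sup>2)"
    unfolding gaussian_mean_def by (rule Bochner_Integration.integral_diff[OF i])
  finally show ?thesis by (simp add: algebra_simps)
qed

lemma gaussian_mean_nonneg: "0 \<le> gaussian_mean s"
  unfolding gaussian_mean_def by (intro mean_nonneg) auto

text \<open>
  The factors of the product satisfy \<open>1 + s * \<delta>\<^sup>2\<^sup>n \<le> exp (2 * sqrt s * \<delta>\<^sup>n)\<close>, and the exponents form
  a geometric series.
\<close>

lemma gaussian_mean_lower:
  assumes "0 \<le> s" shows "exp (- 2 * sqrt s * \<kappa>) / 2 \<le> gaussian_mean s"
proof -
  have it: "gaussian_mean (s * \<delta> ^ (2 * n)) \<le> gaussian_mean s * exp (2 * sqrt s * (\<Sum>i<n. \<delta> ^ i))" for n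
  proof (induction n)
    case (Suc n)
    let ?t = "s * \<delta> ^ (2 * n)"
    have t: "0 \<le> ?t" using assms \<delta>_pos by simp
    have sq: "sqrt ?t = sqrt s * \<delta> ^ n"
      using \<delta>_pos by (simp add: real_sqrt_mult power_mult power2_eq_square real_sqrt_power mult.commute)
    have "1 + ?t \<le> (1 + sqrt ?t)\<^sup>2" using t by (simp add: power2_sum)
    also have "\<dots> \<le> (exp (sqrt ?t))\<^sup>2" using t by (intro power_mono exp_ge_add_one_self) auto
    also have "\<dots> = exp (2 * sqrt s * \<delta> ^ n)" unfolding sq by (simp add: exp_double[symmetric] mult.assoc)
    finally have le: "1 + ?t \<le> exp (2 * sqrt s * \<delta> ^ n)" .
    have "gaussian_mean (s * \<delta> ^ (2 * Suc n)) = (1 + ?t) * gaussian_mean ?t"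
      using gaussian_mean_recursion[OF t] by (simp add: power2_eq_square mult_ac)
    also have "\<dots> \<le> exp (2 * sqrt s * \<delta> ^ n) * (gaussian_mean s * exp (2 * sqrt s * (\<Sum>i<n. \<delta> ^ i)))"
      using le t by (intro mult_mono Suc.IH gaussian_mean_nonneg) auto
    also have "\<dots> = gaussian_mean s * exp (2 * sqrt s * (\<Sum>i<Suc n. \<delta> ^ i))"
      by (simp add: exp_add distrib_left mult_ac)
    finally show ?case .
  qed simp
  have sum_le: "(\<Sum>i<n. \<delta> ^ i) \<le> \<kappa>" for n
    using \<delta>_pos \<delta>_less by (simp add: sum_gp_strict kappa_def divide_right_mono)
  have low: "(\<integral>x. x \<partial>\<mu>) - t / 2 * (\<integral>x. x ^ 3 \<partial>\<mu>) \<le> gaussian_mean t" if "0 \<le> t" for t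
  proof -
    have "(\<integral>x. x - t / 2 * x ^ 3 \<partial>\<mu>) \<le> gaussian_mean t"
      unfolding gaussian_mean_def
    proof (rule mean_mono)
      fix x :: real assume x: "0 \<le> x"
      have "x * (1 + - (t * x\<^sup>2 / 2)) \<le> x * exp (- (t * x\<^sup>2 / 2))"
        using x by (intro mult_left_mono exp_ge_add_one_self)
      then show "x - t / 2 * x ^ 3 \<le> x * exp (- (t * x\<^sup>2 / 2))"
        by (simp add: algebra_simps power2_eq_square power3_eq_cube)
    qed (use that in \<open>auto intro!: smooth_integrable smooth_intros\<close>)
    then show ?thesis
      by (subst (asm) Bochner_Integration.integral_diff) (auto intro!: smooth_integrable smooth_intros)
  qed
  have "(\<integral>x. x \<partial>\<mu>) \<le> gaussian_mean s * exp (2 * sqrt s * \<kappa>)"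
  proof (rule LIMSEQ_le_const2)
    have "(\<lambda>n. (\<integral>x. x \<partial>\<mu>) - s * (\<delta>\<^sup>2) ^ n / 2 * (\<integral>x. x ^ 3 \<partial>\<mu>)) \<longlonglongrightarrow>
        (\<integral>x. x \<partial>\<mu>) - s * 0 / 2 * (\<integral>x. x ^ 3 \<partial>\<mu>)"
      using q_less_1 by (intro tendsto_intros LIMSEQ_realpow_zero) auto
    then show "(\<lambda>n. (\<integral>x. x \<partial>\<mu>) - s * (\<delta>\<^sup>2) ^ n / 2 * (\<integral>x. x ^ 3 \<partial>\<mu>)) \<longlonglongrightarrow> (\<integral>x. x \<partial>\<mu>)"
      by simp
    show "\<exists>M. \<forall>n\<ge>M. (\<integral>x. x \<partial>\<mu>) - s * (\<delta>\<^sup>2) ^ n / 2 * (\<integral>x. x ^ 3 \<partial>\<mu>) \<le> gaussian_mean s * exp (2 * sqrt s * \<kappa>)"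
    proof (intro exI allI impI)
      fix n :: nat
      have "(\<integral>x. x \<partial>\<mu>) - s * (\<delta>\<^sup>2) ^ n / 2 * (\<integral>x. x ^ 3 \<partial>\<mu>) \<le> gaussian_mean (s * \<delta> ^ (2 * n))"
        using low[of "s * \<delta> ^ (2 * n)"] assms \<delta>_pos by (simp add: power_mult)
      also have "\<dots> \<le> gaussian_mean s * exp (2 * sqrt s * (\<Sum>i<n. \<delta> ^ i))" by (rule it)
      also have "\<dots> \<le> gaussian_mean s * exp (2 * sqrt s * \<kappa>)"
        using sum_le assms by (intro mult_left_mono gaussian_mean_nonneg) (auto intro!: mult_left_mono)
      finally show "(\<integral>x. x \<partial>\<mu>) - s * (\<delta>\<^sup>2) ^ n / 2 * (\<integral>x. x ^ 3 \<partial>\<mu>) \<le> gaussian_mean s * exp (2 * sqrt s * \<kappa>)" .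
    qed
  qed
  then have "1 / 2 \<le> gaussian_mean s * exp (2 * sqrt s * \<kappa>)" using first_moment_lower by simp
  then show ?thesis by (simp add: exp_minus field_simps)
qed

text \<open>
  The density of \<open>\<mu>\<close> vanishes to infinite order at the origin, so a quantitative lower bound on the
  mass there is needed. For large \<open>s\<close> the weight \<open>x * exp (- s * x\<^sup>2 / 2)\<close> puts at least half of its
  mass on \<open>[0, y]\<close>: beyond \<open>y\<close> it is smaller by the factor \<open>exp (- z)\<close> than the weight with parameter
  \<open>s * \<delta>\<^sup>2\<close>, whose total mass is only \<open>1 + s\<close> times larger by the recursion.
\<close>

lemma near_origin_mass:
  assumes y: "0 < y"
  shows "exp (- (2 * \<kappa> + 12 * \<kappa>\<^sup>2 / y\<^sup>2)) / 4 \<le> (\<integral>x. x * indicator {0..y} x \<partial>\<mu>)"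
proof -
  define q where "q = \<delta>\<^sup>2"
  have q: "0 < 1 - q" "q \<ge> 0" using q_less_1 by (auto simp: q_def)
  \<comment> \<open>s is chosen so large that 4 * s is at most half of z squared, hence (1 + s) * exp (- z) at most 1/2\<close>
  define s where "s = 1 + 32 / ((1 - q)\<^sup>2 * y ^ 4)"
  have s: "1 \<le> s" unfolding s_def using q y by simp
  define z where "z = (1 - q) * s * y\<^sup>2 / 2"
  have z: "0 < z" unfolding z_def using q s y by simp
  have "(1 + s) * exp (- z) \<le> 1 / 2"
  proof -
    have "1 + z + z\<^sup>2 / 2 \<le> exp z" using z exp_lower_Taylor_quadratic[of z] by simp
    then have "z\<^sup>2 / 2 \<le> exp z" using z by simp
    moreover have "4 * s \<le> z\<^sup>2 / 2"
    proof -
      have "32 / ((1 - q)\<^sup>2 * y ^ 4) \<le> s" by (simp add: s_def)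
      then have "32 \<le> s * ((1 - q)\<^sup>2 * y ^ 4)" using q y by (simp add: pos_divide_le_eq)
      then have "s * 32 \<le> s * (s * ((1 - q)\<^sup>2 * y ^ 4))" using s by (intro mult_left_mono) auto
      then show ?thesis unfolding z_def by (simp add: power2_eq_square eval_nat_numeral field_simps)
    qed
    ultimately have "2 * (1 + s) \<le> exp z" using s by simp
    then show ?thesis by (simp add: exp_minus field_simps)
  qed
  then have half: "gaussian_mean s / 2 \<le> gaussian_mean s - exp (- z) * ((1 + s) * gaussian_mean s)"
    using mult_right_mono[OF _ gaussian_mean_nonneg[of s], of "(1 + s) * exp (- z)" "1 / 2"] by (simp add: algebra_simps)
  have "gaussian_mean s - exp (- z) * gaussian_mean (s * \<delta>\<^sup>2) = (\<integral>x. x * exp (- (s * x\<^sup>2 / 2)) - exp (- z) * (x * exp (- (s * \<delta>\<^sup>2 * x\<^sup>2 / 2))) \<partial>\<mu>)"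
    unfolding gaussian_mean_def using s
    by (subst Bochner_Integration.integral_diff) (auto intro!: smooth_integrable smooth_intros)
  also have "\<dots> \<le> (\<integral>x. x * indicator {0..y} x \<partial>\<mu>)"
  proof (rule mean_mono)
    show "integrable \<mu> (\<lambda>x. x * exp (- (s * x\<^sup>2 / 2)) - exp (- z) * (x * exp (- (s * \<delta>\<^sup>2 * x\<^sup>2 / 2))))"
      using s by (intro smooth_integrable smooth_intros) auto
    have "integrable \<mu> (\<lambda>x. x)" by (auto intro!: smooth_integrable smooth_intros)
    then show "integrable \<mu> (\<lambda>x. x * indicator {0..y} x)"
      by (rule Bochner_Integration.integrable_bound)
        (auto intro!: borel_measurable_mu simp: indicator_def)
  next
    fix x :: real assume x: "0 \<le> x"
    show "x * exp (- (s * x\<^sup>2 / 2)) - exp (- z) * (x * exp (- (s * \<delta>\<^sup>2 * x\<^sup>2 / 2))) \<le> x * indicator {0..y} x"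
    proof (cases "x \<le> y")
      case True
      have "x * exp (- (s * x\<^sup>2 / 2)) \<le> x * 1" using x s by (intro mult_left_mono) auto
      moreover have "0 \<le> exp (- z) * (x * exp (- (s * \<delta>\<^sup>2 * x\<^sup>2 / 2)))" using x by simp
      ultimately have "x * exp (- (s * x\<^sup>2 / 2)) - exp (- z) * (x * exp (- (s * \<delta>\<^sup>2 * x\<^sup>2 / 2))) \<le> x"
        by linarith
      then show ?thesis using True x by simp
    next
      case False
      have "z \<le> (1 - q) * s * x\<^sup>2 / 2"
        unfolding z_def using False y q s by (intro divide_right_mono mult_left_mono power_mono) auto
      then have "- (s * x\<^sup>2 / 2) \<le> - z - s * \<delta>\<^sup>2 * x\<^sup>2 / 2" by (simp add: q_def field_simps)
      then have "exp (- (s * x\<^sup>2 / 2)) \<le> exp (- z - s * \<delta>\<^sup>2 * x\<^sup>2 / 2)" by simp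
      also have "\<dots> = exp (- z) * exp (- (s * \<delta>\<^sup>2 * x\<^sup>2 / 2))" by (simp add: exp_add[symmetric])
      finally have "x * exp (- (s * x\<^sup>2 / 2)) \<le> x * (exp (- z) * exp (- (s * \<delta>\<^sup>2 * x\<^sup>2 / 2)))"
        using x by (rule mult_left_mono)
      then show ?thesis using False x by (simp add: mult_ac)
    qed
  qed
  finally have main: "gaussian_mean s / 2 \<le> (\<integral>x. x * indicator {0..y} x \<partial>\<mu>)"
    using half gaussian_mean_recursion[of s] s by simp
  have "sqrt s \<le> 1 + 6 * \<kappa> / y\<^sup>2"
  proof (rule real_le_lsqrt)
    have "1 / (1 - q) \<le> \<kappa>" using kappa_q by (simp add: q_def)
    then have "(1 / (1 - q))\<^sup>2 \<le> \<kappa>\<^sup>2" using q by (intro power_mono) auto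
    then have "32 / y ^ 4 * (1 / (1 - q))\<^sup>2 \<le> 36 / y ^ 4 * \<kappa>\<^sup>2"
      using y by (intro mult_mono divide_right_mono) auto
    then have "s \<le> 1 + (6 * \<kappa> / y\<^sup>2)\<^sup>2"
      unfolding s_def using y by (simp add: power_divide power_mult_distrib mult.commute)
    also have "\<dots> \<le> (1 + 6 * \<kappa> / y\<^sup>2)\<^sup>2" using kappa_ge_1 y by (simp add: power2_sum)
    finally show "s \<le> (1 + 6 * \<kappa> / y\<^sup>2)\<^sup>2" .
  qed (use s kappa_ge_1 y in auto)
  then have "2 * sqrt s * \<kappa> \<le> 2 * (1 + 6 * \<kappa> / y\<^sup>2) * \<kappa>"
    using kappa_ge_1 by (intro mult_right_mono mult_left_mono) auto
  also have "\<dots> = 2 * \<kappa> + 12 * \<kappa>\<^sup>2 / y\<^sup>2" by (simp add: power2_eq_square algebra_simps)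
  finally have "exp (- (2 * \<kappa> + 12 * \<kappa>\<^sup>2 / y\<^sup>2)) \<le> exp (- 2 * sqrt s * \<kappa>)"
    by simp
  moreover have "exp (- 2 * sqrt s * \<kappa>) / 2 \<le> gaussian_mean s" using s by (intro gaussian_mean_lower) auto
  ultimately show ?thesis using main by linarith
qed

section \<open>Gaussian lower bound and pointwise control by the energy\<close>

text \<open>
  With \<open>G z = - exp (z\<^sup>2 / 2) * \<integral>\<^bsub>[z,\<infinity>)\<^esub> p y * exp (- y\<^sup>2 / 2) dy\<close>, the solution of
  \<open>G' = z * G + p\<close> that grows only polynomially, stationarity reads \<open>\<mu>(p) = - \<mu>(x * G (\<delta> * x))\<close>.
  Keeping only the part \<open>y \<in> [a, b]\<close> of the integral and \<open>\<delta> * x \<le> a\<close> of the mean gives the bound.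
\<close>

lemma gaussian_minorisation:
  assumes p: "p \<in> smooth_poly" "\<And>x. 0 \<le> x \<Longrightarrow> 0 \<le> p x"
    and Q: "half_deriv Q (\<lambda>y. p y * exp (- (y\<^sup>2 / 2)))" and ab: "0 \<le> a" "a \<le> b"
  shows "(Q b - Q a) * (\<integral>x. x * indicator {0..a / \<delta>} x \<partial>\<mu>) \<le> (\<integral>x. p x \<partial>\<mu>)"
proof -
  obtain C k where C: "0 \<le> C" "\<forall>x\<ge>0. \<bar>p x\<bar> \<le> C * (1 + x) ^ k"
    using poly_boundedE[OF smooth_poly_bounded[OF p(1)]] by blast
  have Q_mono: "Q x \<le> Q y" if "0 \<le> x" "x \<le> y" for x y
    by (rule half_deriv_mono[OF Q that]) (use p(2) that in auto)
  define z0 where "z0 = real k + 1"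
  have z0: "0 \<le> z0" by (simp add: z0_def)
  \<comment> \<open>the Gaussian tail beats the polynomial growth of p from z0 on\<close>
  have tail: "Q y - Q z \<le> C * (1 + z) ^ k * exp (- (z\<^sup>2 / 2))" if "z0 \<le> z" "z \<le> y" for y z
  proof -
    let ?R' = "\<lambda>x::real. exp (- (x\<^sup>2 / 2)) * (x * (C * (1 + x) ^ k) - C * (real k * (1 + x) ^ (k - 1)) - p x)"
    have "- (Q z + C * (1 + z) ^ k * exp (- (z\<^sup>2 / 2))) \<le> - (Q y + C * (1 + y) ^ k * exp (- (y\<^sup>2 / 2)))"
    proof (rule half_deriv_mono[where f = "\<lambda>x. - (Q x + C * (1 + x) ^ k * exp (- (x\<^sup>2 / 2)))" and f' = ?R'])
      show "half_deriv (\<lambda>x. - (Q x + C * (1 + x) ^ k * exp (- (x\<^sup>2 / 2)))) ?R'"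
        using Q unfolding half_deriv_def
        by (auto intro!: derivative_eq_intros simp: algebra_simps)
      fix x assume x: "z \<le> x" "x \<le> y"
      have x0: "0 \<le> x" using that x z0 by simp
      have "C * (real k * (1 + x) ^ (k - 1)) \<le> C * (real k * (1 + x) ^ k)"
        using x0 C(1) by (intro mult_left_mono power_increasing) auto
      moreover have "(real k + 1) * (C * (1 + x) ^ k) \<le> x * (C * (1 + x) ^ k)"
        using x that x0 C(1) by (intro mult_right_mono) (auto simp: z0_def)
      ultimately have "0 \<le> x * (C * (1 + x) ^ k) - C * (real k * (1 + x) ^ (k - 1)) - p x"
        using C(2)[rule_format, OF x0] by (simp add: algebra_simps)
      then show "0 \<le> ?R' x" by simp
    qed (use that z0 in auto)
    moreover have "0 \<le> C * (1 + y) ^ k * exp (- (y\<^sup>2 / 2))" using that z0 C(1) by simp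
    ultimately show ?thesis by simp
  qed
  define B where "B = Q z0 + C * (1 + z0) ^ k * exp (- (z0\<^sup>2 / 2))"
  have QB: "Q y \<le> B" if "0 \<le> y" for y
  proof (cases "y \<le> z0")
    case True
    have "0 \<le> C * (1 + z0) ^ k * exp (- (z0\<^sup>2 / 2))" using z0 C(1) by simp
    then show ?thesis using Q_mono[OF that True] by (simp add: B_def)
  next
    case False
    then show ?thesis using tail[of z0 y] by (simp add: B_def)
  qed
  \<comment> \<open>the integral over the whole half-line, as the supremum of its bounded increasing antiderivative\<close>
  define Qi where "Qi = (SUP y\<in>{0..}. Q y)"
  have bdd: "bdd_above (Q ` {0..})" using QB by (auto intro!: bdd_aboveI)
  have Qi_ge: "Q y \<le> Qi" if "0 \<le> y" for y
    unfolding Qi_def using that bdd by (intro cSUP_upper) auto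
  have Qi_le: "Qi - Q z \<le> C * (1 + z) ^ k * exp (- (z\<^sup>2 / 2))" if "z0 \<le> z" for z
  proof -
    have "Qi \<le> Q z + C * (1 + z) ^ k * exp (- (z\<^sup>2 / 2))"
      unfolding Qi_def
    proof (rule cSUP_least)
      fix y :: real assume y: "y \<in> {0..}"
      have "0 \<le> C * (1 + z) ^ k * exp (- (z\<^sup>2 / 2))" using that z0 C(1) by simp
      then show "Q y \<le> Q z + C * (1 + z) ^ k * exp (- (z\<^sup>2 / 2))"
        using tail[of z y] Q_mono[of y z] that y by (cases "z \<le> y") auto
    qed auto
    then show ?thesis by simp
  qed
  define G where "G z = exp (z\<^sup>2 / 2) * (Q z - Qi)" for z
  have hd: "half_deriv G (\<lambda>z. z * G z + p z)"
    unfolding half_deriv_def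
  proof (intro allI impI)
    fix z :: real assume z: "0 \<le> z"
    have "(G has_real_derivative exp (z\<^sup>2 / 2) * (z * 1) * (Q z - Qi) + exp (z\<^sup>2 / 2) * (p z * exp (- (z\<^sup>2 / 2))))
        (at z within {0..})"
      unfolding G_def using half_derivD[OF Q z]
      by (auto intro!: derivative_eq_intros)
    moreover have "exp (z\<^sup>2 / 2) * (z * 1) * (Q z - Qi) + exp (z\<^sup>2 / 2) * (p z * exp (- (z\<^sup>2 / 2)))
        = z * G z + p z"
      by (simp add: G_def exp_minus field_simps)
    ultimately show "(G has_real_derivative z * G z + p z) (at z within {0..})"
      by simp
  qed
  \<comment> \<open>C bounds G beyond z0, the second summand bounds it before z0\<close>
  define D where "D = C + exp (z0\<^sup>2 / 2) * (Qi - Q 0)"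
  have QQ: "0 \<le> exp (z0\<^sup>2 / 2) * (Qi - Q 0)" using Qi_ge[of 0] by simp
  have "poly_bounded G"
  proof (rule poly_boundedI[where C = D and k = k])
    fix z :: real assume z: "0 \<le> z"
    have abs: "\<bar>G z\<bar> = exp (z\<^sup>2 / 2) * (Qi - Q z)"
      using Qi_ge[OF z] by (simp add: G_def abs_mult)
    show "\<bar>G z\<bar> \<le> D * (1 + z) ^ k"
    proof (cases "z0 \<le> z")
      case True
      have "\<bar>G z\<bar> \<le> exp (z\<^sup>2 / 2) * (C * (1 + z) ^ k * exp (- (z\<^sup>2 / 2)))"
        unfolding abs using Qi_le[OF True] by (intro mult_left_mono) auto
      also have "\<dots> = C * (1 + z) ^ k" by (simp add: exp_minus field_simps)
      also have "\<dots> \<le> D * (1 + z) ^ k" using QQ z by (intro mult_right_mono) (auto simp: D_def)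
      finally show ?thesis .
    next
      case False
      have "z\<^sup>2 \<le> z0\<^sup>2" using False z by (intro power_mono) auto
      then have "\<bar>G z\<bar> \<le> exp (z0\<^sup>2 / 2) * (Qi - Q 0)"
        unfolding abs using Q_mono[of 0 z] Qi_ge[of 0] z Qi_ge[of z] by (intro mult_mono) auto
      also have "\<dots> \<le> D * 1" using C(1) by (simp add: D_def)
      also have "\<dots> \<le> D * (1 + z) ^ k"
        using QQ C(1) z by (intro mult_left_mono) (auto simp: D_def)
      finally show ?thesis .
    qed
  qed
  then have G: "G \<in> smooth_poly"
    by (rule smooth_polyI[OF _ hd]) (intro adjoined.intros smooth_poly_id p)
  have int: "integrable \<mu> (\<lambda>x. x * G x)" "integrable \<mu> p" "integrable \<mu> (\<lambda>x. - x * G (\<delta> * x))"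
    by (intro smooth_integrable smooth_intros G p smooth_dil[OF G])+
  have "(\<integral>x. x * G x + p x \<partial>\<mu>) = (\<integral>x. x * G x + (- x * G (\<delta> * x)) \<partial>\<mu>)"
    using stationarity(2)[OF G hd] by (simp add: algebra_simps)
  then have eq: "(\<integral>x. p x \<partial>\<mu>) = (\<integral>x. - x * G (\<delta> * x) \<partial>\<mu>)"
    using int by simp
  have "(Q b - Q a) * (\<integral>x. x * indicator {0..a / \<delta>} x \<partial>\<mu>)
      = (\<integral>x. (Q b - Q a) * (x * indicator {0..a / \<delta>} x) \<partial>\<mu>)" by simp
  also have "\<dots> \<le> (\<integral>x. - x * G (\<delta> * x) \<partial>\<mu>)"
  proof (rule mean_mono[OF _ int(3)])
    have "integrable \<mu> (\<lambda>x. x)" by (intro smooth_integrable smooth_intros)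
    then have "integrable \<mu> (\<lambda>x. x * indicator {0..a / \<delta>} x)"
      by (rule Bochner_Integration.integrable_bound)
        (auto intro!: borel_measurable_mu simp: indicator_def)
    then show "integrable \<mu> (\<lambda>x. (Q b - Q a) * (x * indicator {0..a / \<delta>} x))" by simp
    fix x :: real assume x: "0 \<le> x"
    have dx: "0 \<le> \<delta> * x" using x \<delta>_pos by simp
    show "(Q b - Q a) * (x * indicator {0..a / \<delta>} x) \<le> - x * G (\<delta> * x)"
    proof (cases "x \<le> a / \<delta>")
      case True
      then have "\<delta> * x \<le> a" using \<delta>_pos by (simp add: field_simps)
      then have le: "Q b - Q a \<le> Qi - Q (\<delta> * x)" "0 \<le> Qi - Q (\<delta> * x)"
        using Q_mono[OF dx] Qi_ge[of b] Qi_ge[OF dx] ab by (auto intro: diff_mono)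
      have "Qi - Q (\<delta> * x) \<le> exp ((\<delta> * x)\<^sup>2 / 2) * (Qi - Q (\<delta> * x))"
        using le(2) by (simp add: mult_ge1_I mult_le_cancel_right1)
      then have "x * (Q b - Q a) \<le> x * (exp ((\<delta> * x)\<^sup>2 / 2) * (Qi - Q (\<delta> * x)))"
        using le x by (intro mult_left_mono) auto
      then show ?thesis using True x by (simp add: G_def algebra_simps)
    next
      case False
      then show ?thesis using x Qi_ge[OF dx]
        by (simp add: G_def mult_nonneg_nonpos mult_nonpos_nonneg)
    qed
  qed
  finally show ?thesis using eq by simp
qed

text \<open>
  Stationarity for an antiderivative: averaging \<open>x * \<integral>\<^bsub>[\<delta> x, x]\<^esub> p\<close> gives back the mean of \<open>p\<close>. This is
  how squared increments between \<open>\<delta> * x\<close> and \<open>x\<close> are converted into energy.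
\<close>

lemma mean_square_transport:
  assumes p: "p \<in> smooth_poly"
  obtains P where "P \<in> smooth_poly" "half_deriv P p"
    "(\<integral>x. x * (P x - P (\<delta> * x)) \<partial>\<mu>) = (\<integral>x. p x \<partial>\<mu>)"
proof -
  obtain P where P: "P \<in> smooth_poly" "half_deriv P p"
    using smooth_poly_antiderivative[OF p] by blast
  then show thesis using that stationarity(2)[OF P] by simp
qed

definition energy :: "(real \<Rightarrow> real) \<Rightarrow> real" where
  "energy g = (\<integral>x. (hderiv g x)\<^sup>2 \<partial>\<mu>)"

lemma energy_nonneg: "0 \<le> energy g"
  unfolding energy_def by (intro mean_nonneg) auto

lemma mean_dilated_square:
  assumes g: "g \<in> smooth_poly"
  shows "(\<integral>x. (g (\<delta> * x))\<^sup>2 \<partial>\<mu>) \<le> 2 * (\<integral>x. (g x)\<^sup>2 \<partial>\<mu>) + 2 * energy g"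
proof -
  have g': "(\<lambda>x. (hderiv g x)\<^sup>2) \<in> smooth_poly"
    by (intro smooth_intros smooth_poly_hderiv g)
  obtain P where P: "P \<in> smooth_poly" "half_deriv P (\<lambda>x. (hderiv g x)\<^sup>2)"
    "(\<integral>x. x * (P x - P (\<delta> * x)) \<partial>\<mu>) = energy g"
    using mean_square_transport[OF g'] unfolding energy_def by blast
  have int: "integrable \<mu> (\<lambda>x. 2 * (g x)\<^sup>2)" "integrable \<mu> (\<lambda>x. 2 * (x * (P x - P (\<delta> * x))))"
    by (intro smooth_integrable smooth_intros g P smooth_dil[OF P(1)])+
  have "(\<integral>x. (g (\<delta> * x))\<^sup>2 \<partial>\<mu>) \<le> (\<integral>x. 2 * (g x)\<^sup>2 + 2 * (x * (P x - P (\<delta> * x))) \<partial>\<mu>)"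
  proof (rule mean_mono)
    show "integrable \<mu> (\<lambda>x. (g (\<delta> * x))\<^sup>2)"
      by (intro smooth_integrable smooth_intros smooth_dil[OF g])
    show "integrable \<mu> (\<lambda>x. 2 * (g x)\<^sup>2 + 2 * (x * (P x - P (\<delta> * x))))"
      using int by (rule Bochner_Integration.integrable_add)
    fix x :: real assume x: "0 \<le> x"
    have le: "0 \<le> \<delta> * x" "\<delta> * x \<le> x" using x \<delta>_pos \<delta>_less by (auto simp: mult_left_le_one_le)
    have "1 * (g x - g (\<delta> * x))\<^sup>2 \<le> (x - \<delta> * x) * (P x - P (\<delta> * x))"
      by (rule half_deriv_Cauchy_Schwarz[OF smooth_poly_half_deriv[OF g] P(2) le]) auto
    also have "\<dots> \<le> x * (P x - P (\<delta> * x))"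
      using half_deriv_mono[OF P(2) le] le by (intro mult_right_mono) auto
    finally have "(g x - g (\<delta> * x))\<^sup>2 \<le> x * (P x - P (\<delta> * x))" by simp
    moreover have "(g (\<delta> * x))\<^sup>2 \<le> 2 * (g x)\<^sup>2 + 2 * (g x - g (\<delta> * x))\<^sup>2"
      using zero_le_power2[of "2 * g x - g (\<delta> * x)"] by (simp add: power2_eq_square algebra_simps)
    ultimately show "(g (\<delta> * x))\<^sup>2 \<le> 2 * (g x)\<^sup>2 + 2 * (x * (P x - P (\<delta> * x)))" by linarith
  qed
  also have "\<dots> = 2 * (\<integral>x. (g x)\<^sup>2 \<partial>\<mu>) + 2 * energy g"
    by (subst Bochner_Integration.integral_add[OF int]) (simp add: P(3))
  finally show ?thesis .
qed

text \<open>
  Cauchy--Schwarz on the interval between \<open>1\<close> and \<open>x\<close>, with \<open>dy\<close> bounded by \<open>\<mu>\<close> through the Gaussian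
  minorisation. The base point \<open>1\<close> is arbitrary.
\<close>

lemma pointwise_bound:
  assumes g: "g \<in> smooth_poly" and x: "0 < x"
  defines "a \<equiv> min 1 x" and "b \<equiv> max 1 x"
  shows "(g x - g 1)\<^sup>2 \<le> (b - a) * exp (b\<^sup>2 / 2) * (4 * exp (2 * \<kappa> + 12 * \<kappa>\<^sup>2 / a\<^sup>2)) * energy g"
proof -
  have ab: "0 < a" "a \<le> b" using x by (auto simp: a_def b_def)
  have sm: "(\<lambda>y. (hderiv g y)\<^sup>2) \<in> smooth_poly"
    by (intro smooth_intros smooth_poly_hderiv g)
  have "(\<lambda>y. exp (- (1 * y\<^sup>2 / 2))) \<in> smooth_poly" by (intro smooth_intros) simp
  then have "(\<lambda>y. (hderiv g y)\<^sup>2 * exp (- (y\<^sup>2 / 2))) \<in> smooth_poly"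
    by (intro smooth_poly_mult sm) simp
  then obtain Q where Q: "half_deriv Q (\<lambda>y. (hderiv g y)\<^sup>2 * exp (- (y\<^sup>2 / 2)))"
    using smooth_poly_antiderivative by blast
  have "exp (- (b\<^sup>2 / 2)) * (g b - g a)\<^sup>2 \<le> (b - a) * (Q b - Q a)"
  proof (rule half_deriv_Cauchy_Schwarz[OF smooth_poly_half_deriv[OF g] Q])
    fix y assume "a \<le> y" "y \<le> b"
    then have "y\<^sup>2 \<le> b\<^sup>2" using ab by (intro power_mono) auto
    then have "exp (- (b\<^sup>2 / 2)) \<le> exp (- (y\<^sup>2 / 2))" by simp
    then show "exp (- (b\<^sup>2 / 2)) * (hderiv g y)\<^sup>2 \<le> (hderiv g y)\<^sup>2 * exp (- (y\<^sup>2 / 2))"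
      by (simp add: mult.commute mult_left_mono)
  qed (use ab in auto)
  then have 1: "(g b - g a)\<^sup>2 \<le> (b - a) * exp (b\<^sup>2 / 2) * (Q b - Q a)"
    by (simp add: exp_minus field_simps)
  let ?e = "exp (- (2 * \<kappa> + 12 * \<kappa>\<^sup>2 / a\<^sup>2)) / 4"
  have "a \<le> a / \<delta>" using ab \<delta>_pos \<delta>_less by (simp add: field_simps mult_left_le_one_le)
  then have "12 * \<kappa>\<^sup>2 / (a / \<delta>)\<^sup>2 \<le> 12 * \<kappa>\<^sup>2 / a\<^sup>2"
    using ab \<delta>_pos by (intro divide_left_mono power_mono) auto
  then have "?e \<le> exp (- (2 * \<kappa> + 12 * \<kappa>\<^sup>2 / (a / \<delta>)\<^sup>2)) / 4" by simp
  also have "\<dots> \<le> (\<integral>x. x * indicator {0..a / \<delta>} x \<partial>\<mu>)"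
    using ab \<delta>_pos by (intro near_origin_mass) auto
  finally have e: "?e \<le> (\<integral>x. x * indicator {0..a / \<delta>} x \<partial>\<mu>)" .
  have Qab: "0 \<le> Q b - Q a" using half_deriv_mono[OF Q, of a b] ab by simp
  have "(Q b - Q a) * ?e \<le> (Q b - Q a) * (\<integral>x. x * indicator {0..a / \<delta>} x \<partial>\<mu>)"
    using e Qab by (rule mult_left_mono)
  also have "\<dots> \<le> energy g"
    unfolding energy_def by (rule gaussian_minorisation[OF sm _ Q]) (use ab in auto)
  finally have "(Q b - Q a) * ?e \<le> energy g" .
  moreover have "A \<le> 4 * exp T * E" if "A * (exp (- T) / 4) \<le> E" for A T E :: real
  proof -
    have "A = A * (exp (- T) / 4) * (4 * exp T)" by (simp add: exp_minus)
    also have "\<dots> \<le> E * (4 * exp T)" using that by (intro mult_right_mono) auto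
    finally show ?thesis by (simp add: mult_ac)
  qed
  ultimately have 2: "Q b - Q a \<le> 4 * exp (2 * \<kappa> + 12 * \<kappa>\<^sup>2 / a\<^sup>2) * energy g" by blast
  have "(g x - g 1)\<^sup>2 = (g b - g a)\<^sup>2"
    by (auto simp: a_def b_def max_def min_def power2_commute)
  also note 1
  also have "(b - a) * exp (b\<^sup>2 / 2) * (Q b - Q a) \<le> (b - a) * exp (b\<^sup>2 / 2) * (4 * exp (2 * \<kappa> + 12 * \<kappa>\<^sup>2 / a\<^sup>2) * energy g)"
    using 2 ab by (intro mult_left_mono) auto
  finally show ?thesis by (simp add: mult.assoc)
qed

text \<open>
  The factors \<open>1 / (1 - \<delta>\<^sup>2\<^sup>n)\<close> of the moment recursion have a convergent product, so the odd moments
  grow as for the density \<open>exp (- x\<^sup>2 / 2)\<close>.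
\<close>

lemma odd_moment_upper_aux:
  "(\<integral>x. x ^ (2 * n + 1) \<partial>\<mu>) \<le> 2 ^ n * fact n * (\<kappa> * exp ((\<Sum>j=1..n. (\<delta>\<^sup>2) ^ j) * \<kappa>))"
proof (induction n)
  case 0
  then show ?case using first_moment_upper by simp
next
  case (Suc n)
  let ?r = "(\<delta>\<^sup>2) ^ Suc n"
  have r: "0 < ?r" "?r \<le> \<delta>\<^sup>2" "?r < 1"
  proof -
    show "0 < ?r" using \<delta>_pos by simp
    show "?r \<le> \<delta>\<^sup>2" using q_less_1 power_decreasing[of 1 "Suc n" "\<delta>\<^sup>2"] by simp
    then show "?r < 1" using q_less_1 by linarith
  qed
  have "1 / (1 - ?r) = 1 + ?r / (1 - ?r)" using r by (simp add: field_simps)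
  also have "\<dots> \<le> exp (?r / (1 - ?r))" by (rule exp_ge_add_one_self)
  also have "\<dots> \<le> exp (?r * \<kappa>)"
  proof -
    have "1 / (1 - ?r) \<le> 1 / (1 - \<delta>\<^sup>2)" using r q_less_1 by (intro divide_left_mono) auto
    then have "1 / (1 - ?r) \<le> \<kappa>" using kappa_q by linarith
    then have "?r * (1 / (1 - ?r)) \<le> ?r * \<kappa>" using r by (intro mult_left_mono) auto
    then show ?thesis by simp
  qed
  finally have le: "1 / (1 - ?r) \<le> exp (?r * \<kappa>)" .
  have "real (2 * Suc n) * (\<integral>x. x ^ (2 * n + 1) \<partial>\<mu>) = (1 - ?r) * (\<integral>x. x ^ (2 * Suc n + 1) \<partial>\<mu>)"
  proof -
    have "2 * Suc n - 1 = 2 * n + 1" by simp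
    then show ?thesis using moment_recursion[of "2 * Suc n"] by (simp only: power_mult)
  qed
  then have "(\<integral>x. x ^ (2 * Suc n + 1) \<partial>\<mu>) = real (2 * Suc n) * (1 / (1 - ?r)) * (\<integral>x. x ^ (2 * n + 1) \<partial>\<mu>)"
    using r by (simp add: field_simps)
  also have "\<dots> \<le> real (2 * Suc n) * exp (?r * \<kappa>) * (2 ^ n * fact n * (\<kappa> * exp ((\<Sum>j=1..n. (\<delta>\<^sup>2) ^ j) * \<kappa>)))"
    using le r by (intro mult_mono mult_left_mono Suc.IH mean_nonneg) auto
  also have "\<dots> = 2 ^ Suc n * fact (Suc n) * (\<kappa> * exp ((\<Sum>j=1..Suc n. (\<delta>\<^sup>2) ^ j) * \<kappa>))"
  proof -
    have "(\<Sum>j=1..Suc n. (\<delta>\<^sup>2) ^ j) * \<kappa> = (\<Sum>j=1..n. (\<delta>\<^sup>2) ^ j) * \<kappa> + ?r * \<kappa>"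
      by (simp add: distrib_right)
    then have "exp ((\<Sum>j=1..Suc n. (\<delta>\<^sup>2) ^ j) * \<kappa>) = exp ((\<Sum>j=1..n. (\<delta>\<^sup>2) ^ j) * \<kappa>) * exp (?r * \<kappa>)"
      by (simp only: exp_add)
    moreover have "real (2 * Suc n) * 2 ^ n * fact n = (2 ^ Suc n * fact (Suc n) :: real)" by simp
    moreover have "a * x * (b * c * (k * y)) = d * e * (k * (y * x))" if "a * b * c = d * e"
      for a b c d e k x y :: real
    proof -
      have "a * x * (b * c * (k * y)) = (a * b * c) * (k * (y * x))" by (simp add: mult_ac)
      then show ?thesis using that by simp
    qed
    ultimately show ?thesis by metis
  qed
  finally show ?case .
qed

lemma odd_moment_upper: "(\<integral>x. x ^ (2 * n + 1) \<partial>\<mu>) \<le> 2 ^ n * fact n * (\<kappa> * exp (\<kappa>\<^sup>2))"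
proof -
  have "(\<Sum>j=1..n. (\<delta>\<^sup>2) ^ j) \<le> 1 / (1 - \<delta>\<^sup>2)"
  proof -
    have "(\<Sum>j=1..n. (\<delta>\<^sup>2) ^ j) \<le> (\<Sum>j<Suc n. (\<delta>\<^sup>2) ^ j)"
      by (rule sum_mono2) auto
    also have "\<dots> = (1 - (\<delta>\<^sup>2) ^ Suc n) / (1 - \<delta>\<^sup>2)"
      using q_less_1 by (subst sum_gp_strict) auto
    also have "\<dots> \<le> 1 / (1 - \<delta>\<^sup>2)" using q_less_1 by (intro divide_right_mono) auto
    finally show ?thesis .
  qed
  then have "(\<Sum>j=1..n. (\<delta>\<^sup>2) ^ j) * \<kappa> \<le> \<kappa> * \<kappa>"
    using kappa_q kappa_ge_1 by (intro mult_right_mono) auto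
  then have "2 ^ n * fact n * (\<kappa> * exp ((\<Sum>j=1..n. (\<delta>\<^sup>2) ^ j) * \<kappa>)) \<le> 2 ^ n * fact n * (\<kappa> * exp (\<kappa>\<^sup>2))"
    using kappa_ge_1 by (intro mult_left_mono) (auto simp: power2_eq_square)
  then show ?thesis using odd_moment_upper_aux[of n] by linarith
qed

text \<open>
  Expansion of the exponential in powers of \<open>x\<close>; the series of moments converges because the exponent
  \<open>\<delta>\<^sup>2 / 2\<close> stays below the critical \<open>1 / 2\<close>. The weight \<open>exp (\<delta>\<^sup>2 * x\<^sup>2 / 2)\<close> is the size of the
  pointwise bound at the dilated point \<open>\<delta> * x\<close>.
\<close>

lemma gaussian_moment:
  "integrable \<mu> (\<lambda>x. x ^ 3 * exp (\<delta>\<^sup>2 * x\<^sup>2 / 2))"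
  "(\<integral>x. x ^ 3 * exp (\<delta>\<^sup>2 * x\<^sup>2 / 2) \<partial>\<mu>) \<le> 2 * \<kappa> ^ 3 * exp (\<kappa>\<^sup>2)"
proof -
  define f where "f n x = (\<delta>\<^sup>2) ^ n / (2 ^ n * fact n) * x ^ (2 * Suc n + 1)" for n and x :: real
  have f_sums: "(\<lambda>n. f n x) sums (x ^ 3 * exp (\<delta>\<^sup>2 * x\<^sup>2 / 2))" for x
  proof -
    have "(\<lambda>n. x ^ 3 * ((\<delta>\<^sup>2 * x\<^sup>2 / 2) ^ n /\<^sub>R fact n)) sums (x ^ 3 * exp (\<delta>\<^sup>2 * x\<^sup>2 / 2))"
      by (intro sums_mult exp_converges)
    moreover have "x ^ 3 * ((\<delta>\<^sup>2 * x\<^sup>2 / 2) ^ n /\<^sub>R fact n) = f n x" for n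
      unfolding f_def
      by (simp add: power_mult_distrib power_divide power_mult[symmetric] power_add
          divide_simps eval_nat_numeral)
    ultimately show ?thesis by simp
  qed
  have int: "integrable \<mu> (f n)" for n
    unfolding f_def by (intro smooth_integrable smooth_intros)
  have f_nonneg: "0 \<le> f n x" if "0 \<le> x" for n x using that by (simp add: f_def)
  have le: "(\<integral>x. f n x \<partial>\<mu>) \<le> 2 * \<kappa> * exp (\<kappa>\<^sup>2) * (of_nat (Suc n) * (\<delta>\<^sup>2) ^ n)" for n
  proof -
    have "(\<integral>x. f n x \<partial>\<mu>) = (\<delta>\<^sup>2) ^ n / (2 ^ n * fact n) * (\<integral>x. x ^ (2 * Suc n + 1) \<partial>\<mu>)"
      unfolding f_def by simp
    also have "\<dots> \<le> (\<delta>\<^sup>2) ^ n / (2 ^ n * fact n) * (2 ^ Suc n * fact (Suc n) * (\<kappa> * exp (\<kappa>\<^sup>2)))"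
      by (intro mult_left_mono odd_moment_upper) auto
    also have "\<dots> = 2 * \<kappa> * exp (\<kappa>\<^sup>2) * (of_nat (Suc n) * (\<delta>\<^sup>2) ^ n)"
      by (simp add: divide_simps)
    finally show ?thesis .
  qed
  have gs: "(\<lambda>n. of_nat (Suc n) * (\<delta>\<^sup>2) ^ n) sums (1 / (1 - \<delta>\<^sup>2)\<^sup>2)"
    using q_less_1 by (intro geometric_deriv_sums) simp
  then have gs': "(\<lambda>n. 2 * \<kappa> * exp (\<kappa>\<^sup>2) * (of_nat (Suc n) * (\<delta>\<^sup>2) ^ n)) sums (2 * \<kappa> * exp (\<kappa>\<^sup>2) * (1 / (1 - \<delta>\<^sup>2)\<^sup>2))"
    by (rule sums_mult)
  have nrm: "(\<integral>x. norm (f n x) \<partial>\<mu>) = (\<integral>x. f n x \<partial>\<mu>)" for n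
    using f_nonneg by (intro Bochner_Integration.integral_cong) auto
  have summ: "summable (\<lambda>n. \<integral>x. f n x \<partial>\<mu>)"
    by (rule summable_comparison_test'[OF sums_summable[OF gs'], of 0])
      (use le mean_nonneg f_nonneg in auto)
  have s1: "AE x in \<mu>. summable (\<lambda>n. norm (f n x))"
  proof (rule AE_I2)
    fix x assume "x \<in> space \<mu>"
    then have "(\<lambda>n. norm (f n x)) = (\<lambda>n. f n x)" using f_nonneg by auto
    then show "summable (\<lambda>n. norm (f n x))" using f_sums sums_summable by metis
  qed
  have eq: "(\<Sum>n. f n x) = x ^ 3 * exp (\<delta>\<^sup>2 * x\<^sup>2 / 2)" for x
    using sums_unique[OF f_sums] by simp
  have i: "integrable \<mu> (\<lambda>x. \<Sum>n. f n x)"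
    using int s1 summ unfolding nrm[symmetric] by (rule integrable_suminf)
  then show "integrable \<mu> (\<lambda>x. x ^ 3 * exp (\<delta>\<^sup>2 * x\<^sup>2 / 2))" by (simp add: eq)
  have "(\<integral>x. x ^ 3 * exp (\<delta>\<^sup>2 * x\<^sup>2 / 2) \<partial>\<mu>) = (\<Sum>n. \<integral>x. f n x \<partial>\<mu>)"
    using integral_suminf[OF int s1 summ[unfolded nrm[symmetric]]] by (simp add: eq)
  also have "\<dots> \<le> (\<Sum>n. 2 * \<kappa> * exp (\<kappa>\<^sup>2) * (of_nat (Suc n) * (\<delta>\<^sup>2) ^ n))"
    by (intro suminf_le le summ sums_summable[OF gs'])
  also have "\<dots> = 2 * \<kappa> * exp (\<kappa>\<^sup>2) * (1 / (1 - \<delta>\<^sup>2))\<^sup>2"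
    using sums_unique[OF gs'] by (simp add: power_divide)
  also have "\<dots> \<le> 2 * \<kappa> * exp (\<kappa>\<^sup>2) * \<kappa>\<^sup>2"
    using kappa_q kappa_ge_1 q_less_1 by (intro mult_left_mono power_mono) auto
  finally show "(\<integral>x. x ^ 3 * exp (\<delta>\<^sup>2 * x\<^sup>2 / 2) \<partial>\<mu>) \<le> 2 * \<kappa> ^ 3 * exp (\<kappa>\<^sup>2)"
    by (simp add: power2_eq_square power3_eq_cube mult_ac)
qed

end

section \<open>Logarithmic Sobolev inequality\<close>

lemma integrable_Fatou:
  fixes f :: "nat \<Rightarrow> 'a \<Rightarrow> real"
  assumes int: "\<And>n. integrable M (f n)" and nonneg: "\<And>n. AE x in M. 0 \<le> f n x"
    and lim: "AE x in M. (\<lambda>n. f n x) \<longlonglongrightarrow> g x" and g: "g \<in> borel_measurable M"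
    and le: "\<And>n. (\<integral>x. f n x \<partial>M) \<le> B"
  shows "integrable M g" "(\<integral>x. g x \<partial>M) \<le> B"
proof -
  have all: "AE x in M. \<forall>n. 0 \<le> f n x" using nonneg by (simp add: AE_all_countable)
  have B: "0 \<le> B" using le[of 0] integral_nonneg_AE[OF nonneg[of 0]] by linarith
  have g0: "AE x in M. 0 \<le> g x"
    using all lim by eventually_elim (auto intro: LIMSEQ_le_const)
  have nn: "(\<integral>\<^sup>+x. ennreal (g x) \<partial>M) \<le> ennreal B"
  proof -
    have "(\<integral>\<^sup>+x. ennreal (g x) \<partial>M) = (\<integral>\<^sup>+x. liminf (\<lambda>n. ennreal (f n x)) \<partial>M)"
    proof (rule nn_integral_cong_AE)
      show "AE x in M. ennreal (g x) = liminf (\<lambda>n. ennreal (f n x))"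
        using lim
      proof eventually_elim
        fix x assume "(\<lambda>n. f n x) \<longlonglongrightarrow> g x"
        then have "(\<lambda>n. ennreal (f n x)) \<longlonglongrightarrow> ennreal (g x)" by (rule tendsto_ennrealI)
        then show "ennreal (g x) = liminf (\<lambda>n. ennreal (f n x))"
          using lim_imp_Liminf[OF trivial_limit_sequentially] by metis
      qed
    qed
    also have "\<dots> \<le> liminf (\<lambda>n. \<integral>\<^sup>+x. ennreal (f n x) \<partial>M)"
      using int by (intro nn_integral_liminf) auto
    also have "\<dots> \<le> ennreal B"
    proof (rule Liminf_le)
      show "\<forall>\<^sub>F n in sequentially. (\<integral>\<^sup>+x. ennreal (f n x) \<partial>M) \<le> ennreal B"
        using le by (intro always_eventually allI) (simp add: nn_integral_eq_integral[OF int nonneg] ennreal_leI)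
    qed simp
    finally show ?thesis .
  qed
  have "(\<integral>\<^sup>+x. ennreal (g x) \<partial>M) < \<infinity>" using le_less_trans[OF nn ennreal_less_top] by simp
  with g g0 show i: "integrable M g" by (rule integrableI_nonneg)
  have "ennreal (\<integral>x. g x \<partial>M) \<le> ennreal B" using nn by (simp add: nn_integral_eq_integral[OF i g0])
  then show "(\<integral>x. g x \<partial>M) \<le> B" using B by (simp add: ennreal_le_iff)
qed

text \<open>
  Bound of the relative entropy density \<open>z * ln (z / s) - z + s\<close> at \<open>z = g\<^sup>2\<close> in terms of the deviation
  \<open>\<phi> = g - c\<close>. The reference level \<open>s = c\<^sup>2 + E\<close> covers both regimes: for \<open>\<phi>\<^sup>2 \<le> s\<close> the density is at
  most \<open>(z - s)\<^sup>2 / s\<close>, quadratic in \<open>\<phi>\<close>; for \<open>\<phi>\<^sup>2 > s\<close> it is at most of the order of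
  \<open>\<phi>\<^sup>2 * (1 + ln (\<phi>\<^sup>2 / E))\<close>, and the logarithm is bounded by \<open>W\<close>. Centering at a constant in this way yields the tight inequality
  directly, without passing through a defective one.
\<close>

lemma entropy_density_bound:
  fixes c E W \<phi> :: real
  assumes E: "0 < E" and W: "0 \<le> W" and le: "\<phi>\<^sup>2 \<le> E * exp W"
  defines "g \<equiv> c + \<phi>" and "s \<equiv> c\<^sup>2 + E"
  shows "g\<^sup>2 * ln (g\<^sup>2) - g\<^sup>2 * ln s - g\<^sup>2 + s \<le> 23 * \<phi>\<^sup>2 + 3 * E + 4 * (\<phi>\<^sup>2 * W)"
proof -
  have s: "0 < s" "E \<le> s" "c\<^sup>2 \<le> s" using E by (auto simp: s_def add_nonneg_pos)
  have pW: "0 \<le> \<phi>\<^sup>2 * W" using W by simp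
  show ?thesis
  proof (cases "g = 0")
    case True
    then have "c\<^sup>2 = \<phi>\<^sup>2" by (simp add: g_def add_eq_0_iff)
    with True E pW show ?thesis by (simp add: s_def)
  next
    case False
    define z where "z = g\<^sup>2"
    have z: "0 < z" using False by (simp add: z_def)
    have ln_eq: "z * ln z - z * ln s = z * ln (z / s)" using z s by (simp add: ln_div right_diff_distrib)
    show ?thesis
    proof (cases "\<phi>\<^sup>2 \<le> s")
      case True
      have "ln (z / s) \<le> z / s - 1" using z s by (intro ln_le_minus_one) simp
      then have "z * ln (z / s) \<le> z * (z / s - 1)" using z by (intro mult_left_mono) auto
      then have "z * ln (z / s) - z + s \<le> z * (z / s - 1) - z + s" by simp
      also have "\<dots> = (z - s)\<^sup>2 / s" using s by (simp add: power2_eq_square field_simps)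
      also have "z - s = 2 * c * \<phi> + \<phi>\<^sup>2 - E" by (simp add: z_def g_def s_def power2_sum)
      also have "(2 * c * \<phi> + \<phi>\<^sup>2 - E)\<^sup>2 / s \<le> (15 * \<phi>\<^sup>2 + 3 * E)"
      proof -
        have "(p + q - r)\<^sup>2 \<le> 3 * (p\<^sup>2 + q\<^sup>2 + r\<^sup>2)" for p q r :: real
          using zero_le_power2[of "p - q"] zero_le_power2[of "p + r"] zero_le_power2[of "q + r"]
          by (simp add: power2_eq_square algebra_simps)
        then have "(2 * c * \<phi> + \<phi>\<^sup>2 - E)\<^sup>2 \<le> 3 * ((2 * c * \<phi>)\<^sup>2 + (\<phi>\<^sup>2)\<^sup>2 + E\<^sup>2)" .
        also have "\<dots> = 12 * (c\<^sup>2 * \<phi>\<^sup>2) + 3 * (\<phi>\<^sup>2 * \<phi>\<^sup>2) + 3 * (E * E)"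
          by (simp add: power2_eq_square algebra_simps)
        also have "\<dots> \<le> 12 * (s * \<phi>\<^sup>2) + 3 * (s * \<phi>\<^sup>2) + 3 * (s * E)"
          using s True E by (intro add_mono mult_left_mono mult_right_mono) auto
        also have "\<dots> = (15 * \<phi>\<^sup>2 + 3 * E) * s" by (simp add: algebra_simps)
        finally show ?thesis using s by (simp add: pos_divide_le_eq)
      qed
      finally show ?thesis using ln_eq pW zero_le_power2[of \<phi>] unfolding z_def by linarith
    next
      case False
      have "0 \<le> (c - \<phi>)\<^sup>2" by simp
      then have "z \<le> 2 * c\<^sup>2 + 2 * \<phi>\<^sup>2" by (simp add: z_def g_def power2_eq_square algebra_simps)
      with False s have z4: "z \<le> 4 * \<phi>\<^sup>2" by linarith
      show ?thesis
      proof (cases "z \<le> s")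
        case True
        then have "ln (z / s) \<le> 0" using z s by simp
        then have "z * ln (z / s) \<le> 0" using z by (simp add: mult_nonneg_nonpos)
        then show ?thesis
          using ln_eq pW False E zero_le_power2[of g] zero_le_power2[of \<phi>] unfolding z_def by linarith
      next
        case z_gt: False
        have "ln (z / s) \<le> ln (4 * exp W)"
        proof (subst ln_le_cancel_iff)
          have "z \<le> 4 * exp W * E" using z4 le by (simp add: mult_ac)
          also have "\<dots> \<le> 4 * exp W * s" using s by (intro mult_left_mono) auto
          finally show "z / s \<le> 4 * exp W" using s by (simp add: pos_divide_le_eq)
        qed (use z s in auto)
        also have "\<dots> = ln 4 + W" by (simp add: ln_mult)
        also have "ln (4 :: real) \<le> 2" 
        proof -
          have "ln (4 :: real) = 2 * ln 2" using ln_realpow[of 2 2] by simp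
          then show ?thesis using ln_2_less_1 by simp
        qed
        finally have "ln (z / s) \<le> 2 + W" by simp
        moreover have "0 \<le> ln (z / s)" using z_gt s by simp
        ultimately have "z * ln (z / s) \<le> (4 * \<phi>\<^sup>2) * (2 + W)"
          using z4 z W by (intro mult_mono) auto
        then have "z * ln (z / s) \<le> 8 * \<phi>\<^sup>2 + 4 * (\<phi>\<^sup>2 * W)" by (simp add: algebra_simps)
        then show ?thesis
          using ln_eq z_gt E zero_le_power2[of \<phi>] unfolding z_def by linarith
      qed
    qed
  qed
qed

text \<open>
  The constants of the successive estimates, as functions of \<open>\<delta>\<close>: the factor of the pointwise bound
  beyond \<open>1\<close>; the pointwise bound on \<open>[\<delta> / 5, 5 / \<delta>]\<close>, outside of which the weight \<open>x\<^sup>2 + 1 / x\<^sup>2\<close>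
  exceeds \<open>25 / \<delta>\<^sup>2\<close>; and the coefficients of the energy in the Hardy, Poincare and logarithmic Sobolev
  inequalities. Powers are written as products so that they are visibly closed forms.
\<close>

definition pointwise_const :: "real \<Rightarrow> real" where "pointwise_const d = 4 * exp (2 * kappa d + 12 * (kappa d * kappa d))"
definition bulk_const :: "real \<Rightarrow> real" where
  "bulk_const d = (5 / d) * exp ((25 / (d * d)) / 2) * (4 * exp (2 * kappa d + 12 * (kappa d * kappa d) * (25 / (d * d))))"
definition energy_const :: "real \<Rightarrow> real" where
  "energy_const d = 16 / (d * d) + 4 * pointwise_const d * (kappa d * kappa d * kappa d) * exp (kappa d * kappa d)"
definition Poincare_const :: "real \<Rightarrow> real" where "Poincare_const d = 2 * bulk_const d + 2 * energy_const d"
definition weighted_Poincare_const :: "real \<Rightarrow> real" where "weighted_Poincare_const d = 10 / (d * d) * Poincare_const d + energy_const d"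
definition log_Sobolev_const :: "real \<Rightarrow> real" where
  "log_Sobolev_const d = 23 * Poincare_const d + 3 * exp 1 * pointwise_const d + 48 * (kappa d * kappa d) * weighted_Poincare_const d"

context stationary_half_line begin

lemma energy_cong:
  assumes "half_deriv g g'" shows "energy g = (\<integral>x. (g' x)\<^sup>2 \<partial>\<mu>)"
  unfolding energy_def using half_deriv_hderiv[OF assms]
  by (intro Bochner_Integration.integral_cong) auto

text \<open>
  In stationarity for the test function \<open>- g\<^sup>2 / (x + e)\<close>, differentiating the weight creates the
  singular term \<open>g\<^sup>2 / (x + e)\<^sup>2\<close>, while the jump rate \<open>x\<close> cancels the singularity in the jump term.
\<close>

lemma Hardy_shifted:
  assumes g: "g \<in> smooth_poly" and e: "0 < e"
  shows "(\<integral>x. (g x * (1 / (x + e)))\<^sup>2 \<partial>\<mu>) \<le> 4 * energy g + 2 / \<delta> * (\<integral>x. (g (\<delta> * x))\<^sup>2 \<partial>\<mu>)"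
proof -
  let ?i = "\<lambda>x::real. 1 / (x + e)"
  let ?G = "\<lambda>x. - ((g x)\<^sup>2 * ?i x)"
  let ?G' = "\<lambda>x. (g x * ?i x)\<^sup>2 - 2 * (g x * ?i x) * hderiv g x"
  note sm = smooth_intros g smooth_poly_hderiv[OF g] smooth_dil[OF g] e
  have G: "?G \<in> smooth_poly" by (intro sm)
  have hd: "half_deriv ?G ?G'"
    unfolding half_deriv_def
  proof (intro allI impI)
    fix x :: real assume x: "0 \<le> x"
    have "(?G has_real_derivative - ((g x)\<^sup>2 * (- 1 / (x + e)\<^sup>2) + 2 * g x * hderiv g x * ?i x)) (at x within {0..})"
      using half_derivD[OF smooth_poly_half_deriv[OF g] x] x e
      by (auto intro!: derivative_eq_intros simp: power2_eq_square divide_simps)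
    moreover have "- ((g x)\<^sup>2 * (- 1 / (x + e)\<^sup>2) + 2 * g x * hderiv g x * ?i x) = ?G' x"
      by (simp add: power_divide power_mult_distrib)
    ultimately show "(?G has_real_derivative ?G' x) (at x within {0..})" by simp
  qed
  have i1: "integrable \<mu> (\<lambda>x. (g x * ?i x)\<^sup>2)" "integrable \<mu> (\<lambda>x. (hderiv g x)\<^sup>2)"
    "integrable \<mu> (\<lambda>x. (g (\<delta> * x))\<^sup>2)"
    by (intro smooth_integrable sm)+
  have iG: "integrable \<mu> (\<lambda>x. x * (?G x - ?G (\<delta> * x)))"
    by (intro smooth_integrable smooth_intros G smooth_dil[OF G])
  have "(\<integral>x. (g x * ?i x)\<^sup>2 \<partial>\<mu>) / 2 - 2 * energy g = (\<integral>x. (g x * ?i x)\<^sup>2 / 2 - 2 * (hderiv g x)\<^sup>2 \<partial>\<mu>)"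
    using i1 by (simp add: energy_def)
  also have "\<dots> \<le> (\<integral>x. ?G' x \<partial>\<mu>)"
  proof (rule mean_mono)
    show "integrable \<mu> ?G'" using stationarity(1)[OF G hd] .
    fix x
    show "(g x * ?i x)\<^sup>2 / 2 - 2 * (hderiv g x)\<^sup>2 \<le> ?G' x"
      using zero_le_power2[of "g x * ?i x - 2 * hderiv g x"] by (simp add: power2_diff)
  qed (use i1 in auto)
  also have "\<dots> = (\<integral>x. x * (?G x - ?G (\<delta> * x)) \<partial>\<mu>)" by (rule stationarity(2)[OF G hd])
  also have "\<dots> \<le> (\<integral>x. 1 / \<delta> * (g (\<delta> * x))\<^sup>2 \<partial>\<mu>)"
  proof (rule mean_mono[OF iG])
    fix x :: real assume x: "0 \<le> x"
    have pos: "0 < \<delta> * x + e" using x \<delta>_pos e by (simp add: add_nonneg_pos)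
    have "x * ?i (\<delta> * x) \<le> 1 / \<delta>" using pos \<delta>_pos e by (simp add: field_simps)
    then have "(g (\<delta> * x))\<^sup>2 * (x * ?i (\<delta> * x)) \<le> (g (\<delta> * x))\<^sup>2 * (1 / \<delta>)"
      by (intro mult_left_mono) auto
    moreover have "0 \<le> x * ((g x)\<^sup>2 * ?i x)" using x e by simp
    ultimately show "x * (?G x - ?G (\<delta> * x)) \<le> 1 / \<delta> * (g (\<delta> * x))\<^sup>2"
      by (simp add: algebra_simps)
  qed (use i1 in simp)
  also have "\<dots> = 1 / \<delta> * (\<integral>x. (g (\<delta> * x))\<^sup>2 \<partial>\<mu>)" by simp
  finally show ?thesis by simp
qed

text \<open>
  The Hardy inequality for \<open>g = 1\<close> bounds the mean of \<open>1 / (x + e)\<^sup>2\<close> uniformly in \<open>e\<close>, which an atom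
  at the origin would violate.
\<close>

lemma AE_positive: "AE x in \<mu>. 0 < x"
proof -
  have meas: "{0} \<in> sets \<mu>"
    unfolding sets_half_line half_line_def by (simp add: sets_restrict_space_iff)
  have "half_deriv (\<lambda>x. 1) (\<lambda>x. 0)" by (simp add: half_deriv_def)
  then have E: "energy (\<lambda>x. 1) = 0" by (simp add: energy_cong)
  have le: "prob {0} \<le> 2 / \<delta> * e\<^sup>2" if e: "0 < e" for e :: real
  proof -
    have "prob {0} / e\<^sup>2 = (\<integral>x. indicator {0} x / e\<^sup>2 \<partial>\<mu>)"
      using space_half_line by (simp add: Int_absorb2)
    also have "\<dots> \<le> (\<integral>x. (1 * (1 / (x + e)))\<^sup>2 \<partial>\<mu>)"
    proof (rule mean_mono)
      show "integrable \<mu> (\<lambda>x. indicator {0} x / e\<^sup>2)" using meas by (simp add: emeasure_eq_measure)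
      show "integrable \<mu> (\<lambda>x. (1 * (1 / (x + e)))\<^sup>2)" using e by (intro smooth_integrable smooth_intros)
    qed (auto simp: indicator_def power_divide)
    also have "\<dots> \<le> 2 / \<delta>"
      using Hardy_shifted[OF smooth_poly_const[of 1] e] by (simp add: E prob_space)
    finally show ?thesis using e by (simp add: pos_divide_le_eq)
  qed
  have "prob {0} \<le> 0"
  proof (rule field_le_epsilon)
    fix e :: real assume e: "0 < e"
    have "prob {0} \<le> 2 / \<delta> * (sqrt (e * \<delta> / 2))\<^sup>2" using e \<delta>_pos by (intro le) simp
    also have "\<dots> = e" using e \<delta>_pos by simp
    finally show "prob {0} \<le> 0 + e" by simp
  qed
  then have "prob {0} = 0" by (simp add: measure_nonneg antisym)
  then have "AE x in \<mu>. x \<notin> {0}"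
    using meas by (intro AE_not_in) (simp add: null_sets_def emeasure_eq_measure)
  then show ?thesis
    using AE_space[of \<mu>] by eventually_elim (auto simp: space_half_line)
qed

lemma Hardy_origin:
  assumes g: "g \<in> smooth_poly"
  shows "integrable \<mu> (\<lambda>x. (g x)\<^sup>2 / x\<^sup>2)"
    "(\<integral>x. (g x)\<^sup>2 / x\<^sup>2 \<partial>\<mu>) \<le> 4 * energy g + 2 / \<delta> * (\<integral>x. (g (\<delta> * x))\<^sup>2 \<partial>\<mu>)"
proof -
  let ?f = "\<lambda>n x. (g x * (1 / (x + 1 / Suc n)))\<^sup>2"
  have int: "integrable \<mu> (?f n)" for n by (intro smooth_integrable smooth_intros g) simp
  have lim: "AE x in \<mu>. (\<lambda>n. ?f n x) \<longlonglongrightarrow> (g x)\<^sup>2 / x\<^sup>2"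
    using AE_positive
  proof eventually_elim
    fix x :: real assume "0 < x"
    have "(\<lambda>n. ?f n x) \<longlonglongrightarrow> (g x * (1 / (x + 0)))\<^sup>2"
      using \<open>0 < x\<close> lim_1_over_n[THEN LIMSEQ_Suc]
      by (intro tendsto_intros) (auto simp: )
    then show "(\<lambda>n. ?f n x) \<longlonglongrightarrow> (g x)\<^sup>2 / x\<^sup>2" by (simp add: power_divide)
  qed
  have meas: "(\<lambda>x. (g x)\<^sup>2 / x\<^sup>2) \<in> borel_measurable \<mu>"
    by (intro borel_measurable_divide borel_measurable_power smooth_measurable g smooth_poly_id)
  note * = integrable_Fatou[OF int _ lim meas Hardy_shifted[OF g]]
  show "integrable \<mu> (\<lambda>x. (g x)\<^sup>2 / x\<^sup>2)" by (rule *) auto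
  show "(\<integral>x. (g x)\<^sup>2 / x\<^sup>2 \<partial>\<mu>) \<le> 4 * energy g + 2 / \<delta> * (\<integral>x. (g (\<delta> * x))\<^sup>2 \<partial>\<mu>)" by (rule *) auto
qed

text \<open>
  The test function \<open>x * g\<^sup>2\<close> produces the weight \<open>x\<^sup>2\<close> from the jump rate; the price is the same
  weight at the dilated point, estimated separately.
\<close>

lemma weight_infinity:
  assumes g: "g \<in> smooth_poly"
  shows "(\<integral>x. x\<^sup>2 * (g x)\<^sup>2 \<partial>\<mu>) \<le> 2 * (\<integral>x. (g x)\<^sup>2 \<partial>\<mu>) + 4 * energy g + 2 * (\<integral>x. x\<^sup>2 * (g (\<delta> * x))\<^sup>2 \<partial>\<mu>)"
proof -
  let ?G = "\<lambda>x. x * (g x)\<^sup>2"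
  let ?G' = "\<lambda>x. (g x)\<^sup>2 + 2 * (x * g x) * hderiv g x"
  note sm = smooth_intros g smooth_poly_hderiv[OF g] smooth_dil[OF g]
  have G: "?G \<in> smooth_poly" by (intro sm)
  have hd: "half_deriv ?G ?G'"
    unfolding half_deriv_def using half_derivD[OF smooth_poly_half_deriv[OF g]]
    by (auto intro!: derivative_eq_intros)
  have i: "integrable \<mu> (\<lambda>x. (g x)\<^sup>2)" "integrable \<mu> (\<lambda>x. (hderiv g x)\<^sup>2)"
    "integrable \<mu> (\<lambda>x. x\<^sup>2 * (g (\<delta> * x))\<^sup>2)" "integrable \<mu> (\<lambda>x. x\<^sup>2 * (g x)\<^sup>2)"
    by (intro smooth_integrable sm)+
  have "(\<integral>x. x\<^sup>2 * (g x)\<^sup>2 \<partial>\<mu>) - (\<integral>x. x\<^sup>2 * (g (\<delta> * x))\<^sup>2 \<partial>\<mu>)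
      = (\<integral>x. x\<^sup>2 * (g x)\<^sup>2 - x\<^sup>2 * (g (\<delta> * x))\<^sup>2 \<partial>\<mu>)" using i by simp
  also have "\<dots> \<le> (\<integral>x. x * (?G x - ?G (\<delta> * x)) \<partial>\<mu>)"
  proof (rule mean_mono)
    show "integrable \<mu> (\<lambda>x. x * (?G x - ?G (\<delta> * x)))"
      by (intro smooth_integrable smooth_intros G smooth_dil[OF G])
    fix x :: real assume "0 \<le> x"
    have "\<delta> * (x\<^sup>2 * (g (\<delta> * x))\<^sup>2) \<le> x\<^sup>2 * (g (\<delta> * x))\<^sup>2"
      using \<delta>_pos \<delta>_less by (intro mult_left_le_one_le) auto
    then show "x\<^sup>2 * (g x)\<^sup>2 - x\<^sup>2 * (g (\<delta> * x))\<^sup>2 \<le> x * (?G x - ?G (\<delta> * x))"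
      by (simp add: power2_eq_square algebra_simps)
  qed (use i in auto)
  also have "\<dots> = (\<integral>x. ?G' x \<partial>\<mu>)" using stationarity(2)[OF G hd] by simp
  also have "\<dots> \<le> (\<integral>x. (g x)\<^sup>2 + ((x\<^sup>2 * (g x)\<^sup>2) / 2 + 2 * (hderiv g x)\<^sup>2) \<partial>\<mu>)"
  proof (rule mean_mono)
    show "integrable \<mu> ?G'" using stationarity(1)[OF G hd] .
    fix x
    show "?G' x \<le> (g x)\<^sup>2 + ((x\<^sup>2 * (g x)\<^sup>2) / 2 + 2 * (hderiv g x)\<^sup>2)"
      using zero_le_power2[of "x * g x - 2 * hderiv g x"] by (simp add: power2_diff power_mult_distrib)
  qed (use i in auto)
  also have "\<dots> = (\<integral>x. (g x)\<^sup>2 \<partial>\<mu>) + (\<integral>x. x\<^sup>2 * (g x)\<^sup>2 \<partial>\<mu>) / 2 + 2 * energy g"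
    using i by (simp add: energy_def)
  finally show ?thesis by simp
qed

text \<open>
  For \<open>\<delta> * x \<le> 1\<close> the factor \<open>x\<^sup>2\<close> is bounded. For \<open>\<delta> * x > 1\<close> the pointwise bound at \<open>\<delta> * x\<close> costs
  only \<open>exp (\<delta>\<^sup>2 * x\<^sup>2 / 2)\<close>, which \<open>\<mu>\<close> integrates.
\<close>

lemma weighted_dilated_square:
  assumes g: "g \<in> smooth_poly" "g 1 = 0"
  shows "(\<integral>x. x\<^sup>2 * (g (\<delta> * x))\<^sup>2 \<partial>\<mu>)
    \<le> 1 / \<delta>\<^sup>2 * (2 * (\<integral>x. (g x)\<^sup>2 \<partial>\<mu>) + 2 * energy g) + pointwise_const \<delta> * energy g * (2 * \<kappa> ^ 3 * exp (\<kappa>\<^sup>2))"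
proof -
  have KE: "0 \<le> pointwise_const \<delta> * energy g" using energy_nonneg by (simp add: pointwise_const_def)
  have i: "integrable \<mu> (\<lambda>x. x\<^sup>2 * (g (\<delta> * x))\<^sup>2)" "integrable \<mu> (\<lambda>x. (g (\<delta> * x))\<^sup>2)"
    by (intro smooth_integrable smooth_intros smooth_dil g)+
  have "(\<integral>x. x\<^sup>2 * (g (\<delta> * x))\<^sup>2 \<partial>\<mu>)
    \<le> (\<integral>x. 1 / \<delta>\<^sup>2 * (g (\<delta> * x))\<^sup>2 + pointwise_const \<delta> * energy g * (x ^ 3 * exp (\<delta>\<^sup>2 * x\<^sup>2 / 2)) \<partial>\<mu>)"
  proof (rule mean_mono[OF i(1)])
    show "integrable \<mu> (\<lambda>x. 1 / \<delta>\<^sup>2 * (g (\<delta> * x))\<^sup>2 + pointwise_const \<delta> * energy g * (x ^ 3 * exp (\<delta>\<^sup>2 * x\<^sup>2 / 2)))"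
      using i(2) gaussian_moment(1) by (intro Bochner_Integration.integrable_add integrable_mult_right)
    fix x :: real assume x: "0 \<le> x"
    have nn: "0 \<le> x ^ 3 * exp (\<delta>\<^sup>2 * x\<^sup>2 / 2)" using x by simp
    show "x\<^sup>2 * (g (\<delta> * x))\<^sup>2 \<le> 1 / \<delta>\<^sup>2 * (g (\<delta> * x))\<^sup>2 + pointwise_const \<delta> * energy g * (x ^ 3 * exp (\<delta>\<^sup>2 * x\<^sup>2 / 2))"
    proof (cases "\<delta> * x \<le> 1")
      case True
      then have "x \<le> 1 / \<delta>" using \<delta>_pos by (simp add: field_simps)
      then have "x\<^sup>2 \<le> (1 / \<delta>)\<^sup>2" using x by (intro power_mono)
      then have "x\<^sup>2 * (g (\<delta> * x))\<^sup>2 \<le> 1 / \<delta>\<^sup>2 * (g (\<delta> * x))\<^sup>2"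
        by (intro mult_right_mono) (auto simp: power_divide)
      then show ?thesis using mult_nonneg_nonneg[OF KE nn] by linarith
    next
      case False
      have "(g (\<delta> * x) - g 1)\<^sup>2 \<le> (max 1 (\<delta> * x) - min 1 (\<delta> * x)) * exp ((max 1 (\<delta> * x))\<^sup>2 / 2) *
          (4 * exp (2 * \<kappa> + 12 * \<kappa>\<^sup>2 / (min 1 (\<delta> * x))\<^sup>2)) * energy g"
        by (rule pointwise_bound[OF g(1)]) (use False in simp)
      then have "(g (\<delta> * x))\<^sup>2 \<le> (\<delta> * x - 1) * exp ((\<delta> * x)\<^sup>2 / 2) * pointwise_const \<delta> * energy g"
        using False g(2) by (simp add: pointwise_const_def max_def min_def power2_eq_square)
      also have "\<dots> \<le> x * exp ((\<delta> * x)\<^sup>2 / 2) * pointwise_const \<delta> * energy g"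
      proof (intro mult_right_mono energy_nonneg)
        have "\<delta> * x \<le> x" using x \<delta>_pos \<delta>_less by (simp add: mult_left_le_one_le)
        then show "\<delta> * x - 1 \<le> x" by simp
      qed (auto simp: pointwise_const_def)
      finally have "x\<^sup>2 * (g (\<delta> * x))\<^sup>2 \<le> x\<^sup>2 * (x * exp ((\<delta> * x)\<^sup>2 / 2) * pointwise_const \<delta> * energy g)"
        by (rule mult_left_mono) simp
      also have "\<dots> = pointwise_const \<delta> * energy g * (x ^ 3 * exp (\<delta>\<^sup>2 * x\<^sup>2 / 2))"
        by (simp add: power2_eq_square power3_eq_cube mult_ac)
      moreover have "0 \<le> 1 / \<delta>\<^sup>2 * (g (\<delta> * x))\<^sup>2" by simp
      ultimately show ?thesis by linarith
    qed
  qed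
  also have "\<dots> = 1 / \<delta>\<^sup>2 * (\<integral>x. (g (\<delta> * x))\<^sup>2 \<partial>\<mu>) + pointwise_const \<delta> * energy g * (\<integral>x. x ^ 3 * exp (\<delta>\<^sup>2 * x\<^sup>2 / 2) \<partial>\<mu>)"
    using i(2) gaussian_moment(1) by simp
  also have "\<dots> \<le> 1 / \<delta>\<^sup>2 * (2 * (\<integral>x. (g x)\<^sup>2 \<partial>\<mu>) + 2 * energy g) + pointwise_const \<delta> * energy g * (2 * \<kappa> ^ 3 * exp (\<kappa>\<^sup>2))"
    using mean_dilated_square[OF g(1)] gaussian_moment(2) KE by (intro add_mono mult_left_mono) auto
  finally show ?thesis .
qed

text \<open>
  The Hardy inequalities bound the weighted norm by the energy plus \<open>10 / \<delta>\<^sup>2\<close> times the plain norm.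
  The plain norm is controlled pointwise on \<open>[1 / R, R]\<close> and, outside, by the weighted norm divided by
  \<open>R\<^sup>2\<close>; with \<open>R = 5 / \<delta>\<close> the two estimates close.
\<close>

lemma weighted_Poincare:
  assumes g: "g \<in> smooth_poly" "g 1 = 0"
  shows "(\<integral>x. (g x)\<^sup>2 \<partial>\<mu>) \<le> Poincare_const \<delta> * energy g"
    "(\<integral>x. x\<^sup>2 * (g x)\<^sup>2 + (g x)\<^sup>2 / x\<^sup>2 \<partial>\<mu>) \<le> weighted_Poincare_const \<delta> * energy g"
proof -
  define m2 where "m2 = (\<integral>x. (g x)\<^sup>2 \<partial>\<mu>)"
  define E where "E = energy g"
  define i where "i = 1 / \<delta>"
  have i1: "1 \<le> i" using \<delta>_pos \<delta>_less by (simp add: i_def)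
  then have ii: "i \<le> i\<^sup>2" "1 \<le> i\<^sup>2" by (auto simp: power2_eq_square intro: mult_mono[of 1 i 1 i, simplified])
  have nn: "0 \<le> m2" "0 \<le> E" unfolding m2_def E_def by (auto intro: mean_nonneg energy_nonneg)
  have kpos: "0 < \<kappa>" using kappa_ge_1 by simp
  have energy_const: "energy_const \<delta> = 16 * i\<^sup>2 + 4 * pointwise_const \<delta> * \<kappa> ^ 3 * exp (\<kappa>\<^sup>2)"
    by (simp add: energy_const_def i_def power2_eq_square power3_eq_cube power_divide)
  have int: "integrable \<mu> (\<lambda>x. x\<^sup>2 * (g x)\<^sup>2)" "integrable \<mu> (\<lambda>x. (g x)\<^sup>2)"
    by (intro smooth_integrable smooth_intros g)+
  note J = Hardy_origin[OF g(1)]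
  have intW: "integrable \<mu> (\<lambda>x. x\<^sup>2 * (g x)\<^sup>2 + (g x)\<^sup>2 / x\<^sup>2)" using int J by simp
  define Wt where "Wt = (\<integral>x. x\<^sup>2 * (g x)\<^sup>2 + (g x)\<^sup>2 / x\<^sup>2 \<partial>\<mu>)"
  have "Wt = (\<integral>x. x\<^sup>2 * (g x)\<^sup>2 \<partial>\<mu>) + (\<integral>x. (g x)\<^sup>2 / x\<^sup>2 \<partial>\<mu>)"
    unfolding Wt_def using int J by simp
  also have "\<dots> \<le> (2 * m2 + 4 * E + 2 * (i\<^sup>2 * (2 * m2 + 2 * E) + pointwise_const \<delta> * E * (2 * \<kappa> ^ 3 * exp (\<kappa>\<^sup>2))))
      + (4 * E + 2 * i * (2 * m2 + 2 * E))"
  proof (rule add_mono)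
    show "(\<integral>x. x\<^sup>2 * (g x)\<^sup>2 \<partial>\<mu>) \<le> 2 * m2 + 4 * E + 2 * (i\<^sup>2 * (2 * m2 + 2 * E) + pointwise_const \<delta> * E * (2 * \<kappa> ^ 3 * exp (\<kappa>\<^sup>2)))"
    proof -
      have "1 / \<delta>\<^sup>2 = i\<^sup>2" by (simp add: i_def power_divide)
      then show ?thesis
        using weight_infinity[OF g(1)] weighted_dilated_square[OF g]
        unfolding m2_def E_def by simp
    qed
    have "2 / \<delta> * (\<integral>x. (g (\<delta> * x))\<^sup>2 \<partial>\<mu>) \<le> 2 / \<delta> * (2 * m2 + 2 * E)"
      using mean_dilated_square[OF g(1)] \<delta>_pos unfolding m2_def E_def by (intro mult_left_mono) auto
    then show "(\<integral>x. (g x)\<^sup>2 / x\<^sup>2 \<partial>\<mu>) \<le> 4 * E + 2 * i * (2 * m2 + 2 * E)"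
      using J(2) by (simp add: E_def i_def)
  qed
  also have "\<dots> = (2 + 4 * i\<^sup>2 + 4 * i) * m2 + (8 + 4 * i\<^sup>2 + 4 * i) * E + 4 * pointwise_const \<delta> * \<kappa> ^ 3 * exp (\<kappa>\<^sup>2) * E"
    by (simp add: algebra_simps)
  also have "\<dots> \<le> (10 * i\<^sup>2) * m2 + (16 * i\<^sup>2) * E + 4 * pointwise_const \<delta> * \<kappa> ^ 3 * exp (\<kappa>\<^sup>2) * E"
    using ii nn kpos by (intro add_mono mult_right_mono) (auto simp: pointwise_const_def)
  also have "\<dots> = 10 * i\<^sup>2 * m2 + energy_const \<delta> * E" unfolding energy_const by (simp add: algebra_simps)
  finally have Wt: "Wt \<le> 10 * i\<^sup>2 * m2 + energy_const \<delta> * E" .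
  \<comment> \<open>R is at least 1, and 10 * i squared is at most half of R squared\<close>
  define R where "R = 5 * i"
  have R: "1 \<le> R" using i1 by (simp add: R_def)
  have bulk_const: "bulk_const \<delta> = R * exp (R\<^sup>2 / 2) * (4 * exp (2 * \<kappa> + 12 * \<kappa>\<^sup>2 * R\<^sup>2))"
    by (simp add: bulk_const_def R_def i_def power2_eq_square)
  have KR0: "0 \<le> bulk_const \<delta>" unfolding bulk_const using R by simp
  have A20: "0 \<le> energy_const \<delta>" unfolding energy_const using kpos by (simp add: pointwise_const_def)
  have "m2 \<le> (\<integral>x. bulk_const \<delta> * E + (x\<^sup>2 * (g x)\<^sup>2 + (g x)\<^sup>2 / x\<^sup>2) / R\<^sup>2 \<partial>\<mu>)"
    unfolding m2_def
  proof (rule integral_mono_AE)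
    show "AE x in \<mu>. (g x)\<^sup>2 \<le> bulk_const \<delta> * E + (x\<^sup>2 * (g x)\<^sup>2 + (g x)\<^sup>2 / x\<^sup>2) / R\<^sup>2"
      using AE_positive
    proof eventually_elim
      fix x :: real assume x: "0 < x"
      have KE: "0 \<le> bulk_const \<delta> * E" using KR0 nn by simp
      have p: "0 \<le> x\<^sup>2 * (g x)\<^sup>2 / R\<^sup>2" "0 \<le> (g x)\<^sup>2 / x\<^sup>2 / R\<^sup>2" by auto
      show "(g x)\<^sup>2 \<le> bulk_const \<delta> * E + (x\<^sup>2 * (g x)\<^sup>2 + (g x)\<^sup>2 / x\<^sup>2) / R\<^sup>2"
      proof (cases "R \<le> x")
        case True
        then have "R\<^sup>2 \<le> x\<^sup>2" using R by (intro power_mono) auto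
        then have "R\<^sup>2 * (g x)\<^sup>2 \<le> x\<^sup>2 * (g x)\<^sup>2" by (intro mult_right_mono) auto
        then have "(g x)\<^sup>2 \<le> x\<^sup>2 * (g x)\<^sup>2 / R\<^sup>2" using R by (simp add: pos_le_divide_eq mult.commute)
        then show ?thesis using p KE unfolding add_divide_distrib by linarith
      next
        case xR: False
        show ?thesis
        proof (cases "x \<le> 1 / R")
          case True
          then have "x * R \<le> 1" using R by (simp add: field_simps)
          then have "(x * R)\<^sup>2 \<le> 1" using x R by (intro power_le_one) auto
          then have "(g x)\<^sup>2 * (x * R)\<^sup>2 \<le> (g x)\<^sup>2 * 1" by (intro mult_left_mono) auto
          then have "(g x)\<^sup>2 \<le> (g x)\<^sup>2 / x\<^sup>2 / R\<^sup>2"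
            using x R by (simp add: pos_le_divide_eq power_mult_distrib mult_ac)
          then show ?thesis using p KE unfolding add_divide_distrib by linarith
        next
          case False
          let ?a = "min 1 x" and ?b = "max 1 x"
          have a: "1 / R \<le> ?a" "0 < ?a" and b: "?b \<le> R" "0 < ?b" using False xR R x by auto
          have "(1 / R)\<^sup>2 \<le> ?a\<^sup>2" using a R by (intro power_mono) auto
          then have "12 * \<kappa>\<^sup>2 / ?a\<^sup>2 \<le> 12 * \<kappa>\<^sup>2 / (1 / R)\<^sup>2"
            using a R by (intro divide_left_mono) auto
          then have e1: "12 * \<kappa>\<^sup>2 / ?a\<^sup>2 \<le> 12 * \<kappa>\<^sup>2 * R\<^sup>2" by (simp add: power_divide)
          have e2: "?b\<^sup>2 \<le> R\<^sup>2" using b by (intro power_mono) auto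
          have "(g x - g 1)\<^sup>2 \<le> (?b - ?a) * exp (?b\<^sup>2 / 2) * (4 * exp (2 * \<kappa> + 12 * \<kappa>\<^sup>2 / ?a\<^sup>2)) * energy g"
            by (rule pointwise_bound[OF g(1) x])
          also have "\<dots> \<le> bulk_const \<delta> * energy g"
            unfolding bulk_const using a b e1 e2 R energy_nonneg
            by (intro mult_right_mono mult_mono) auto
          finally show ?thesis using p unfolding g(2) diff_0_right E_def add_divide_distrib by linarith
        qed
      qed
    qed
  qed (use int intW in auto)
  also have "\<dots> = bulk_const \<delta> * E + Wt / R\<^sup>2" using intW by (simp add: Wt_def prob_space)
  also have "Wt / R\<^sup>2 \<le> m2 / 2 + energy_const \<delta> * E"
  proof -
    have "10 * i\<^sup>2 * m2 \<le> R\<^sup>2 * (m2 / 2)" using nn by (simp add: R_def power_mult_distrib)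
    moreover have "1 * (energy_const \<delta> * E) \<le> R\<^sup>2 * (energy_const \<delta> * E)"
      using R A20 nn by (intro mult_right_mono) auto
    ultimately have "Wt \<le> R\<^sup>2 * (m2 / 2 + energy_const \<delta> * E)" using Wt by (simp only: distrib_left)
    then show ?thesis using R by (simp add: pos_divide_le_eq mult.commute)
  qed
  finally have m2: "m2 \<le> Poincare_const \<delta> * E" by (simp add: Poincare_const_def algebra_simps)
  then show "(\<integral>x. (g x)\<^sup>2 \<partial>\<mu>) \<le> Poincare_const \<delta> * energy g" by (simp add: m2_def E_def)
  have "10 * i\<^sup>2 * m2 \<le> 10 * i\<^sup>2 * (Poincare_const \<delta> * E)" using m2 by (intro mult_left_mono) auto
  moreover have "weighted_Poincare_const \<delta> = 10 * i\<^sup>2 * Poincare_const \<delta> + energy_const \<delta>" by (simp add: weighted_Poincare_const_def i_def power2_eq_square)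
  ultimately have "Wt \<le> weighted_Poincare_const \<delta> * E" using Wt by (simp add: algebra_simps)
  then show "(\<integral>x. x\<^sup>2 * (g x)\<^sup>2 + (g x)\<^sup>2 / x\<^sup>2 \<partial>\<mu>) \<le> weighted_Poincare_const \<delta> * energy g" by (simp add: Wt_def E_def)
qed

text \<open>
  The entropy is the infimum, over \<open>s > 0\<close>, of the mean of \<open>g\<^sup>2 * ln (g\<^sup>2 / s) - g\<^sup>2 + s\<close>. Taking
  \<open>s = (g 1)\<^sup>2 + E\<close> with \<open>E\<close> proportional to the energy, the pointwise bound puts the integrand under
  the weighted norm of \<open>g - g 1\<close>. An arbitrarily small \<open>e\<close> is added to the energy to keep \<open>E\<close> positive
  when \<open>g\<close> is constant.
\<close>

lemma log_Sobolev:
  assumes g: "g \<in> smooth_poly"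
  shows "Ent \<mu> g \<le> log_Sobolev_const \<delta> * energy g"
proof (rule field_le_epsilon)
  fix e :: real assume e: "0 < e"
  define \<phi> where "\<phi> x = g x - g 1" for x
  have \<phi>: "\<phi> \<in> smooth_poly" "\<phi> 1 = 0"
    unfolding \<phi>_def by (auto intro: smooth_intros g)
  have "half_deriv \<phi> (hderiv g)"
    using smooth_poly_half_deriv[OF g] unfolding \<phi>_def half_deriv_def
    by (auto intro!: derivative_eq_intros)
  from energy_cong[OF this] have E\<phi>: "energy \<phi> = energy g" unfolding energy_def[of g] .
  have kpos: "0 < \<kappa>" and k2: "1 \<le> \<kappa>\<^sup>2" using kappa_ge_1 by auto
  have pointwise_const: "pointwise_const \<delta> = 4 * exp (2 * \<kappa> + 12 * \<kappa>\<^sup>2)" by (simp add: pointwise_const_def power2_eq_square)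
  \<comment> \<open>three times E enters the final estimate, so adding e / t to the energy costs exactly e\<close>
  define t where "t = 3 * exp 1 * pointwise_const \<delta>"
  have t: "0 < t" by (simp add: t_def pointwise_const)
  define E where "E = exp 1 * pointwise_const \<delta> * (energy g + e / t)"
  have E: "0 < E" unfolding E_def pointwise_const using energy_nonneg[of g] e t by (auto intro!: mult_pos_pos add_nonneg_pos)
  define W where "W x = 12 * \<kappa>\<^sup>2 * (x\<^sup>2 + 1 / x\<^sup>2)" for x :: real
  have le: "(\<phi> x)\<^sup>2 \<le> E * exp (W x)" if x: "0 < x" for x
  proof -
    let ?a = "min 1 x" and ?b = "max 1 x"
    have "(\<phi> x)\<^sup>2 \<le> (?b - ?a) * exp (?b\<^sup>2 / 2) * (4 * exp (2 * \<kappa> + 12 * \<kappa>\<^sup>2 / ?a\<^sup>2)) * energy g"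
      using pointwise_bound[OF g x] by (simp add: \<phi>_def)
    also have "\<dots> \<le> exp (1 / 2 + x\<^sup>2 / 2) * exp (1 / 2 + x\<^sup>2 / 2) * (4 * exp (2 * \<kappa> + 12 * \<kappa>\<^sup>2 + 12 * \<kappa>\<^sup>2 / x\<^sup>2)) * energy g"
    proof (intro mult_right_mono mult_mono energy_nonneg)
      have "?b - ?a \<le> 1 + (1 / 2 + x\<^sup>2 / 2)"
        using x zero_le_power2[of "x - 1"] by (auto simp: max_def min_def power2_diff)
      also have "\<dots> \<le> exp (1 / 2 + x\<^sup>2 / 2)" by (rule exp_ge_add_one_self)
      finally show "?b - ?a \<le> exp (1 / 2 + x\<^sup>2 / 2)" .
      show "exp (?b\<^sup>2 / 2) \<le> exp (1 / 2 + x\<^sup>2 / 2)" by (auto simp: max_def)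
      have "12 * \<kappa>\<^sup>2 / ?a\<^sup>2 \<le> 12 * \<kappa>\<^sup>2 + 12 * \<kappa>\<^sup>2 / x\<^sup>2" by (auto simp: min_def)
      then show "exp (2 * \<kappa> + 12 * \<kappa>\<^sup>2 / ?a\<^sup>2) \<le> exp (2 * \<kappa> + 12 * \<kappa>\<^sup>2 + 12 * \<kappa>\<^sup>2 / x\<^sup>2)" by simp
    qed auto
    also have "\<dots> = exp 1 * pointwise_const \<delta> * (exp (x\<^sup>2 + 12 * \<kappa>\<^sup>2 / x\<^sup>2) * energy g)"
    proof -
      have "exp (1 / 2 + x\<^sup>2 / 2) * exp (1 / 2 + x\<^sup>2 / 2) = exp 1 * exp (x\<^sup>2)"
        by (simp add: exp_add[symmetric])
      moreover have "exp (2 * \<kappa> + 12 * \<kappa>\<^sup>2 + 12 * \<kappa>\<^sup>2 / x\<^sup>2) = exp (2 * \<kappa> + 12 * \<kappa>\<^sup>2) * exp (12 * \<kappa>\<^sup>2 / x\<^sup>2)"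
        by (simp add: exp_add)
      ultimately show ?thesis unfolding pointwise_const by (simp only: exp_add mult_ac)
    qed
    also have "\<dots> \<le> exp 1 * pointwise_const \<delta> * (exp (W x) * (energy g + e / t))"
    proof (intro mult_left_mono mult_mono)
      have "1 * x\<^sup>2 \<le> (12 * \<kappa>\<^sup>2) * x\<^sup>2" using k2 by (intro mult_right_mono) auto
      then show "exp (x\<^sup>2 + 12 * \<kappa>\<^sup>2 / x\<^sup>2) \<le> exp (W x)" by (simp add: W_def distrib_left)
    qed (use e t energy_nonneg in \<open>auto simp: pointwise_const\<close>)
    finally show ?thesis by (simp add: E_def mult_ac)
  qed
  define s where "s = (g 1)\<^sup>2 + E"
  have s: "0 < s" using E by (simp add: s_def add_nonneg_pos)
  define A where "A = (\<integral>x. (g x)\<^sup>2 \<partial>\<mu>)"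
  have A: "0 \<le> A" unfolding A_def by (intro mean_nonneg) auto
  have ig: "integrable \<mu> (\<lambda>x. (g x)\<^sup>2)" by (intro smooth_integrable smooth_intros g)
  have il: "integrable \<mu> (\<lambda>x. (g x)\<^sup>2 * ln ((g x)\<^sup>2))"
  proof (rule Bochner_Integration.integrable_bound)
    show "integrable \<mu> (\<lambda>x. 1 + ((g x)\<^sup>2)\<^sup>2)" by (intro smooth_integrable smooth_intros g)
    show "(\<lambda>x. (g x)\<^sup>2 * ln ((g x)\<^sup>2)) \<in> borel_measurable \<mu>" using smooth_measurable[OF g] by simp
    have bd: "\<bar>z * ln z\<bar> \<le> 1 + z\<^sup>2" if z: "0 \<le> z" for z :: real
    proof (cases "z = 0")
      case False
      with z have z: "0 < z" by simp
      have "z * ln z \<le> z * z" using z ln_le_minus_one[OF z] by (intro mult_left_mono) auto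
      moreover have "z * ln (1 / z) \<le> z * (1 / z)"
        using z ln_le_minus_one[of "1 / z"] by (intro mult_left_mono) auto
      ultimately show ?thesis using z by (simp add: ln_div power2_eq_square abs_le_iff add_increasing add_increasing2)
    qed simp
    have "norm ((g x)\<^sup>2 * ln ((g x)\<^sup>2)) \<le> norm (1 + ((g x)\<^sup>2)\<^sup>2)" for x
      using order_trans[OF bd[of "(g x)\<^sup>2"] abs_ge_self] by simp
    then show "AE x in \<mu>. norm ((g x)\<^sup>2 * ln ((g x)\<^sup>2)) \<le> norm (1 + ((g x)\<^sup>2)\<^sup>2)"
      by (intro AE_I2)
  qed
  have "A * ln s + A - s \<le> A * ln A"
  proof (cases "A = 0")
    case False
    with A have "0 < A" by simp
    then have "A * ln (s / A) \<le> A * (s / A - 1)"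
      using s by (intro mult_left_mono ln_le_minus_one) auto
    then show ?thesis using \<open>0 < A\<close> s by (simp add: ln_div algebra_simps)
  qed (use s in simp)
  then have "Ent \<mu> g \<le> (\<integral>x. (g x)\<^sup>2 * ln ((g x)\<^sup>2) \<partial>\<mu>) - A * ln s - A + s"
    unfolding Ent_def A_def[symmetric] by simp
  also have "\<dots> = (\<integral>x. (g x)\<^sup>2 * ln ((g x)\<^sup>2) - (g x)\<^sup>2 * ln s - (g x)\<^sup>2 + s \<partial>\<mu>)"
    using ig il by (simp add: A_def prob_space)
  also have "\<dots> \<le> (\<integral>x. 23 * (\<phi> x)\<^sup>2 + 3 * E + 48 * \<kappa>\<^sup>2 * (x\<^sup>2 * (\<phi> x)\<^sup>2 + (\<phi> x)\<^sup>2 / x\<^sup>2) \<partial>\<mu>)"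
  proof (rule integral_mono_AE)
    show "AE x in \<mu>. (g x)\<^sup>2 * ln ((g x)\<^sup>2) - (g x)\<^sup>2 * ln s - (g x)\<^sup>2 + s
        \<le> 23 * (\<phi> x)\<^sup>2 + 3 * E + 48 * \<kappa>\<^sup>2 * (x\<^sup>2 * (\<phi> x)\<^sup>2 + (\<phi> x)\<^sup>2 / x\<^sup>2)"
      using AE_positive
    proof eventually_elim
      fix x :: real assume x: "0 < x"
      have "0 \<le> W x" by (simp add: W_def)
      from entropy_density_bound[OF E this le[OF x], of "g 1"]
      have "(g x)\<^sup>2 * ln ((g x)\<^sup>2) - (g x)\<^sup>2 * ln s - (g x)\<^sup>2 + s \<le> 23 * (\<phi> x)\<^sup>2 + 3 * E + 4 * ((\<phi> x)\<^sup>2 * W x)"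
        by (simp add: \<phi>_def s_def)
      then show "(g x)\<^sup>2 * ln ((g x)\<^sup>2) - (g x)\<^sup>2 * ln s - (g x)\<^sup>2 + s
        \<le> 23 * (\<phi> x)\<^sup>2 + 3 * E + 48 * \<kappa>\<^sup>2 * (x\<^sup>2 * (\<phi> x)\<^sup>2 + (\<phi> x)\<^sup>2 / x\<^sup>2)"
        by (simp add: W_def algebra_simps)
    qed
    show "integrable \<mu> (\<lambda>x. 23 * (\<phi> x)\<^sup>2 + 3 * E + 48 * \<kappa>\<^sup>2 * (x\<^sup>2 * (\<phi> x)\<^sup>2 + (\<phi> x)\<^sup>2 / x\<^sup>2))"
    proof -
      have "integrable \<mu> (\<lambda>x. 23 * (\<phi> x)\<^sup>2 + 3 * E)" "integrable \<mu> (\<lambda>x. x\<^sup>2 * (\<phi> x)\<^sup>2)"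
        by (intro smooth_integrable smooth_intros \<phi>)+
      then show ?thesis using Hardy_origin(1)[OF \<phi>(1)] by simp
    qed
  qed (use ig il in simp)
  also have "\<dots> = 23 * (\<integral>x. (\<phi> x)\<^sup>2 \<partial>\<mu>) + 3 * E + 48 * \<kappa>\<^sup>2 * (\<integral>x. x\<^sup>2 * (\<phi> x)\<^sup>2 + (\<phi> x)\<^sup>2 / x\<^sup>2 \<partial>\<mu>)"
  proof -
    have "integrable \<mu> (\<lambda>x. (\<phi> x)\<^sup>2)" "integrable \<mu> (\<lambda>x. x\<^sup>2 * (\<phi> x)\<^sup>2)"
      by (intro smooth_integrable smooth_intros \<phi>)+
    then show ?thesis using Hardy_origin(1)[OF \<phi>(1)] by (simp add: prob_space)
  qed
  also have "\<dots> \<le> 23 * (Poincare_const \<delta> * energy g) + 3 * E + 48 * \<kappa>\<^sup>2 * (weighted_Poincare_const \<delta> * energy g)"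
    using weighted_Poincare[OF \<phi>] unfolding E\<phi> by (intro add_mono mult_left_mono) auto
  also have "3 * E = t * energy g + e"
  proof -
    have "3 * E = t * (energy g + e / t)" by (simp add: E_def t_def)
    then show ?thesis using t by (simp add: distrib_left)
  qed
  finally show "Ent \<mu> g \<le> log_Sobolev_const \<delta> * energy g + e"
    by (simp add: log_Sobolev_const_def t_def algebra_simps power2_eq_square)
qed

lemma variance_le_energy:
  assumes g: "g \<in> smooth_poly"
  shows "(\<integral>x. (g x)\<^sup>2 \<partial>\<mu>) - (\<integral>x. g x \<partial>\<mu>)\<^sup>2 \<le> Poincare_const \<delta> * energy g"
proof -
  define \<phi> where "\<phi> x = g x - g 1" for x
  have \<phi>: "\<phi> \<in> smooth_poly" "\<phi> 1 = 0"
    unfolding \<phi>_def by (auto intro: smooth_intros g)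
  have "half_deriv \<phi> (hderiv g)"
    using smooth_poly_half_deriv[OF g] unfolding \<phi>_def half_deriv_def
    by (auto intro!: derivative_eq_intros)
  from energy_cong[OF this] have E\<phi>: "energy \<phi> = energy g" unfolding energy_def[of g] .
  have i: "integrable \<mu> (\<lambda>x. (g x)\<^sup>2)" "integrable \<mu> g" by (intro smooth_integrable smooth_intros g)+
  have "(\<integral>x. (\<phi> x)\<^sup>2 \<partial>\<mu>) = (\<integral>x. (g x)\<^sup>2 - 2 * g 1 * g x + (g 1)\<^sup>2 \<partial>\<mu>)"
    by (simp add: \<phi>_def power2_diff algebra_simps)
  also have "\<dots> = (\<integral>x. (g x)\<^sup>2 \<partial>\<mu>) - 2 * g 1 * (\<integral>x. g x \<partial>\<mu>) + (g 1)\<^sup>2"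
    using i by (simp add: prob_space)
  finally have "(\<integral>x. (g x)\<^sup>2 \<partial>\<mu>) - (\<integral>x. g x \<partial>\<mu>)\<^sup>2 + ((\<integral>x. g x \<partial>\<mu>) - g 1)\<^sup>2 = (\<integral>x. (\<phi> x)\<^sup>2 \<partial>\<mu>)"
    by (simp add: power2_diff algebra_simps)
  then show ?thesis using weighted_Poincare(1)[OF \<phi>] zero_le_power2[of "(\<integral>x. g x \<partial>\<mu>) - g 1"]
    unfolding E\<phi> by linarith
qed

end

section \<open>Dissipation of the variance and of the energy\<close>

text \<open>
  With \<open>\<theta> = damping \<delta>\<close>, the jumps dissipate \<open>\<theta> * x * v\<^sup>2\<close> and the weight below contributes
  \<open>8 * exp (- 8 * x / \<theta>) * v\<^sup>2\<close>; \<open>variance_weight\<close> is the multiple of the variance that absorbs the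
  remaining error.
\<close>

definition damping :: "real \<Rightarrow> real" where "damping d = (1 - d * d) / 2"
definition variance_weight :: "real \<Rightarrow> real" where "variance_weight d = 512 / (damping d * damping d * damping d)"
definition H1_const :: "real \<Rightarrow> real" where "H1_const d = 2 + variance_weight d * Poincare_const d"
definition decay_rate :: "real \<Rightarrow> real" where "decay_rate d = damping d * damping d / 16 / H1_const d"

context stationary_half_line begin

lemma damping_pos: "0 < damping \<delta>" "damping \<delta> \<le> 1 / 2"
  using q_less_1 \<delta>_pos by (auto simp: damping_def power2_eq_square)

text \<open>
  Increasing, so that the drift dissipates near the origin, but with total oscillation only \<open>\<theta>\<close>, so
  that the contraction of the derivative by \<open>\<delta>\<close> at jumps is not destroyed.
\<close>

definition drift_weight :: "real \<Rightarrow> real" where "drift_weight x = 1 + damping \<delta> * (1 - exp (- (8 / damping \<delta> * x)))"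

lemma drift_weight_bounds:
  assumes "0 \<le> x" shows "1 \<le> drift_weight x" "drift_weight x \<le> 1 + damping \<delta>" "drift_weight x \<le> 2"
proof -
  have "0 \<le> 1 - exp (- (8 / damping \<delta> * x))" "1 - exp (- (8 / damping \<delta> * x)) \<le> 1"
    using assms damping_pos by auto
  then have "0 \<le> damping \<delta> * (1 - exp (- (8 / damping \<delta> * x)))" "damping \<delta> * (1 - exp (- (8 / damping \<delta> * x))) \<le> damping \<delta> * 1"
    using damping_pos by (auto intro: mult_left_mono simp del: mult_1_right)
  then show "1 \<le> drift_weight x" "drift_weight x \<le> 1 + damping \<delta>" "drift_weight x \<le> 2"
    using damping_pos unfolding drift_weight_def by linarith+
qed

lemma drift_weight_smooth: "drift_weight \<in> smooth_poly"
  unfolding drift_weight_def using damping_pos by (intro smooth_intros) auto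

lemma drift_weight_deriv: "half_deriv drift_weight (\<lambda>x. 8 * exp (- (8 / damping \<delta> * x)))"
  unfolding drift_weight_def half_deriv_def using damping_pos by (auto intro!: derivative_eq_intros)

text \<open>
  The carre du champ identity: \<open>2 * u * L u - L (u\<^sup>2)\<close> is minus the rate times the squared jump, and
  \<open>L (u\<^sup>2)\<close> has mean zero.
\<close>

lemma variance_dissipation:
  assumes u: "u \<in> smooth_poly"
  shows "(\<integral>x. 2 * u x * tcp_gen \<delta> u x \<partial>\<mu>) = - (\<integral>x. x * (u x - u (\<delta> * x))\<^sup>2 \<partial>\<mu>)"
proof -
  note sm = smooth_intros u smooth_poly_hderiv[OF u] smooth_dil[OF u]
  have G: "(\<lambda>x. (u x)\<^sup>2) \<in> smooth_poly" by (intro sm)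
  have hd: "half_deriv (\<lambda>x. (u x)\<^sup>2) (\<lambda>x. 2 * u x * hderiv u x)"
    unfolding half_deriv_def using half_derivD[OF smooth_poly_half_deriv[OF u]]
    by (auto intro!: derivative_eq_intros)
  have i: "integrable \<mu> (\<lambda>x. 2 * u x * hderiv u x)" "integrable \<mu> (\<lambda>x. 2 * u x * (x * (u (\<delta> * x) - u x)))"
    "integrable \<mu> (\<lambda>x. x * ((u x)\<^sup>2 - (u (\<delta> * x))\<^sup>2))"
    by (intro smooth_integrable sm)+
  have "(\<integral>x. 2 * u x * tcp_gen \<delta> u x \<partial>\<mu>) = (\<integral>x. 2 * u x * hderiv u x + 2 * u x * (x * (u (\<delta> * x) - u x)) \<partial>\<mu>)"
    by (simp add: tcp_gen_def distrib_left)
  also have "\<dots> = (\<integral>x. x * ((u x)\<^sup>2 - (u (\<delta> * x))\<^sup>2) \<partial>\<mu>) + (\<integral>x. 2 * u x * (x * (u (\<delta> * x) - u x)) \<partial>\<mu>)"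
    using i stationarity(2)[OF G hd] by simp
  also have "\<dots> = (\<integral>x. x * ((u x)\<^sup>2 - (u (\<delta> * x))\<^sup>2) + 2 * u x * (x * (u (\<delta> * x) - u x)) \<partial>\<mu>)"
    using i by simp
  also have "\<dots> = (\<integral>x. - (x * (u x - u (\<delta> * x))\<^sup>2) \<partial>\<mu>)"
    by (intro Bochner_Integration.integral_cong) (auto simp: power2_eq_square algebra_simps)
  finally show ?thesis by simp
qed

text \<open>
  Completing the square in \<open>a\<close> leaves \<open>t - \<theta> - \<delta>\<^sup>2 * t\<^sup>2\<close> as coefficient of \<open>b\<^sup>2\<close>, which is nonnegative for
  \<open>1 \<le> t \<le> 1 + \<theta>\<close> since \<open>\<delta>\<^sup>2 = 1 - 2 * \<theta>\<close>.
\<close>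

lemma jump_quadratic_form:
  fixes a b t :: real
  assumes t: "1 \<le> t" "t \<le> 1 + damping \<delta>" and s: "1 \<le> s"
  shows "damping \<delta> * b\<^sup>2 \<le> s * a\<^sup>2 + t * b\<^sup>2 - 2 * \<delta> * t * a * b"
proof -
  define th where "th = damping \<delta>"
  have q: "\<delta>\<^sup>2 = 1 - 2 * th" by (simp add: th_def damping_def power2_eq_square field_simps)
  define r where "r = t - 1"
  have r: "0 \<le> r" "r \<le> th" using t by (auto simp: r_def th_def)
  have "t - th - \<delta>\<^sup>2 * t\<^sup>2 = (th - r) + r * (4 * th - r) + 2 * th * r\<^sup>2"
    unfolding q r_def by (simp add: power2_eq_square algebra_simps)
  also have "\<dots> \<ge> 0" using r by (intro add_nonneg_nonneg mult_nonneg_nonneg) auto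
  finally have "0 \<le> (t - th - \<delta>\<^sup>2 * t\<^sup>2) * b\<^sup>2" by (rule mult_nonneg_nonneg) simp
  moreover have "0 \<le> (a - \<delta> * t * b)\<^sup>2" by simp
  moreover have "0 \<le> (s - 1) * a\<^sup>2" using s by simp
  ultimately show ?thesis
    unfolding th_def[symmetric] by (simp add: power2_eq_square algebra_simps)
qed

text \<open>
  Along \<open>u\<^sub>t = P\<^sub>t u\<close> the left side is the time derivative of the weighted energy. Subtracting the
  mean-zero term \<open>L (w * v\<^sup>2)\<close>, with \<open>v = u'\<close> and \<open>w = drift_weight\<close>, leaves the dissipation by drift and
  jumps and the error \<open>- 2 * w * v * D\<close>, where \<open>D x = u x - u (\<delta> * x)\<close> comes from differentiating the
  rate. The error is split with \<open>e x = exp (- 8 * x / \<theta>)\<close>. The part carrying \<open>e\<close> lives near the origin,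
  where \<open>e * D\<^sup>2\<close> averages to at most \<open>e * v\<^sup>2\<close> by transport, to be absorbed by the drift term. The part
  carrying \<open>1 - e \<le> 8 * x / \<theta>\<close> has a factor \<open>x\<close>, so it is split between the jump dissipation
  \<open>x * v\<^sup>2\<close> and the variance dissipation \<open>x * D\<^sup>2\<close>.
\<close>

lemma energy_dissipation:
  assumes u: "u \<in> smooth_poly"
  shows "(\<integral>x. 2 * drift_weight x * hderiv u x * hderiv (tcp_gen \<delta> u) x \<partial>\<mu>)
    \<le> - (damping \<delta> * damping \<delta> / 16) * energy u + variance_weight \<delta> * (\<integral>x. x * (u x - u (\<delta> * x))\<^sup>2 \<partial>\<mu>)"
proof -
  define th where "th = damping \<delta>"
  have th: "0 < th" "th \<le> 1 / 2" using damping_pos by (auto simp: th_def)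
  define v where "v = hderiv u"
  define e where "e x = exp (- (8 / th * x))" for x :: real
  define D where "D x = u x - u (\<delta> * x)" for x
  have v: "v \<in> smooth_poly" "half_deriv u v"
    unfolding v_def by (auto intro: smooth_poly_hderiv smooth_poly_half_deriv u)
  have e: "e \<in> smooth_poly" unfolding e_def using th by (intro smooth_intros) auto
  have D: "D \<in> smooth_poly" unfolding D_def by (intro smooth_intros u smooth_dil[OF u])
  note sm = smooth_intros u v(1) smooth_poly_hderiv[OF v(1)] smooth_dil[OF v(1)] smooth_dil[OF u]
    drift_weight_smooth smooth_dil[OF drift_weight_smooth] e D
  have ev: "(\<lambda>x. e x * (v x)\<^sup>2) \<in> smooth_poly" by (intro sm)
  obtain P where P: "P \<in> smooth_poly" "half_deriv P (\<lambda>x. e x * (v x)\<^sup>2)"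
    "(\<integral>x. x * (P x - P (\<delta> * x)) \<partial>\<mu>) = (\<integral>x. e x * (v x)\<^sup>2 \<partial>\<mu>)"
    using mean_square_transport[OF ev] by blast
  have gen': "half_deriv (tcp_gen \<delta> u) (\<lambda>x. hderiv v x - D x + x * (\<delta> * v (\<delta> * x) - v x))"
    unfolding half_deriv_def
  proof (intro allI impI)
    fix x :: real assume x: "0 \<le> x"
    have "(u has_real_derivative v (\<delta> * x)) (at (\<delta> * x) within (*) \<delta> ` {0..})"
      by (rule DERIV_subset[OF half_derivD[OF v(2)]]) (use x \<delta>_pos in auto)
    moreover have "((*) \<delta> has_real_derivative \<delta>) (at x within {0..})"
      by (auto intro!: derivative_eq_intros)
    ultimately have "((\<lambda>x. u (\<delta> * x)) has_real_derivative v (\<delta> * x) * \<delta>) (at x within {0..})"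
      using DERIV_image_chain[of u _ "(*) \<delta>" x "{0..}" \<delta>] by (simp add: o_def)
    then have "((\<lambda>x. v x + x * (u (\<delta> * x) - u x)) has_real_derivative
        hderiv v x + ((v (\<delta> * x) * \<delta> - v x) * x + 1 * (u (\<delta> * x) - u x))) (at x within {0..})"
      using half_derivD[OF smooth_poly_half_deriv[OF v(1)] x] half_derivD[OF v(2) x]
      by (auto intro!: derivative_eq_intros)
    moreover have "tcp_gen \<delta> u = (\<lambda>x. v x + x * (u (\<delta> * x) - u x))"
      by (auto simp: tcp_gen_def v_def)
    ultimately show "(tcp_gen \<delta> u has_real_derivative hderiv v x - D x + x * (\<delta> * v (\<delta> * x) - v x)) (at x within {0..})"
      by (simp add: D_def algebra_simps)
  qed
  let ?G = "\<lambda>x. drift_weight x * (v x)\<^sup>2" and ?G' = "\<lambda>x. 8 * e x * (v x)\<^sup>2 + 2 * drift_weight x * v x * hderiv v x"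
  let ?J = "\<lambda>x. x * (drift_weight x * (v x)\<^sup>2 - drift_weight (\<delta> * x) * (v (\<delta> * x))\<^sup>2)"
  let ?K = "\<lambda>x. - 8 * e x * (v x)\<^sup>2 - 2 * drift_weight x * v x * D x + 2 * x * drift_weight x * v x * (\<delta> * v (\<delta> * x) - v x)"
  have G: "?G \<in> smooth_poly" by (intro sm)
  have hd: "half_deriv ?G ?G'"
    unfolding half_deriv_def
    using half_derivD[OF smooth_poly_half_deriv[OF v(1)]] half_derivD[OF drift_weight_deriv]
    by (auto intro!: derivative_eq_intros simp: e_def th_def)
  have i: "integrable \<mu> ?G'" "integrable \<mu> ?J" "integrable \<mu> ?K"
    by (intro smooth_integrable sm)+
  have iR: "integrable \<mu> (\<lambda>x. e x * (v x)\<^sup>2)" "integrable \<mu> (\<lambda>x. x * (v x)\<^sup>2)"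
    "integrable \<mu> (\<lambda>x. x * (D x)\<^sup>2)" "integrable \<mu> (\<lambda>x. x * (P x - P (\<delta> * x)))" "integrable \<mu> (\<lambda>x. (v x)\<^sup>2)"
    by (intro smooth_integrable sm P(1) smooth_dil[OF P(1)])+
  have "(\<integral>x. 2 * drift_weight x * hderiv u x * hderiv (tcp_gen \<delta> u) x \<partial>\<mu>) = (\<integral>x. ?G' x + ?K x \<partial>\<mu>)"
  proof (rule Bochner_Integration.integral_cong)
    fix x assume "x \<in> space \<mu>"
    then have x: "0 \<le> x" by simp
    show "2 * drift_weight x * hderiv u x * hderiv (tcp_gen \<delta> u) x = ?G' x + ?K x"
      unfolding half_deriv_hderiv[OF gen' x] v_def[symmetric] by (simp add: algebra_simps)
  qed simp
  also have "\<dots> = (\<integral>x. ?J x \<partial>\<mu>) + (\<integral>x. ?K x \<partial>\<mu>)"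
    using stationarity(2)[OF G hd] Bochner_Integration.integral_add[OF i(1) i(3)] by simp
  also have "\<dots> = (\<integral>x. ?J x + ?K x \<partial>\<mu>)"
    using Bochner_Integration.integral_add[OF i(2) i(3)] by simp
  also have "\<dots> \<le> (\<integral>x. 2 * (x * (P x - P (\<delta> * x))) - 6 * (e x * (v x)\<^sup>2) - th / 2 * (x * (v x)\<^sup>2) + variance_weight \<delta> * (x * (D x)\<^sup>2) \<partial>\<mu>)"
  proof (rule mean_mono)
    show "integrable \<mu> (\<lambda>x. ?J x + ?K x)" by (rule Bochner_Integration.integrable_add[OF i(2) i(3)])
    show "integrable \<mu> (\<lambda>x. 2 * (x * (P x - P (\<delta> * x))) - 6 * (e x * (v x)\<^sup>2) - th / 2 * (x * (v x)\<^sup>2) + variance_weight \<delta> * (x * (D x)\<^sup>2))"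
      using iR by (intro Bochner_Integration.integrable_add Bochner_Integration.integrable_diff integrable_mult_right)
    fix x :: real assume x: "0 \<le> x"
    have dx: "0 \<le> \<delta> * x" "\<delta> * x \<le> x" using x \<delta>_pos \<delta>_less by (auto simp: mult_left_le_one_le)
    have e01: "0 \<le> e x" "e x \<le> 1" using x th by (auto simp: e_def)
    define a b w where "a = v (\<delta> * x)" and "b = v x" and "w = drift_weight x"
    have w: "1 \<le> w" "w \<le> 1 + th" "w \<le> 2" using drift_weight_bounds[OF x] by (auto simp: w_def th_def)
    have q1: "th * b\<^sup>2 \<le> drift_weight (\<delta> * x) * a\<^sup>2 + w * b\<^sup>2 - 2 * \<delta> * w * a * b"
      unfolding th_def using w drift_weight_bounds[OF dx(1)] by (intro jump_quadratic_form) (auto simp: th_def)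
    \<comment> \<open>e is decreasing, so it is at least e x on the interval; the right side has the mean of e times v squared\<close>
    have q2: "e x * (D x)\<^sup>2 \<le> x * (P x - P (\<delta> * x))"
    proof -
      have "e x * (D x)\<^sup>2 \<le> (x - \<delta> * x) * (P x - P (\<delta> * x))"
        unfolding D_def
      proof (rule half_deriv_Cauchy_Schwarz[OF v(2) P(2) dx e01(1)])
        fix y assume "\<delta> * x \<le> y" "y \<le> x"
        then have "e x \<le> e y" using th by (auto simp: e_def intro!: divide_right_mono mult_left_mono)
        then show "e x * (v y)\<^sup>2 \<le> e y * (v y)\<^sup>2" by (intro mult_right_mono) auto
      qed
      also have "\<dots> \<le> x * (P x - P (\<delta> * x))"
        using half_deriv_mono[OF P(2) dx] e01 dx by (intro mult_right_mono) (auto simp: e_def)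
      finally show ?thesis .
    qed
    have q3: "- 2 * w * b * D x * e x \<le> 2 * (e x * b\<^sup>2) + 2 * (e x * (D x)\<^sup>2)"
    proof -
      have "- 2 * b * D x \<le> b\<^sup>2 + (D x)\<^sup>2"
        using zero_le_power2[of "b + D x"] by (simp add: power2_eq_square algebra_simps)
      then have "w * (- 2 * b * D x) \<le> w * (b\<^sup>2 + (D x)\<^sup>2)" using w by (intro mult_left_mono) auto
      also have "\<dots> \<le> 2 * (b\<^sup>2 + (D x)\<^sup>2)" using w by (intro mult_right_mono) auto
      finally have "e x * (w * (- 2 * b * D x)) \<le> e x * (2 * (b\<^sup>2 + (D x)\<^sup>2))"
        using e01 by (intro mult_left_mono)
      then show ?thesis by (simp add: algebra_simps)
    qed
    have q4: "- 2 * w * b * D x * (1 - e x) \<le> th / 2 * (x * b\<^sup>2) + variance_weight \<delta> * (x * (D x)\<^sup>2)"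
    proof -
      have "1 - e x \<le> 8 / th * x" using exp_ge_add_one_self[of "- (8 / th * x)"] by (simp add: e_def)
      have "- 2 * w * b * D x * (1 - e x) \<le> \<bar>2 * w * b * D x\<bar> * (1 - e x)"
        using e01 by (intro mult_right_mono) (auto simp: abs_le_iff)
      also have "\<dots> \<le> \<bar>2 * w * b * D x\<bar> * (8 / th * x)"
        using \<open>1 - e x \<le> 8 / th * x\<close> by (intro mult_left_mono) auto
      also have "\<dots> = 2 * w * \<bar>b\<bar> * \<bar>D x\<bar> * (8 / th * x)" using w by (simp add: abs_mult)
      also have "\<dots> \<le> 2 * 2 * \<bar>b\<bar> * \<bar>D x\<bar> * (8 / th * x)"
        using w x th by (intro mult_right_mono mult_left_mono) auto
      also have "\<dots> = x * (32 / th * \<bar>b\<bar> * \<bar>D x\<bar>)" by simp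
      also have "32 / th * \<bar>b\<bar> * \<bar>D x\<bar> \<le> th / 2 * b\<^sup>2 + 512 / (th * th * th) * (D x)\<^sup>2"
      proof -
        have "0 \<le> th / 2 * (\<bar>b\<bar> - 32 / (th * th) * \<bar>D x\<bar>)\<^sup>2" using th by simp
        also have "\<dots> = th / 2 * b\<^sup>2 + 512 / (th * th * th) * (D x)\<^sup>2 - 32 / th * \<bar>b\<bar> * \<bar>D x\<bar>"
        proof -
          have "(\<bar>b\<bar> - 32 / (th * th) * \<bar>D x\<bar>)\<^sup>2 = b\<^sup>2 + (32 / (th * th))\<^sup>2 * (D x)\<^sup>2 - 2 * \<bar>b\<bar> * (32 / (th * th) * \<bar>D x\<bar>)"
            by (simp add: power2_diff power_mult_distrib del: times_divide_eq_left)
          moreover have "th / 2 * ((32 / (th * th))\<^sup>2 * z) = 512 / (th * th * th) * z" for z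
            using th by (simp add: power2_eq_square field_simps)
          moreover have "th / 2 * (2 * y * (32 / (th * th) * z)) = 32 / th * y * z" for y z
            using th by (simp add: field_simps)
          ultimately show ?thesis by (simp only: right_diff_distrib distrib_left)
        qed
        finally show ?thesis by linarith
      qed
      finally show ?thesis using x by (simp add: variance_weight_def th_def distrib_left mult_left_mono mult.left_commute)
    qed
    have "?J x + ?K x = - x * (drift_weight (\<delta> * x) * a\<^sup>2 + w * b\<^sup>2 - 2 * \<delta> * w * a * b) - 8 * (e x * b\<^sup>2)
        + (- 2 * w * b * D x * e x) + (- 2 * w * b * D x * (1 - e x))"
      unfolding a_def b_def w_def by (simp add: power2_eq_square algebra_simps)
    also have "\<dots> \<le> - x * (th * b\<^sup>2) - 8 * (e x * b\<^sup>2) + (2 * (e x * b\<^sup>2) + 2 * (x * (P x - P (\<delta> * x))))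
        + (th / 2 * (x * b\<^sup>2) + variance_weight \<delta> * (x * (D x)\<^sup>2))"
      using mult_left_mono[OF q1 x] q2 q3 q4 by (intro add_mono diff_mono) auto
    also have "\<dots> = 2 * (x * (P x - P (\<delta> * x))) - 6 * (e x * b\<^sup>2) - th / 2 * (x * b\<^sup>2) + variance_weight \<delta> * (x * (D x)\<^sup>2)"
      by (simp add: algebra_simps)
    finally show "?J x + ?K x \<le> 2 * (x * (P x - P (\<delta> * x))) - 6 * (e x * (v x)\<^sup>2) - th / 2 * (x * (v x)\<^sup>2) + variance_weight \<delta> * (x * (D x)\<^sup>2)"
      by (simp add: b_def)
  qed
  also have "\<dots> = - (\<integral>x. 4 * (e x * (v x)\<^sup>2) + th / 2 * (x * (v x)\<^sup>2) \<partial>\<mu>) + variance_weight \<delta> * (\<integral>x. x * (D x)\<^sup>2 \<partial>\<mu>)"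
    using iR by (simp add: P(3))
  also have "\<dots> \<le> - (th * th / 16) * energy u + variance_weight \<delta> * (\<integral>x. x * (D x)\<^sup>2 \<partial>\<mu>)"
  proof -
    have "(\<integral>x. th * th / 16 * (v x)\<^sup>2 \<partial>\<mu>) \<le> (\<integral>x. 4 * (e x * (v x)\<^sup>2) + th / 2 * (x * (v x)\<^sup>2) \<partial>\<mu>)"
    proof (rule mean_mono)
      fix x :: real assume x: "0 \<le> x"
      have c: "th * th / 16 \<le> 4" using th mult_mono[of th 1 th 1] by simp
      have "th * th / 16 \<le> th * th / 16 * (e x + 8 / th * x)"
        using exp_ge_add_one_self[of "- (8 / th * x)"] th by (simp add: e_def)
      also have "\<dots> = th * th / 16 * e x + th / 2 * x" using th by (simp add: field_simps)
      also have "\<dots> \<le> 4 * e x + th / 2 * x" using c by (intro add_right_mono mult_right_mono) (auto simp: e_def)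
      finally have "th * th / 16 * (v x)\<^sup>2 \<le> (4 * e x + th / 2 * x) * (v x)\<^sup>2"
        by (intro mult_right_mono) auto
      then show "th * th / 16 * (v x)\<^sup>2 \<le> 4 * (e x * (v x)\<^sup>2) + th / 2 * (x * (v x)\<^sup>2)"
        by (simp add: algebra_simps)
    qed (use iR in auto)
    then show ?thesis by (simp add: energy_def v_def)
  qed
  finally show ?thesis by (simp add: th_def D_def)
qed

end

section \<open>The process as a random variable\<close>

lemma prob_space_exp_law: "prob_space exp_law"
proof -
  interpret e: prob_space "density lborel (exponential_density 1)"
    by (rule prob_space_exponential_density) simp
  have "AE x in density lborel (exponential_density 1). x \<in> {0..}"
    by (subst AE_density) (auto simp: exponential_density_def)
  then have "e.prob {0..} = 1" by (subst e.prob_eq_1) auto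
  then show ?thesis
    unfolding exp_law_def
    by (intro prob_space_restrict_space) (auto simp: e.emeasure_eq_measure)
qed

lemma prob_space_clocks: "prob_space clocks"
proof -
  interpret product_prob_space "\<lambda>i::nat. exp_law" UNIV
    by (simp add: product_prob_space_def product_prob_space_axioms_def prob_space_exp_law
        product_sigma_finite_def prob_space_imp_sigma_finite)
  show ?thesis unfolding clocks_def by unfold_locales
qed

lemma clocks_nonneg: "\<omega> \<in> space clocks \<Longrightarrow> 0 \<le> \<omega> n"
  by (auto simp: clocks_def space_PiM exp_law_def space_restrict_space PiE_def Pi_def)

lemma measurable_clock: "(\<lambda>\<omega>. \<omega> n) \<in> borel_measurable clocks"
proof -
  have "(\<lambda>\<omega>. \<omega> n) \<in> measurable clocks exp_law"
    unfolding clocks_def by (rule measurable_component_singleton) simp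
  moreover have "(\<lambda>x. x) \<in> borel_measurable exp_law"
    unfolding exp_law_def by (intro measurable_restrict_space1) simp
  ultimately show ?thesis by (rule measurable_compose)
qed

lemma clocks_positive: "AE \<omega> in clocks. 0 < \<omega> n"
proof -
  have "AE x in density lborel (exponential_density 1). x \<noteq> 0"
    using AE_lborel_singleton[of "0::real"] by (simp add: AE_density eventually_mono)
  then have "AE x in density lborel (exponential_density 1). x \<in> {0..} \<longrightarrow> 0 < x"
    by (rule eventually_mono) auto
  then have "AE x in exp_law. 0 < x"
    unfolding exp_law_def by (subst AE_restrict_space_iff) auto
  then show ?thesis
    unfolding clocks_def by (intro AE_PiM_component[where I = UNIV]) (auto simp: prob_space_exp_law)
qed

lemma wait_nonneg: "0 \<le> e \<Longrightarrow> 0 \<le> z \<Longrightarrow> 0 \<le> wait z e"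
  unfolding wait_def using real_le_rsqrt[of z "z\<^sup>2 + 2 * e"] by simp

lemma wait_pos: "0 < e \<Longrightarrow> 0 \<le> z \<Longrightarrow> 0 < wait z e"
  unfolding wait_def using real_less_rsqrt[of z "z\<^sup>2 + 2 * e"] by simp

context
  fixes \<delta> x :: real and \<omega> :: "nat \<Rightarrow> real"
  assumes \<delta>: "0 < \<delta>" "\<delta> < 1" and x: "0 \<le> x" and \<omega>: "\<And>n. 0 \<le> \<omega> n"
begin

lemma post_jump_nonneg: "0 \<le> post_jump \<delta> x \<omega> n"
  by (induction n) (use \<delta> x \<omega> wait_nonneg in auto)

lemma jump_time_Suc_ge: "jump_time \<delta> x \<omega> n \<le> jump_time \<delta> x \<omega> (Suc n)"
  using wait_nonneg[OF \<omega> post_jump_nonneg] by simp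

lemma jump_time_mono: "m \<le> n \<Longrightarrow> jump_time \<delta> x \<omega> m \<le> jump_time \<delta> x \<omega> n"
  using lift_Suc_mono_le[of "jump_time \<delta> x \<omega>", OF jump_time_Suc_ge] .

lemma post_jump_le: "post_jump \<delta> x \<omega> n \<le> x + jump_time \<delta> x \<omega> n"
proof (induction n)
  case (Suc n)
  let ?p = "post_jump \<delta> x \<omega> n + wait (post_jump \<delta> x \<omega> n) (\<omega> n)"
  have "0 \<le> ?p" using post_jump_nonneg wait_nonneg[OF \<omega> post_jump_nonneg] by simp
  then have "\<delta> * ?p \<le> ?p" using \<delta> by (intro mult_left_le_one_le) auto
  then show ?case using Suc by simp
qed simp

text \<open>
  The indices of jumps up to time \<open>t\<close> form an initial segment, whose cardinality is therefore the index
  of the last jump. When there are infinitely many, the cardinality is \<open>0\<close> by convention and the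
  claim reduces to \<open>0 \<le> t\<close>.
\<close>

lemma jump_time_jump_count:
  assumes t: "0 \<le> t" shows "jump_time \<delta> x \<omega> (jump_count \<delta> x \<omega> t) \<le> t"
proof (cases "jump_count \<delta> x \<omega> t")
  case (Suc k)
  define S where "S = {n. jump_time \<delta> x \<omega> (Suc n) \<le> t}"
  have card: "card S = Suc k" using Suc by (simp add: S_def jump_count_def)
  have "k \<in> S"
  proof (rule ccontr)
    assume k: "k \<notin> S"
    have "S \<subseteq> {..<k}"
    proof
      fix n assume "n \<in> S"
      then have "\<not> k \<le> n" using k jump_time_mono[of "Suc k" "Suc n"] by (auto simp: S_def)
      then show "n \<in> {..<k}" by simp
    qed
    then have "card S \<le> k" using card_mono[of "{..<k}" S] by simp
    with card show False by simp
  qed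
  then show ?thesis using Suc by (simp add: S_def)
qed (use t in simp)

lemma tcp_nonneg: "0 \<le> t \<Longrightarrow> 0 \<le> tcp \<delta> x \<omega> t"
  using post_jump_nonneg jump_time_jump_count by (simp add: tcp_def Let_def)

lemma tcp_le: "0 \<le> t \<Longrightarrow> tcp \<delta> x \<omega> t \<le> x + t"
  using post_jump_le[of "jump_count \<delta> x \<omega> t"] by (simp add: tcp_def Let_def)

lemma tcp_time_0:
  assumes "0 < \<omega> 0" shows "tcp \<delta> x \<omega> 0 = x"
proof -
  have "0 < jump_time \<delta> x \<omega> (Suc n)" for n
    using jump_time_mono[of "Suc 0" "Suc n"] wait_pos[OF assms x] by simp
  then have "jump_count \<delta> x \<omega> 0 = 0" by (simp add: jump_count_def not_le[symmetric] del: jump_time.simps)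
  then show ?thesis by (simp add: tcp_def)
qed

end

lemma measurable_tcp:
  assumes X[measurable]: "X \<in> borel_measurable M"
    and W[measurable]: "\<And>n. (\<lambda>p. W p n) \<in> borel_measurable M"
  shows "(\<lambda>p. tcp \<delta> (X p) (W p) t) \<in> borel_measurable M"
proof -
  have pj[measurable]: "(\<lambda>p. post_jump \<delta> (X p) (W p) n) \<in> borel_measurable M" for n
    by (induction n) (simp_all add: wait_def)
  have jt[measurable]: "(\<lambda>p. jump_time \<delta> (X p) (W p) n) \<in> borel_measurable M" for n
    by (induction n) (simp_all add: wait_def)
  have jc: "(\<lambda>p. jump_count \<delta> (X p) (W p) t) \<in> measurable M (count_space UNIV)"
    unfolding jump_count_def by (rule measurable_card) (simp del: jump_time.simps)
  show ?thesis
    unfolding tcp_def Let_def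
    by (rule measurable_compose_countable[OF _ jc]) simp
qed

text \<open>
  Invariance is given on indicators only. Joint measurability in the initial point and the clocks turns
  it into the statement that \<open>\<mu>\<close> is the image of \<open>\<mu> \<Otimes> clocks\<close> under the process at time \<open>t\<close>, and Fubini
  extends it to all integrable functions.
\<close>

lemma invariant_mean:
  assumes \<delta>: "0 < \<delta>" "\<delta> < 1" and inv: "tcp_invariant \<delta> \<mu>" and t: "0 \<le> t"
    and f: "integrable \<mu> f"
  shows "(\<integral>x. tcp_sg \<delta> t f x \<partial>\<mu>) = (\<integral>x. f x \<partial>\<mu>)"
proof -
  have sets: "sets \<mu> = sets half_line" and "prob_space \<mu>"
    and stat: "\<And>B. B \<in> sets \<mu> \<Longrightarrow> measure \<mu> B = (\<integral>x. tcp_sg \<delta> t (indicat_real B) x \<partial>\<mu>)"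
    using inv t by (auto simp: tcp_invariant_def)
  interpret M: prob_space \<mu> by fact
  interpret C: prob_space clocks by (rule prob_space_clocks)
  interpret P: pair_prob_space \<mu> clocks ..
  have space: "space \<mu> = {0..}"
    using sets_eq_imp_space_eq[OF sets] by (simp add: half_line_def space_restrict_space)
  let ?N = "\<mu> \<Otimes>\<^sub>M clocks"
  define T where "T p = tcp \<delta> (fst p) (snd p) t" for p :: "real \<times> (nat \<Rightarrow> real)"
  have id: "(\<lambda>x. x) \<in> borel_measurable \<mu>"
    using measurable_cong_sets[OF sets refl] measurable_restrict_space1[of "\<lambda>x. x" borel borel "{0..}"]
    by (auto simp: half_line_def)
  have "T \<in> borel_measurable ?N"
    unfolding T_def
    by (intro measurable_tcp measurable_compose[OF measurable_fst id]
        measurable_compose[OF measurable_snd measurable_clock])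
  moreover have "0 \<le> T p" if "p \<in> space ?N" for p
    using that t \<delta> space clocks_nonneg by (auto simp: T_def space_pair_measure intro!: tcp_nonneg)
  ultimately have T: "T \<in> measurable ?N \<mu>"
    unfolding measurable_cong_sets[OF refl sets] half_line_def
    by (intro measurable_restrict_space2) auto
  have distr: "distr ?N \<mu> T = \<mu>"
  proof (rule measure_eqI)
    fix B assume "B \<in> sets (distr ?N \<mu> T)"
    then have B: "B \<in> sets \<mu>" by simp
    have "measure (distr ?N \<mu> T) B = (\<integral>x. indicat_real B x \<partial>distr ?N \<mu> T)"
      using B sets.sets_into_space by (simp add: Int_absorb2)
    also have "\<dots> = (\<integral>p. indicat_real B (T p) \<partial>?N)"
      using B by (intro integral_distr[OF T]) simp
    also have "\<dots> = (\<integral>x. (\<integral>\<omega>. indicat_real B (T (x, \<omega>)) \<partial>clocks) \<partial>\<mu>)"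
    proof (rule P.integral_fst'[symmetric])
      show "integrable ?N (\<lambda>p. indicat_real B (T p))"
        using measurable_compose[OF T borel_measurable_indicator[OF B]]
        by (intro P.integrable_const_bound[where B = 1]) auto
    qed
    also have "\<dots> = measure \<mu> B"
      using stat[OF B] by (simp add: T_def tcp_sg_def)
    finally show "emeasure (distr ?N \<mu> T) B = emeasure \<mu> B"
      using P.prob_space_distr[OF T]
      by (simp add: M.emeasure_eq_measure finite_measure.emeasure_eq_measure prob_space.finite_measure)
  qed simp
  have fm: "f \<in> borel_measurable \<mu>" using f by simp
  have iT: "integrable ?N (\<lambda>p. f (T p))"
    using f distr integrable_distr_eq[OF T fm] by simp
  have "(\<integral>x. f x \<partial>\<mu>) = (\<integral>p. f (T p) \<partial>?N)"
    using integral_distr[OF T fm] distr by simp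
  also have "\<dots> = (\<integral>x. (\<integral>\<omega>. f (T (x, \<omega>)) \<partial>clocks) \<partial>\<mu>)"
    by (rule P.integral_fst'[OF iT, symmetric])
  finally show ?thesis by (simp add: T_def tcp_sg_def)
qed

lemma tcp_sg_time_0:
  assumes \<delta>: "0 < \<delta>" "\<delta> < 1" and f: "continuous_on {0..} f" and x: "0 \<le> x"
  shows "tcp_sg \<delta> 0 f x = f x"
proof -
  interpret C: prob_space clocks by (rule prob_space_clocks)
  have "(\<lambda>\<omega>. tcp \<delta> x \<omega> 0) \<in> measurable clocks (restrict_space borel {0..})"
    using \<delta> x clocks_nonneg
    by (intro measurable_restrict_space2 measurable_tcp measurable_clock) (auto intro!: tcp_nonneg)
  then have meas: "(\<lambda>\<omega>. f (tcp \<delta> x \<omega> 0)) \<in> borel_measurable clocks"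
    using borel_measurable_continuous_on_restrict[OF f] by (rule measurable_compose)
  have "tcp_sg \<delta> 0 f x = (\<integral>\<omega>. f x \<partial>clocks)"
    unfolding tcp_sg_def
  proof (rule integral_cong_AE[OF meas])
    show "AE \<omega> in clocks. f (tcp \<delta> x \<omega> 0) = f x"
      using clocks_positive[of 0] AE_space
    proof eventually_elim
      fix \<omega> assume "0 < \<omega> 0" "\<omega> \<in> space clocks"
      then show "f (tcp \<delta> x \<omega> 0) = f x"
        using tcp_time_0[OF \<delta> x, of \<omega>] clocks_nonneg by simp
    qed
  qed simp
  then show ?thesis by (simp add: C.prob_space)
qed

text \<open>
  The process started from \<open>x\<close> stays in \<open>[0, x + t]\<close> up to time \<open>t\<close>, since jumps only move it down.
\<close>

lemma tcp_sg_bound: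
  assumes \<delta>: "0 < \<delta>" "\<delta> < 1" and C: "0 \<le> C" and f: "\<And>y. 0 \<le> y \<Longrightarrow> \<bar>f y\<bar> \<le> C * (1 + y) ^ k"
    and x: "0 \<le> x" and t: "0 \<le> t"
  shows "\<bar>tcp_sg \<delta> t f x\<bar> \<le> C * (1 + x + t) ^ k"
proof -
  interpret C: prob_space clocks by (rule prob_space_clocks)
  have bd: "\<bar>f (tcp \<delta> x \<omega> t)\<bar> \<le> C * (1 + x + t) ^ k" if "\<omega> \<in> space clocks" for \<omega>
  proof -
    have "0 \<le> tcp \<delta> x \<omega> t" "tcp \<delta> x \<omega> t \<le> x + t"
      using \<delta> x t clocks_nonneg[OF that] by (auto intro: tcp_nonneg tcp_le)
    then have "C * (1 + tcp \<delta> x \<omega> t) ^ k \<le> C * (1 + x + t) ^ k"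
      using C by (intro mult_left_mono power_mono) auto
    then show ?thesis using f[OF \<open>0 \<le> tcp \<delta> x \<omega> t\<close>] by simp
  qed
  show ?thesis
  proof (cases "integrable clocks (\<lambda>\<omega>. f (tcp \<delta> x \<omega> t))")
    case True
    have "\<bar>tcp_sg \<delta> t f x\<bar> \<le> (\<integral>\<omega>. \<bar>f (tcp \<delta> x \<omega> t)\<bar> \<partial>clocks)"
      unfolding tcp_sg_def by (rule integral_abs_bound)
    also have "\<dots> \<le> (\<integral>\<omega>. C * (1 + x + t) ^ k \<partial>clocks)"
      using True bd by (intro integral_mono) auto
    finally show ?thesis by (simp add: C.prob_space)
  next
    case False
    then show ?thesis using C x t by (simp add: tcp_sg_def not_integrable_integral_eq)
  qed
qed

section \<open>Exponential decay of the energy along the semigroup\<close>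

text \<open>
  Polynomial bounds in \<open>x\<close> that are locally uniform in time: the domination needed to differentiate
  means with respect to time.
\<close>

definition locally_poly :: "(real \<Rightarrow> real \<Rightarrow> real) \<Rightarrow> bool" where
  "locally_poly F \<longleftrightarrow> (\<forall>T\<ge>0. \<exists>g. poly_bounded g \<and> (\<forall>t\<ge>0. t \<le> T \<longrightarrow> (\<forall>x\<ge>0. \<bar>F t x\<bar> \<le> g x)))"

lemma locally_poly_const: "poly_bounded f \<Longrightarrow> locally_poly (\<lambda>t. f)"
  unfolding locally_poly_def
  by (intro allI impI exI[of _ "\<lambda>x. \<bar>f x\<bar>"]) (simp add: poly_bounded_def)

lemma locally_poly_add:
  assumes "locally_poly F" "locally_poly G" shows "locally_poly (\<lambda>t x. F t x + G t x)"
  unfolding locally_poly_def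
proof (intro allI impI)
  fix T :: real assume T: "0 \<le> T"
  obtain f where f: "poly_bounded f" "\<forall>t\<ge>0. t \<le> T \<longrightarrow> (\<forall>x\<ge>0. \<bar>F t x\<bar> \<le> f x)"
    using assms(1) T unfolding locally_poly_def by blast
  obtain g where g: "poly_bounded g" "\<forall>t\<ge>0. t \<le> T \<longrightarrow> (\<forall>x\<ge>0. \<bar>G t x\<bar> \<le> g x)"
    using assms(2) T unfolding locally_poly_def by blast
  show "\<exists>h. poly_bounded h \<and> (\<forall>t\<ge>0. t \<le> T \<longrightarrow> (\<forall>x\<ge>0. \<bar>F t x + G t x\<bar> \<le> h x))"
    using f(2) g(2)
    by (intro exI[of _ "\<lambda>x. f x + g x"] conjI poly_bounded_add f(1) g(1))
      (auto intro!: order_trans[OF abs_triangle_ineq add_mono])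
qed

lemma locally_poly_mult:
  assumes "locally_poly F" "locally_poly G" shows "locally_poly (\<lambda>t x. F t x * G t x)"
  unfolding locally_poly_def
proof (intro allI impI)
  fix T :: real assume T: "0 \<le> T"
  obtain f where f: "poly_bounded f" "\<forall>t\<ge>0. t \<le> T \<longrightarrow> (\<forall>x\<ge>0. \<bar>F t x\<bar> \<le> f x)"
    using assms(1) T unfolding locally_poly_def by blast
  obtain g where g: "poly_bounded g" "\<forall>t\<ge>0. t \<le> T \<longrightarrow> (\<forall>x\<ge>0. \<bar>G t x\<bar> \<le> g x)"
    using assms(2) T unfolding locally_poly_def by blast
  show "\<exists>h. poly_bounded h \<and> (\<forall>t\<ge>0. t \<le> T \<longrightarrow> (\<forall>x\<ge>0. \<bar>F t x * G t x\<bar> \<le> h x))"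
    using f(2) g(2)
    by (intro exI[of _ "\<lambda>x. f x * g x"] conjI poly_bounded_mult f(1) g(1))
      (auto simp: abs_mult intro!: mult_mono order_trans[OF abs_ge_zero])
qed

lemma locally_poly_tcp_sg:
  assumes \<delta>: "0 < \<delta>" "\<delta> < 1" and f: "poly_bounded f" and c: "0 \<le> c"
  shows "locally_poly (\<lambda>t x. tcp_sg \<delta> t f (c * x))"
  unfolding locally_poly_def
proof (intro allI impI)
  fix T :: real assume T: "0 \<le> T"
  obtain C k where C: "0 \<le> C" "\<forall>x\<ge>0. \<bar>f x\<bar> \<le> C * (1 + x) ^ k" using poly_boundedE[OF f] by blast
  let ?g = "\<lambda>x. C * ((1 + T + c) * (1 + x)) ^ k"
  have "poly_bounded ?g"
    by (rule poly_boundedI[where C = "C * (1 + T + c) ^ k" and k = k])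
      (use C T c in \<open>simp add: power_mult_distrib abs_mult\<close>)
  moreover have "\<bar>tcp_sg \<delta> t f (c * x)\<bar> \<le> ?g x" if t: "0 \<le> t" "t \<le> T" and x: "0 \<le> x" for t x
  proof -
    have "\<bar>tcp_sg \<delta> t f (c * x)\<bar> \<le> C * (1 + c * x + t) ^ k"
      using tcp_sg_bound[OF \<delta> C(1) _ _ t(1)] C(2) c x by simp
    also have "\<dots> \<le> ?g x"
    proof (intro mult_left_mono power_mono C(1))
      have "0 \<le> x + T * x" "0 \<le> c" using x T c by auto
      then show "1 + c * x + t \<le> (1 + T + c) * (1 + x)" using t by (simp add: algebra_simps)
    qed (use c x t in auto)
    finally show ?thesis .
  qed
  ultimately show "\<exists>g. poly_bounded g \<and> (\<forall>t\<ge>0. t \<le> T \<longrightarrow> (\<forall>x\<ge>0. \<bar>tcp_sg \<delta> t f (c * x)\<bar> \<le> g x))"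
    by blast
qed

lemma (in half_line_measure) half_deriv_mean:
  assumes int: "\<And>t. 0 \<le> t \<Longrightarrow> integrable \<mu> (F t)"
    and meas: "\<And>t. 0 \<le> t \<Longrightarrow> F' t \<in> borel_measurable \<mu>"
    and der: "\<And>x. 0 \<le> x \<Longrightarrow> half_deriv (\<lambda>t. F t x) (\<lambda>t. F' t x)"
    and lp: "locally_poly F'"
  shows "half_deriv (\<lambda>t. \<integral>x. F t x \<partial>\<mu>) (\<lambda>t. \<integral>x. F' t x \<partial>\<mu>)"
  unfolding half_deriv_def has_field_derivative_iff tendsto_at_iff_sequentially
proof (intro allI impI)
  fix t :: real and X :: "nat \<Rightarrow> real"
  assume t: "0 \<le> t" and X: "\<forall>i. X i \<in> {0..} - {t}" and lim: "X \<longlonglongrightarrow> t"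
  have X0: "0 \<le> X i" "X i \<noteq> t" for i using X by auto
  obtain K where K: "\<And>i. \<bar>X i\<bar> \<le> K"
    using convergent_imp_Bseq[OF convergentI[OF lim]] by (auto simp: Bseq_def)
  define T where "T = max t K"
  have T: "0 \<le> T" "t \<le> T" "X i \<le> T" for i using t K[of i] by (auto simp: T_def)
  obtain g where g: "poly_bounded g" "\<forall>s\<ge>0. s \<le> T \<longrightarrow> (\<forall>x\<ge>0. \<bar>F' s x\<bar> \<le> g x)"
    using lp T(1) unfolding locally_poly_def by blast
  obtain C k where C: "0 \<le> C" "\<forall>x\<ge>0. \<bar>g x\<bar> \<le> C * (1 + x) ^ k" using poly_boundedE[OF g(1)] by blast
  let ?q = "\<lambda>i x. (F (X i) x - F t x) / (X i - t)"
  have "(\<lambda>i. \<integral>x. ?q i x \<partial>\<mu>) \<longlonglongrightarrow> (\<integral>x. F' t x \<partial>\<mu>)"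
  proof (rule integral_dominated_convergence[where w = "\<lambda>x. C * (1 + x) ^ k"])
    show "F' t \<in> borel_measurable \<mu>" by (rule meas[OF t])
    show "?q i \<in> borel_measurable \<mu>" for i using int[OF t] int[OF X0(1)] by simp
    show "integrable \<mu> (\<lambda>x. C * (1 + x) ^ k)" by (intro smooth_integrable smooth_intros)
    show "AE x in \<mu>. (\<lambda>i. ?q i x) \<longlonglongrightarrow> F' t x"
    proof (rule AE_I2)
      fix x assume "x \<in> space \<mu>"
      then have "((\<lambda>s. (F s x - F t x) / (s - t)) \<longlongrightarrow> F' t x) (at t within {0..})"
        using half_derivD[OF der t] by (simp add: has_field_derivative_iff)
      then show "(\<lambda>i. ?q i x) \<longlonglongrightarrow> F' t x"
        using X lim unfolding tendsto_at_iff_sequentially by (auto simp: o_def)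
    qed
    show "AE x in \<mu>. norm (?q i x) \<le> C * (1 + x) ^ k" for i
    proof (rule AE_I2)
      fix x assume "x \<in> space \<mu>"
      then have x: "0 \<le> x" by simp
      have "norm (F (X i) x - F t x) \<le> C * (1 + x) ^ k * norm (X i - t)"
      proof (rule field_differentiable_bound[where S = "{0..T}" and f' = "\<lambda>s. F' s x"])
        fix s assume s: "s \<in> {0..T}"
        show "((\<lambda>s. F s x) has_real_derivative F' s x) (at s within {0..T})"
          by (rule DERIV_subset[OF half_derivD[OF der[OF x]]]) (use s in auto)
        show "norm (F' s x) \<le> C * (1 + x) ^ k"
          using g(2) C(2) s x order_trans[of "\<bar>F' s x\<bar>" "g x"] abs_ge_self[of "g x"] by fastforce
      qed (use T X0 t in auto)
      then show "norm (?q i x) \<le> C * (1 + x) ^ k"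
        using X0(2)[of i] by (simp add: pos_divide_le_eq)
    qed
  qed
  moreover have "(\<integral>x. ?q i x \<partial>\<mu>) = ((\<integral>x. F (X i) x \<partial>\<mu>) - (\<integral>x. F t x \<partial>\<mu>)) / (X i - t)" for i
    using int[OF t] int[OF X0(1)] by simp
  ultimately show "((\<lambda>s. ((\<integral>x. F s x \<partial>\<mu>) - (\<integral>x. F t x \<partial>\<mu>)) / (s - t)) \<circ> X) \<longlonglongrightarrow> (\<integral>x. F' t x \<partial>\<mu>)"
    by (simp only: o_def)
qed

lemma regular_semigroup:
  assumes "tcp_regular \<delta>" "f \<in> smooth_poly"
  shows "tcp_gen \<delta> f \<in> smooth_poly"
    and "0 \<le> t \<Longrightarrow> tcp_sg \<delta> t f \<in> smooth_poly"
    and "0 \<le> t \<Longrightarrow> 0 \<le> x \<Longrightarrow> tcp_gen \<delta> (tcp_sg \<delta> t f) x = tcp_sg \<delta> t (tcp_gen \<delta> f) x"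
    and "0 \<le> x \<Longrightarrow> half_deriv (\<lambda>t. tcp_sg \<delta> t f x) (\<lambda>t. tcp_sg \<delta> t (tcp_gen \<delta> f) x)"
proof -
  note R = assms(1)[unfolded tcp_regular_def, rule_format, OF assms(2)]
  show "tcp_gen \<delta> f \<in> smooth_poly" using R by blast
  show "tcp_sg \<delta> t f \<in> smooth_poly" if "0 \<le> t" using R that by blast
  show eq: "tcp_gen \<delta> (tcp_sg \<delta> t f) x = tcp_sg \<delta> t (tcp_gen \<delta> f) x" if "0 \<le> t" "0 \<le> x" for t x
    using R that by blast
  have "((\<lambda>s. tcp_sg \<delta> s f x) has_real_derivative tcp_gen \<delta> (tcp_sg \<delta> t f) x) (at t within {0..})"
    if "0 \<le> t" "0 \<le> x" for t x
    using R that by blast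
  then show "half_deriv (\<lambda>t. tcp_sg \<delta> t f x) (\<lambda>t. tcp_sg \<delta> t (tcp_gen \<delta> f) x)" if "0 \<le> x"
    unfolding half_deriv_def using that eq by simp
qed

text \<open>
  Since \<open>L P\<^sub>t f = P\<^sub>t L f\<close>, the space derivative of \<open>P\<^sub>t f\<close> is a combination of values of the semigroup,
  whose time derivatives are known pointwise.
\<close>

lemma hderiv_tcp_sg:
  assumes "tcp_regular \<delta>" "f \<in> smooth_poly" "0 \<le> t" "0 \<le> x"
  shows "hderiv (tcp_sg \<delta> t f) x
    = tcp_sg \<delta> t (tcp_gen \<delta> f) x - x * (tcp_sg \<delta> t f (\<delta> * x) - tcp_sg \<delta> t f x)"
  using regular_semigroup(3)[OF assms(1,2,3,4)] by (simp add: tcp_gen_def)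

text \<open>
  The mean of \<open>P\<^sub>t G\<close> does not depend on \<open>t\<close>, and its time derivative is the mean of \<open>P\<^sub>t (L G)\<close>, which is
  the mean of \<open>L G\<close>.
\<close>

lemma invariant_stationary:
  assumes \<delta>: "0 < \<delta>" "\<delta> < 1" and reg: "tcp_regular \<delta>" and inv: "tcp_invariant \<delta> \<mu>"
    and mom: "finite_moments \<mu>"
  shows "stationary_half_line \<mu> \<delta>"
proof -
  interpret half_line_measure \<mu>
    using inv mom by (auto simp: half_line_measure_def half_line_measure_axioms_def tcp_invariant_def)
  have "(\<integral>x. tcp_gen \<delta> G x \<partial>\<mu>) = 0" if G: "G \<in> smooth_poly" for G
  proof -
    note R = regular_semigroup[OF reg G]
    note R' = regular_semigroup[OF reg R(1)]
    have mean: "(\<integral>x. tcp_sg \<delta> t f x \<partial>\<mu>) = (\<integral>x. f x \<partial>\<mu>)" if "0 \<le> t" "f \<in> smooth_poly" for t f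
      using invariant_mean[OF \<delta> inv that(1) smooth_integrable[OF that(2)]] .
    have "half_deriv (\<lambda>t. \<integral>x. tcp_sg \<delta> t G x \<partial>\<mu>) (\<lambda>t. \<integral>x. tcp_sg \<delta> t (tcp_gen \<delta> G) x \<partial>\<mu>)"
      using locally_poly_tcp_sg[OF \<delta> smooth_poly_bounded[OF R(1)], of 1]
      by (intro half_deriv_mean smooth_integrable smooth_measurable R R') auto
    then have 1: "half_deriv (\<lambda>t. \<integral>x. G x \<partial>\<mu>) (\<lambda>t. \<integral>x. tcp_gen \<delta> G x \<partial>\<mu>)"
      by (rule half_deriv_cong) (auto simp: mean G R(1))
    have 2: "half_deriv (\<lambda>t. \<integral>x. G x \<partial>\<mu>) (\<lambda>t. 0)" by (simp add: half_deriv_def)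
    show ?thesis using half_deriv_hderiv[OF 1 order_refl] half_deriv_hderiv[OF 2 order_refl] by simp
  qed
  then show ?thesis
    using \<delta> by unfold_locales auto
qed

lemma constants_pos:
  assumes "0 < d" "d < 1"
  shows "0 < Poincare_const d" "0 < log_Sobolev_const d" "0 < variance_weight d" "0 < H1_const d" "0 < decay_rate d"
proof -
  have k: "0 < kappa d" using assms by (simp add: kappa_def)
  have th: "0 < damping d" using assms mult_strict_mono[of d 1 d 1] by (simp add: damping_def)
  have "0 < pointwise_const d" "0 < bulk_const d" using assms by (auto simp: pointwise_const_def bulk_const_def)
  moreover from this have energy_const: "0 < energy_const d" using assms k unfolding energy_const_def by (intro add_pos_pos mult_pos_pos divide_pos_pos) auto
  ultimately show Poincare_const: "0 < Poincare_const d" by (simp add: Poincare_const_def)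
  have "0 < weighted_Poincare_const d" using Poincare_const energy_const assms unfolding weighted_Poincare_const_def by (intro add_pos_pos mult_pos_pos divide_pos_pos) auto
  with Poincare_const \<open>0 < pointwise_const d\<close> k show "0 < log_Sobolev_const d"
    unfolding log_Sobolev_const_def by (intro add_pos_pos mult_pos_pos) auto
  show variance_weight: "0 < variance_weight d" using th by (simp add: variance_weight_def)
  show H1_const: "0 < H1_const d" using variance_weight Poincare_const by (simp add: H1_const_def add_pos_pos)
  show "0 < decay_rate d" using H1_const th by (simp add: decay_rate_def)
qed

text \<open>
  The functional \<open>H t\<close> is the weighted energy of \<open>P\<^sub>t f\<close> plus \<open>variance_weight\<close> times its variance. Its
  derivative is at most a negative multiple of the energy, because the variance dissipation cancels the
  last term of \<open>energy_dissipation\<close>, and by the Poincare inequality \<open>H\<close> lies between the energy and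
  \<open>H1_const\<close> times the energy. Gronwall's argument concludes.
\<close>

lemma (in stationary_half_line) energy_decay:
  assumes reg: "tcp_regular \<delta>" and inv: "tcp_invariant \<delta> \<mu>" and f: "f \<in> smooth_poly" and t: "0 \<le> t"
  shows "energy (tcp_sg \<delta> t f) \<le> H1_const \<delta> * exp (- decay_rate \<delta> * t) * energy f"
proof -
  define U where "U t = tcp_sg \<delta> t f" for t
  define L where "L t = tcp_sg \<delta> t (tcp_gen \<delta> f)" for t
  note R = regular_semigroup[OF reg f]
  note R' = regular_semigroup[OF reg R(1)]
  note pos = constants_pos[OF \<delta>_pos \<delta>_less]
  have U: "U t \<in> smooth_poly" and L: "L t \<in> smooth_poly" if "0 \<le> t" for t
    using R(2) R'(2) that by (auto simp: U_def L_def)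
  have gen: "tcp_gen \<delta> (U t) x = L t x" if "0 \<le> t" "0 \<le> x" for t x
    using R(3) that by (simp add: U_def L_def)
  have hgen: "hderiv (tcp_gen \<delta> (U t)) x = hderiv (L t) x" if "0 \<le> t" "0 \<le> x" for t x
    using half_deriv_cong[OF smooth_poly_half_deriv[OF L[OF that(1)]], of "tcp_gen \<delta> (U t)" "hderiv (L t)"]
      gen that half_deriv_hderiv by metis
  have dU: "half_deriv (\<lambda>t. U t x) (\<lambda>t. L t x)" if "0 \<le> x" for x
    using R(4)[OF that] by (simp add: U_def L_def)
  have dV: "half_deriv (\<lambda>t. hderiv (U t) x) (\<lambda>t. hderiv (L t) x)" if x: "0 \<le> x" for x
  proof -
    have "half_deriv (\<lambda>t. L t x - x * (U t (\<delta> * x) - U t x))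
       (\<lambda>t. tcp_sg \<delta> t (tcp_gen \<delta> (tcp_gen \<delta> f)) x - x * (L t (\<delta> * x) - L t x))"
      using R'(4)[OF x] dU[OF x] dU[of "\<delta> * x"] x \<delta>_pos
      unfolding half_deriv_def L_def by (auto intro!: derivative_eq_intros)
    then show ?thesis
      by (rule half_deriv_cong) (use x in \<open>auto simp: U_def L_def hderiv_tcp_sg[OF reg] f R(1)\<close>)
  qed
  have lpU: "locally_poly (\<lambda>t x. U t (c * x))" and lpL: "locally_poly (\<lambda>t x. L t (c * x))"
    and lpLL: "locally_poly (\<lambda>t x. tcp_sg \<delta> t (tcp_gen \<delta> (tcp_gen \<delta> f)) (c * x))" if "0 \<le> c" for c
    unfolding U_def L_def using that
    by (intro locally_poly_tcp_sg \<delta>_pos \<delta>_less smooth_poly_bounded f R(1) R'(1); simp)+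
  have sm_const: "locally_poly (\<lambda>t. h)" if "h \<in> smooth_poly" for h
    using that by (intro locally_poly_const smooth_poly_bounded)
  have lpV: "locally_poly (\<lambda>t. hderiv (U t))" and lpV': "locally_poly (\<lambda>t. hderiv (L t))"
  proof -
    have cong: "locally_poly G \<Longrightarrow> (\<And>t x. 0 \<le> t \<Longrightarrow> 0 \<le> x \<Longrightarrow> F t x = G t x) \<Longrightarrow> locally_poly F" for F G
      unfolding locally_poly_def by metis
    have "locally_poly (\<lambda>t x. L t (1 * x) + (- x) * (U t (\<delta> * x) + (-1) * U t (1 * x)))"
      using \<delta>_pos by (intro locally_poly_add locally_poly_mult lpU lpL sm_const smooth_intros) auto
    then show "locally_poly (\<lambda>t. hderiv (U t))"
      by (rule cong) (simp add: U_def L_def hderiv_tcp_sg[OF reg f])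
    have "locally_poly (\<lambda>t x. tcp_sg \<delta> t (tcp_gen \<delta> (tcp_gen \<delta> f)) (1 * x) + (- x) * (L t (\<delta> * x) + (-1) * L t (1 * x)))"
      using \<delta>_pos by (intro locally_poly_add locally_poly_mult lpL lpLL sm_const smooth_intros) auto
    then show "locally_poly (\<lambda>t. hderiv (L t))"
      by (rule cong) (simp add: L_def hderiv_tcp_sg[OF reg R(1)])
  qed
  note sm = smooth_intros U L smooth_poly_hderiv drift_weight_smooth
  have dF: "half_deriv (\<lambda>t. \<integral>x. drift_weight x * (hderiv (U t) x)\<^sup>2 \<partial>\<mu>) (\<lambda>t. \<integral>x. 2 * drift_weight x * hderiv (U t) x * hderiv (L t) x \<partial>\<mu>)"
  proof (rule half_deriv_mean)
    show "half_deriv (\<lambda>t. drift_weight x * (hderiv (U t) x)\<^sup>2) (\<lambda>t. 2 * drift_weight x * hderiv (U t) x * hderiv (L t) x)" if "0 \<le> x" for x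
      using dV[OF that] unfolding half_deriv_def by (auto intro!: derivative_eq_intros)
    show "locally_poly (\<lambda>t x. 2 * drift_weight x * hderiv (U t) x * hderiv (L t) x)"
      by (intro locally_poly_mult lpV lpV' sm_const smooth_intros drift_weight_smooth)
  qed (intro smooth_integrable smooth_measurable sm; assumption)+
  have dS: "half_deriv (\<lambda>t. \<integral>x. (U t x)\<^sup>2 \<partial>\<mu>) (\<lambda>t. \<integral>x. 2 * U t x * L t x \<partial>\<mu>)"
  proof (rule half_deriv_mean)
    show "half_deriv (\<lambda>t. (U t x)\<^sup>2) (\<lambda>t. 2 * U t x * L t x)" if "0 \<le> x" for x
      using dU[OF that] unfolding half_deriv_def by (auto intro!: derivative_eq_intros)
    have "locally_poly (\<lambda>t x. 2 * U t (1 * x) * L t (1 * x))"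
      by (intro locally_poly_mult lpU lpL sm_const smooth_intros) auto
    then show "locally_poly (\<lambda>t x. 2 * U t x * L t x)" by simp
  qed (intro smooth_integrable smooth_measurable sm; assumption)+
  define c where "c = (\<integral>x. f x \<partial>\<mu>)"
  have mean: "(\<integral>x. U t x \<partial>\<mu>) = c" if "0 \<le> t" for t
    unfolding U_def c_def using invariant_mean[OF \<delta>_pos \<delta>_less inv that smooth_integrable[OF f]] .
  define H where "H t = (\<integral>x. drift_weight x * (hderiv (U t) x)\<^sup>2 \<partial>\<mu>) + variance_weight \<delta> * ((\<integral>x. (U t x)\<^sup>2 \<partial>\<mu>) - c\<^sup>2)" for t
  define H' where "H' t = (\<integral>x. 2 * drift_weight x * hderiv (U t) x * hderiv (L t) x \<partial>\<mu>) + variance_weight \<delta> * (\<integral>x. 2 * U t x * L t x \<partial>\<mu>)" for t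
  have dH: "half_deriv H H'"
    using dF dS unfolding half_deriv_def H_def H'_def by (auto intro!: derivative_eq_intros)
  have H'_le: "H' t \<le> - (damping \<delta> * damping \<delta> / 16) * energy (U t)" if t: "0 \<le> t" for t
  proof -
    have "(\<integral>x. 2 * drift_weight x * hderiv (U t) x * hderiv (L t) x \<partial>\<mu>) = (\<integral>x. 2 * drift_weight x * hderiv (U t) x * hderiv (tcp_gen \<delta> (U t)) x \<partial>\<mu>)"
      using hgen[OF t] by (intro Bochner_Integration.integral_cong) auto
    moreover have "(\<integral>x. 2 * U t x * L t x \<partial>\<mu>) = (\<integral>x. 2 * U t x * tcp_gen \<delta> (U t) x \<partial>\<mu>)"
      using gen[OF t] by (intro Bochner_Integration.integral_cong) auto
    ultimately show ?thesis
      unfolding H'_def using energy_dissipation[OF U[OF t]] variance_dissipation[OF U[OF t]] by simp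
  qed
  have H_le: "H t \<le> H1_const \<delta> * energy (U t)" and H_ge: "energy (U t) \<le> H t" if t: "0 \<le> t" for t
  proof -
    have i: "integrable \<mu> (\<lambda>x. drift_weight x * (hderiv (U t) x)\<^sup>2)" "integrable \<mu> (\<lambda>x. (hderiv (U t) x)\<^sup>2)"
      "integrable \<mu> (\<lambda>x. (U t x)\<^sup>2)" "integrable \<mu> (U t)"
      using t by (intro smooth_integrable sm; assumption)+
    have "(\<integral>x. drift_weight x * (hderiv (U t) x)\<^sup>2 \<partial>\<mu>) \<le> (\<integral>x. 2 * (hderiv (U t) x)\<^sup>2 \<partial>\<mu>)"
      using i drift_weight_bounds by (intro mean_mono mult_right_mono) auto
    then have 1: "(\<integral>x. drift_weight x * (hderiv (U t) x)\<^sup>2 \<partial>\<mu>) \<le> 2 * energy (U t)" by (simp add: energy_def)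
    have "(\<integral>x. 1 * (hderiv (U t) x)\<^sup>2 \<partial>\<mu>) \<le> (\<integral>x. drift_weight x * (hderiv (U t) x)\<^sup>2 \<partial>\<mu>)"
      using i drift_weight_bounds by (intro mean_mono mult_right_mono) auto
    then have 2: "energy (U t) \<le> (\<integral>x. drift_weight x * (hderiv (U t) x)\<^sup>2 \<partial>\<mu>)" by (simp add: energy_def)
    have "variance_weight \<delta> * ((\<integral>x. (U t x)\<^sup>2 \<partial>\<mu>) - c\<^sup>2) \<le> variance_weight \<delta> * (Poincare_const \<delta> * energy (U t))"
      using variance_le_energy[OF U[OF t]] mean[OF t] pos by (intro mult_left_mono) auto
    with 1 show "H t \<le> H1_const \<delta> * energy (U t)" by (simp add: H_def H1_const_def algebra_simps)
    have "0 \<le> (\<integral>x. (U t x - c)\<^sup>2 \<partial>\<mu>)" by (intro mean_nonneg) auto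
    also have "\<dots> = (\<integral>x. (U t x)\<^sup>2 - 2 * c * U t x + c\<^sup>2 \<partial>\<mu>)" by (simp add: power2_diff algebra_simps)
    also have "\<dots> = (\<integral>x. (U t x)\<^sup>2 \<partial>\<mu>) - c\<^sup>2"
      using i mean[OF t] by (simp add: prob_space power2_eq_square)
    finally have "0 \<le> variance_weight \<delta> * ((\<integral>x. (U t x)\<^sup>2 \<partial>\<mu>) - c\<^sup>2)" using pos by (intro mult_nonneg_nonneg) auto
    with 2 show "energy (U t) \<le> H t" by (simp add: H_def)
  qed
  have "- (exp (decay_rate \<delta> * 0) * H 0) \<le> - (exp (decay_rate \<delta> * t) * H t)"
  proof (rule half_deriv_mono[where f = "\<lambda>t. - (exp (decay_rate \<delta> * t) * H t)"
      and f' = "\<lambda>t. exp (decay_rate \<delta> * t) * (- (decay_rate \<delta> * H t + H' t))"])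
    show "half_deriv (\<lambda>t. - (exp (decay_rate \<delta> * t) * H t)) (\<lambda>t. exp (decay_rate \<delta> * t) * (- (decay_rate \<delta> * H t + H' t)))"
      using dH unfolding half_deriv_def by (auto intro!: derivative_eq_intros simp: algebra_simps)
    fix s :: real assume s: "0 \<le> s"
    have "decay_rate \<delta> * H s \<le> decay_rate \<delta> * (H1_const \<delta> * energy (U s))"
      using pos H_le[OF s] by (intro mult_left_mono) auto
    also have "\<dots> = damping \<delta> * damping \<delta> / 16 * energy (U s)" using pos by (simp add: decay_rate_def)
    finally show "0 \<le> exp (decay_rate \<delta> * s) * (- (decay_rate \<delta> * H s + H' s))"
      using H'_le[OF s] by (intro mult_nonneg_nonneg) auto
  qed (use t in auto)
  then have "exp (decay_rate \<delta> * t) * H t \<le> H 0" by simp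
  then have "H t \<le> exp (- decay_rate \<delta> * t) * H 0" by (simp add: exp_minus field_simps)
  also have "\<dots> \<le> exp (- decay_rate \<delta> * t) * (H1_const \<delta> * energy (U 0))" using H_le[of 0] by (intro mult_left_mono) auto
  also have "energy (U 0) = energy f"
  proof -
    have "half_deriv (U 0) (hderiv f)"
      by (rule half_deriv_cong[OF smooth_poly_half_deriv[OF f]])
        (auto simp: U_def tcp_sg_time_0 \<delta>_pos \<delta>_less smooth_poly_continuous_on f)
    from energy_cong[OF this] show ?thesis by (simp add: energy_def[of f])
  qed
  finally show ?thesis using H_ge[OF t] by (simp add: U_def mult_ac)
qed

lemma closed_form_constants:
  "closed_form kappa" "closed_form pointwise_const" "closed_form bulk_const" "closed_form energy_const" "closed_form Poincare_const"
  "closed_form weighted_Poincare_const" "closed_form log_Sobolev_const" "closed_form damping" "closed_form variance_weight" "closed_form H1_const" "closed_form decay_rate"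
proof -
  show kappa: "closed_form kappa" unfolding kappa_def[abs_def] by (intro closed_form.intros) auto
  show pointwise_const: "closed_form pointwise_const" unfolding pointwise_const_def[abs_def] by (intro closed_form.intros kappa) auto
  show bulk_const: "closed_form bulk_const" unfolding bulk_const_def[abs_def] by (intro closed_form.intros kappa) auto
  show energy_const: "closed_form energy_const" unfolding energy_const_def[abs_def] by (intro closed_form.intros kappa pointwise_const) auto
  show Poincare_const: "closed_form Poincare_const" unfolding Poincare_const_def[abs_def] by (intro closed_form.intros bulk_const energy_const) auto
  show weighted_Poincare_const: "closed_form weighted_Poincare_const" unfolding weighted_Poincare_const_def[abs_def] by (intro closed_form.intros Poincare_const energy_const) auto
  show log_Sobolev_const: "closed_form log_Sobolev_const" unfolding log_Sobolev_const_def[abs_def] by (intro closed_form.intros kappa pointwise_const Poincare_const weighted_Poincare_const) auto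
  show damping: "closed_form damping" unfolding damping_def[abs_def] by (intro closed_form.intros) auto
  show variance_weight: "closed_form variance_weight" unfolding variance_weight_def[abs_def] by (intro closed_form.intros damping) auto
  show H1_const: "closed_form H1_const" unfolding H1_const_def[abs_def] by (intro closed_form.intros variance_weight Poincare_const) auto
  show "closed_form decay_rate" unfolding decay_rate_def[abs_def] by (intro closed_form.intros damping H1_const) auto
qed

theorem proposition3:
  shows "\<exists>c r :: real \<Rightarrow> real. closed_form c \<and> closed_form r \<and>
    (\<forall>\<delta>\<in>{0<..<1}. 0 < c \<delta> \<and> 0 < r \<delta> \<and>
      (\<forall>\<mu>. tcp_regular \<delta> \<longrightarrow> tcp_invariant \<delta> \<mu> \<longrightarrow> finite_moments \<mu> \<longrightarrow>
        (\<forall>f\<in>smooth_poly. \<forall>t>0.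
          Ent \<mu> (tcp_sg \<delta> t f) \<le> c \<delta> * exp (- r \<delta> * t) * (\<integral>x. (hderiv f x)\<^sup>2 \<partial>\<mu>))))"
proof (rule exI[of _ "\<lambda>d. log_Sobolev_const d * H1_const d"], rule exI[of _ decay_rate], intro conjI ballI allI impI)
  show "closed_form (\<lambda>d. log_Sobolev_const d * H1_const d)" by (intro cf_mult closed_form_constants)
  show "closed_form decay_rate" by (rule closed_form_constants)
  fix \<delta> :: real assume "\<delta> \<in> {0<..<1}"
  then have \<delta>: "0 < \<delta>" "\<delta> < 1" by auto
  note pos = constants_pos[OF \<delta>]
  show "0 < log_Sobolev_const \<delta> * H1_const \<delta>" "0 < decay_rate \<delta>" using pos by auto
  fix \<mu> f and t :: real
  assume reg: "tcp_regular \<delta>" and inv: "tcp_invariant \<delta> \<mu>" and mom: "finite_moments \<mu>"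
    and f: "f \<in> smooth_poly" and t: "0 < t"
  interpret stationary_half_line \<mu> \<delta> by (rule invariant_stationary[OF \<delta> reg inv mom])
  have "Ent \<mu> (tcp_sg \<delta> t f) \<le> log_Sobolev_const \<delta> * energy (tcp_sg \<delta> t f)"
    using t by (intro log_Sobolev regular_semigroup(2)[OF reg f]) simp
  also have "\<dots> \<le> log_Sobolev_const \<delta> * (H1_const \<delta> * exp (- decay_rate \<delta> * t) * energy f)"
    using pos t by (intro mult_left_mono energy_decay[OF reg inv f]) auto
  finally show "Ent \<mu> (tcp_sg \<delta> t f) \<le> log_Sobolev_const \<delta> * H1_const \<delta> * exp (- decay_rate \<delta> * t) * (\<integral>x. (hderiv f x)\<^sup>2 \<partial>\<mu>)"
    by (simp add: energy_def mult_ac)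
qed

end
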